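(* Let $\mathfrak g$ be a complex semisimple Lie algebra. For $F\in\mathcal S^m(\mathfrak g)^{\mathfrak g}$ with $m\ge4$, the symmetrisation $\varpi(F)[-1]:=\varpi(F[-1])\in\mathcal U(t^{-1}\mathfrak g[t^{-1}])$ is an element of the Feigin--Frenkel centre $\mathfrak z(\widehat{\mathfrak g})$ if and only if $\mathsf m(F)=0$.
   Context: Put $\widehat{\mathfrak g}^-=t^{-1}\mathfrak g[t^{-1}]$ and $x[a]=xt^a$. The symmetrisation map $\varpi:\mathcal S(\mathfrak q)\to\mathcal U(\mathfrak q)$ is $\varpi(y_1\cdots y_k)=\frac1{k!}\sum_{\sigma\in S_k}y_{\sigma(1)}\cdots y_{\sigma(k)}$; the analogous map $\mathcal S^k(\mathfrak q)\to\mathfrak q^{\otimes k}$ is also denoted $\varpi$. For $F\in\mathcal S(\mathfrak g)$, $F[-1]\in\mathcal S(\mathfrak gt^{-1})$ is its image under the isomorphism induced by $x\mapsto x[-1]$. The Feigin--Frenkel centre $\mathfrak z(\widehat{\mathfrak g})\subset\mathcal U(\widehat{\mathfrak g}^-)$ is the centre of the universal affine vertex algebra at the critical level (the space of $\mathfrak g[t]$-invariant vectors in the vacuum module at the critical level, identified as a vector space with $\mathcal U(\widehat{\mathfrak g}^-)$). By a theorem of Rybnikov it equals the centraliser in $\mathcal U(\widehat{\mathfrak g}^-)$ of $\mathcal H[-1]=\sum_i x_i[-1]x_i[-1]$, where $\{x_i\}$ is an orthonormal basis of $\mathfrak g$ for a fixed non-degenerate $\mathfrak g$-invariant scalar product,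 chosen so that $\sum_i\operatorname{ad}(x_i)^2$ acts on $\mathfrak g$ as a scalar (automatic if $\mathfrak g$ is simple). The map $\mathsf m$: embed $\mathcal S^k(\mathfrak g)$ in $\mathfrak g^{\otimes k}$ via $\varpi$ and, for $k\ge3$, let $\mathsf m:\mathcal S^k(\mathfrak g)\to\mathfrak{gl}(\mathfrak g)\otimes\mathcal S^{k-3}(\mathfrak g)$ be the restriction of $y_1\otimes\dots\otimes y_k\mapsto \operatorname{ad}(y_1)\operatorname{ad}(y_2)\operatorname{ad}(y_3)\otimes y_4\otimes\dots\otimes y_k$. Its image lies in $\mathfrak{so}(\mathfrak g)\otimes\mathcal S^{k-3}(\mathfrak g)\cong\Lambda^2\mathfrak g\otimes\mathcal S^{k-3}(\mathfrak g)$. *)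

theory Defs
  imports Complex_Main "HOL-Library.Poly_Mapping" "HOL-Combinatorics.Permutations"
begin

section \<open>Complex vector spaces and algebras\<close>

class complex_vector = ab_group_add +
  fixes scaleC :: "complex \<Rightarrow> 'a \<Rightarrow> 'a"  (infixr \<open>*\<^sub>C\<close> 75)
  assumes scaleC_add_right: "a *\<^sub>C (x + y) = a *\<^sub>C x + a *\<^sub>C y"
    and scaleC_add_left: "(a + b) *\<^sub>C x = a *\<^sub>C x + b *\<^sub>C x"
    and scaleC_scaleC [simp]: "a *\<^sub>C b *\<^sub>C x = (a * b) *\<^sub>C x"
    and scaleC_one [simp]: "1 *\<^sub>C x = x"

global_interpretation cvec: vector_space "scaleC :: complex \<Rightarrow> 'a \<Rightarrow> 'a::complex_vector"
  by unfold_locales (simp_all add: scaleC_add_right scaleC_add_left)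

abbreviation clinear :: "('a::complex_vector \<Rightarrow> 'b::complex_vector) \<Rightarrow> bool"
  where "clinear f \<equiv> Vector_Spaces.linear scaleC scaleC f"

lemma clinearI:
  assumes "\<And>x y. f (x + y) = f x + f y" "\<And>c x. f (c *\<^sub>C x) = c *\<^sub>C f x"
  shows "clinear f"
  using assms by unfold_locales auto

lemma clinear_add: "clinear f \<Longrightarrow> f (x + y) = f x + f y"
  by (simp add: Vector_Spaces.linear_iff)

lemma clinear_scale: "clinear f \<Longrightarrow> f (c *\<^sub>C x) = c *\<^sub>C f x"
  by (simp add: Vector_Spaces.linear_iff)

lemma clinear_0: "clinear f \<Longrightarrow> f 0 = 0"
  using clinear_scale[of f 0 0] by simp

lemma clinear_diff: "clinear f \<Longrightarrow> f (x - y) = f x - f y"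
  using clinear_add[of f "x - y" y] by simp

lemma clinear_sum: "clinear f \<Longrightarrow> f (\<Sum>i\<in>I. g i) = (\<Sum>i\<in>I. f (g i))"
  by (induction I rule: infinite_finite_induct) (auto simp: clinear_0 clinear_add)

class complex_algebra_1 = complex_vector + ring_1 +
  assumes mult_scaleC_left [simp]: "a *\<^sub>C x * y = a *\<^sub>C (x * y)"
    and mult_scaleC_right [simp]: "x * a *\<^sub>C y = a *\<^sub>C (x * y)"

instantiation complex :: complex_algebra_1
begin
definition scaleC_complex_def [simp]: "scaleC a (x::complex) = a * x"
instance by standard (simp_all add: algebra_simps)
end

instantiation poly_mapping :: (type, complex_vector) complex_vector
begin
lift_definition scaleC_poly_mapping :: "complex \<Rightarrow> ('a \<Rightarrow>\<^sub>0 'b) \<Rightarrow> 'a \<Rightarrow>\<^sub>0 'b"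
  is "\<lambda>c f k. c *\<^sub>C f k"
  by (erule rev_finite_subset) auto
instance
  by standard (transfer, simp add: scaleC_add_right scaleC_add_left)+
end

lemma lookup_scaleC [simp]: "Poly_Mapping.lookup (c *\<^sub>C p) k = c *\<^sub>C Poly_Mapping.lookup p k"
  by transfer simp

lemma scaleC_single [simp]: "c *\<^sub>C Poly_Mapping.single k x = Poly_Mapping.single k (c *\<^sub>C x)"
  by (rule poly_mapping_eqI) (auto simp: Poly_Mapping.lookup_single when_def)

lemma poly_mapping_single_induct [case_names single add]:
  assumes "\<And>k v. P (Poly_Mapping.single k v)" "\<And>p q. P p \<Longrightarrow> P q \<Longrightarrow> P (p + q)"
  shows "P (p :: 'a \<Rightarrow>\<^sub>0 'b::comm_monoid_add)"
proof -
  have eq: "p = (\<Sum>k\<in>Poly_Mapping.keys p. Poly_Mapping.single k (Poly_Mapping.lookup p k))"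
    by (rule poly_mapping_eqI)
       (auto simp: Poly_Mapping.lookup_sum Poly_Mapping.lookup_single when_def Poly_Mapping.in_keys_iff
             intro!: sum.neutral[symmetric] split: if_splits)
  have "P (\<Sum>k\<in>S. Poly_Mapping.single k (Poly_Mapping.lookup p k))" for S
    using assms(1)[of undefined 0]
    by (induction S rule: infinite_finite_induct) (auto intro: assms)
  from this[of "Poly_Mapping.keys p"] show ?thesis by (simp flip: eq)
qed

definition lin_ext :: "('k \<Rightarrow> 'b::complex_vector) \<Rightarrow> ('k \<Rightarrow>\<^sub>0 complex) \<Rightarrow> 'b"
  where "lin_ext f p = (\<Sum>k\<in>Poly_Mapping.keys p. Poly_Mapping.lookup p k *\<^sub>C f k)"

lemma lin_ext_superset:
  "finite S \<Longrightarrow> Poly_Mapping.keys p \<subseteq> S \<Longrightarrow> lin_ext f p = (\<Sum>k\<in>S. Poly_Mapping.lookup p k *\<^sub>C f k)"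
  unfolding lin_ext_def by (rule sum.mono_neutral_left) (auto simp: Poly_Mapping.in_keys_iff)

lemma lin_ext_single [simp]: "lin_ext f (Poly_Mapping.single k c) = c *\<^sub>C f k"
  by (auto simp: lin_ext_def)

lemma clinear_lin_ext: "clinear (lin_ext f)"
proof (rule clinearI)
  fix p q :: "'a \<Rightarrow>\<^sub>0 complex" and c :: complex
  let ?S = "Poly_Mapping.keys p \<union> Poly_Mapping.keys q"
  have "finite ?S" "Poly_Mapping.keys (p + q) \<subseteq> ?S" by (auto simp: Poly_Mapping.in_keys_iff Poly_Mapping.lookup_add)
  then show "lin_ext f (p + q) = lin_ext f p + lin_ext f q"
    by (simp add: lin_ext_superset[of ?S] Poly_Mapping.lookup_add scaleC_add_left sum.distrib)
  have "Poly_Mapping.keys (c *\<^sub>C p) \<subseteq> Poly_Mapping.keys p" by (auto simp: Poly_Mapping.in_keys_iff)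
  then show "lin_ext f (c *\<^sub>C p) = c *\<^sub>C lin_ext f p"
    by (simp add: lin_ext_superset[of "Poly_Mapping.keys p"] cvec.scale_sum_right)
qed

section \<open>Tensor products of vector spaces\<close>

definition bilinear_rels ::
    "(('a::complex_vector \<times> 'b::complex_vector) \<Rightarrow>\<^sub>0 complex) set"
  where "bilinear_rels =
      {Poly_Mapping.single (a + a', b) 1 - Poly_Mapping.single (a, b) 1
         - Poly_Mapping.single (a', b) 1 | a a' b. True}
    \<union> {Poly_Mapping.single (a, b + b') 1 - Poly_Mapping.single (a, b) 1
         - Poly_Mapping.single (a, b') 1 | a b b'. True}
    \<union> {Poly_Mapping.single (c *\<^sub>C a, b) 1 - Poly_Mapping.single (a, b) c | a b c. True}
    \<union> {Poly_Mapping.single (a, c *\<^sub>C b) 1 - Poly_Mapping.single (a, b) c | a b c. True}"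

quotient_type (overloaded) ('a, 'b) tensor_prod =
    "('a::complex_vector \<times> 'b::complex_vector) \<Rightarrow>\<^sub>0 complex"
  / "\<lambda>p q. p - q \<in> cvec.span bilinear_rels"
proof (rule equivpI)
  show "symp (\<lambda>p q::('a \<times> 'b) \<Rightarrow>\<^sub>0 complex. p - q \<in> cvec.span bilinear_rels)"
    by (rule sympI) (drule cvec.span_neg, simp)
  show "transp (\<lambda>p q::('a \<times> 'b) \<Rightarrow>\<^sub>0 complex. p - q \<in> cvec.span bilinear_rels)"
    by (rule transpI) (drule (1) cvec.span_add, simp)
qed (simp add: reflpI cvec.span_zero)

instantiation tensor_prod :: (complex_vector, complex_vector) complex_vector
begin
lift_definition zero_tensor_prod :: "('a, 'b) tensor_prod" is 0 .
lift_definition plus_tensor_prod ::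
    "('a, 'b) tensor_prod \<Rightarrow> ('a, 'b) tensor_prod \<Rightarrow> ('a, 'b) tensor_prod" is "(+)"
  by (drule (1) cvec.span_add) (simp add: algebra_simps)
lift_definition uminus_tensor_prod ::
    "('a, 'b) tensor_prod \<Rightarrow> ('a, 'b) tensor_prod" is uminus
  by (drule cvec.span_neg) simp
lift_definition minus_tensor_prod ::
    "('a, 'b) tensor_prod \<Rightarrow> ('a, 'b) tensor_prod \<Rightarrow> ('a, 'b) tensor_prod" is "(-)"
  by (drule (1) cvec.span_diff) (simp add: algebra_simps)
lift_definition scaleC_tensor_prod ::
    "complex \<Rightarrow> ('a, 'b) tensor_prod \<Rightarrow> ('a, 'b) tensor_prod" is scaleC
  by (drule cvec.span_scale) (simp add: cvec.scale_right_diff_distrib)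
instance
  by standard
     (transfer, simp add: scaleC_add_right scaleC_add_left cvec.span_zero add.assoc add.commute)+
end

lift_definition tensor :: "'a::complex_vector \<Rightarrow> 'b::complex_vector \<Rightarrow> ('a, 'b) tensor_prod"
    (infixr \<open>\<otimes>\<^sub>C\<close> 70)
  is "\<lambda>a b. Poly_Mapping.single (a, b) 1" .

lemma tensor_bilinear:
  "(a + a') \<otimes>\<^sub>C b = a \<otimes>\<^sub>C b + a' \<otimes>\<^sub>C b"
  "a \<otimes>\<^sub>C (b + b') = a \<otimes>\<^sub>C b + a \<otimes>\<^sub>C b'"
  "(c *\<^sub>C a) \<otimes>\<^sub>C b = c *\<^sub>C (a \<otimes>\<^sub>C b)"
  "a \<otimes>\<^sub>C (c *\<^sub>C b) = c *\<^sub>C (a \<otimes>\<^sub>C b)"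
  by (transfer, rule cvec.span_base, simp add: bilinear_rels_def diff_diff_eq[symmetric], blast)+

section \<open>Free, tensor, symmetric and enveloping algebras\<close>

text \<open>Lists form the free monoid under concatenation, so that finitely supported
  functions on lists, with the convolution product of \<^theory>\<open>HOL-Library.Poly_Mapping\<close>,
  form the free associative algebra.\<close>

instantiation list :: (type) monoid_add
begin
definition zero_list_def: "0 = []"
definition plus_list_def: "xs + ys = xs @ ys"
instance by standard (simp_all add: zero_list_def plus_list_def)
end

type_synonym 'a free_alg = "'a list \<Rightarrow>\<^sub>0 complex"

abbreviation word :: "'a list \<Rightarrow> 'a free_alg"
  where "word w \<equiv> Poly_Mapping.single w 1"

lemma word_append: "word (u @ v) = word u * word v"
  by (simp add: mult_single plus_list_def)

lemma word_Nil: "word [] = 1"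
  by (simp flip: zero_list_def)

lemma scaleC_free_alg: "c *\<^sub>C (p :: 'a free_alg) = Poly_Mapping.single [] c * p"
  by (induction p rule: poly_mapping_single_induct)
     (simp_all add: mult_single plus_list_def scaleC_add_right distrib_left)

lemma scaleC_free_alg': "c *\<^sub>C (p :: 'a free_alg) = p * Poly_Mapping.single [] c"
  by (induction p rule: poly_mapping_single_induct)
     (simp_all add: mult_single plus_list_def scaleC_add_right distrib_right mult.commute)

inductive_set ideal_gen :: "'r::ring_1 set \<Rightarrow> 'r set" for R
  where
    gen: "r \<in> R \<Longrightarrow> r \<in> ideal_gen R"
  | zero: "0 \<in> ideal_gen R"
  | add: "p \<in> ideal_gen R \<Longrightarrow> q \<in> ideal_gen R \<Longrightarrow> p + q \<in> ideal_gen R"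
  | mult_left: "p \<in> ideal_gen R \<Longrightarrow> a * p \<in> ideal_gen R"
  | mult_right: "p \<in> ideal_gen R \<Longrightarrow> p * a \<in> ideal_gen R"

lemma ideal_gen_uminus: "p \<in> ideal_gen R \<Longrightarrow> - p \<in> ideal_gen R"
  using ideal_gen.mult_left[of p R "- 1"] by simp

lemma ideal_gen_diff: "p \<in> ideal_gen R \<Longrightarrow> q \<in> ideal_gen R \<Longrightarrow> p - q \<in> ideal_gen R"
  using ideal_gen.add[OF _ ideal_gen_uminus, of p R q] by simp

lemma ideal_gen_scaleC: "(p :: 'a free_alg) \<in> ideal_gen R \<Longrightarrow> c *\<^sub>C p \<in> ideal_gen R"
  by (simp add: scaleC_free_alg ideal_gen.mult_left)

lemma equivp_ideal_gen: "equivp (\<lambda>p q. p - q \<in> ideal_gen R)"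
proof (rule equivpI)
  show "symp (\<lambda>p q. p - q \<in> ideal_gen R)"
    by (rule sympI) (drule ideal_gen_uminus, simp)
  show "transp (\<lambda>p q. p - q \<in> ideal_gen R)"
    by (rule transpI) (drule (1) ideal_gen.add, simp)
qed (simp add: reflpI ideal_gen.zero)

lemma ideal_gen_plus_cong:
  "p - p' \<in> ideal_gen R \<Longrightarrow> q - q' \<in> ideal_gen R \<Longrightarrow> (p + q) - (p' + q') \<in> ideal_gen R"
  by (drule (1) ideal_gen.add) (simp add: algebra_simps)

lemma ideal_gen_minus_cong:
  "p - p' \<in> ideal_gen R \<Longrightarrow> q - q' \<in> ideal_gen R \<Longrightarrow> (p - q) - (p' - q') \<in> ideal_gen R"
  using ideal_gen_diff[of "p - p'" R "q - q'"] by (simp add: algebra_simps)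

lemma ideal_gen_uminus_cong: "p - p' \<in> ideal_gen R \<Longrightarrow> (- p) - (- p') \<in> ideal_gen R"
  by (drule ideal_gen_uminus) simp

lemma ideal_gen_scaleC_cong:
  "(p :: 'a free_alg) - p' \<in> ideal_gen R \<Longrightarrow> c *\<^sub>C p - c *\<^sub>C p' \<in> ideal_gen R"
  by (drule ideal_gen_scaleC) (simp add: cvec.scale_right_diff_distrib)

lemma ideal_gen_times_cong:
  assumes "p - p' \<in> ideal_gen R" "q - q' \<in> ideal_gen R"
  shows "p * q - p' * q' \<in> ideal_gen R"
proof -
  have "p * q - p' * q' = p * (q - q') + (p - p') * q'" by (simp add: algebra_simps)
  with assms show ?thesis by (auto intro: ideal_gen.intros)
qed

lemma lin_ext_ideal_gen:
  assumes R: "\<And>r u v. r \<in> R \<Longrightarrow> lin_ext f (word u * r * word v) = 0"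
    and p: "p \<in> ideal_gen R"
  shows "lin_ext f p = 0"
proof -
  note lin = clinear_lin_ext[of f]
  have "\<forall>a b. lin_ext f (a * p * b) = 0"
    using p
  proof induction
    case (gen r)
    have "lin_ext f (a * r * word v) = 0" for a v
    proof (induction a rule: poly_mapping_single_induct)
      case (single k c)
      have "Poly_Mapping.single k c * r * word v = c *\<^sub>C (word k * r * word v)"
        by (simp add: scaleC_free_alg mult_single plus_list_def flip: mult.assoc)
      then show ?case using R[OF gen] by (simp add: clinear_scale[OF lin])
    qed (simp add: distrib_right clinear_add[OF lin])
    note 1 = this
    have "lin_ext f (a * r * b) = 0" for a b
    proof (induction b rule: poly_mapping_single_induct)
      case (single k c)
      have "a * r * Poly_Mapping.single k c = c *\<^sub>C (a * r * word k)"
        by (simp add: scaleC_free_alg' mult_single plus_list_def mult.assoc)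
      then show ?case using 1 by (simp add: clinear_scale[OF lin])
    qed (simp add: distrib_left clinear_add[OF lin])
    then show ?case by blast
  next
    case (add p q)
    then show ?case by (simp add: distrib_left distrib_right clinear_add[OF lin])
  next
    case (mult_left p c)
    then show ?case by (simp flip: mult.assoc)
  next
    case (mult_right p c)
    then show ?case by (simp add: mult.assoc)
  qed (simp add: clinear_0[OF lin])
  from this[rule_format, of 1 1] show ?thesis by simp
qed

definition linear_rels :: "'a::complex_vector free_alg set"
  where "linear_rels = {word [x + y] - word [x] - word [y] | x y. True}
    \<union> {word [c *\<^sub>C x] - c *\<^sub>C word [x] | c x. True}"

definition comm_rels :: "'a free_alg set"
  where "comm_rels = {word [x, y] - word [y, x] | x y. True}"

definition word_linear :: "('a::complex_vector list \<Rightarrow> 'b::complex_vector) \<Rightarrow> bool"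
  where "word_linear f \<longleftrightarrow>
    (\<forall>u v x y. f (u @ (x + y) # v) = f (u @ x # v) + f (u @ y # v)) \<and>
    (\<forall>u v c x. f (u @ (c *\<^sub>C x) # v) = c *\<^sub>C f (u @ x # v))"

lemma word_linearD:
  assumes "word_linear f"
  shows "f (u @ (x + y) # v) = f (u @ x # v) + f (u @ y # v)"
    "f (u @ (c *\<^sub>C x) # v) = c *\<^sub>C f (u @ x # v)"
  using assms by (auto simp: word_linear_def)

lemma lin_ext_linear_rels:
  assumes "word_linear f" "r \<in> linear_rels"
  shows "lin_ext f (word u * r * word v) = 0"
  using assms
  by (auto simp: linear_rels_def left_diff_distrib right_diff_distrib mult_single plus_list_def
      word_linearD clinear_diff[OF clinear_lin_ext])

lemma lin_ext_comm_rels: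
  assumes "\<And>u v x y. f (u @ x # y # v) = f (u @ y # x # v)" "r \<in> comm_rels"
  shows "lin_ext f (word u * r * word v) = 0"
  using assms
  by (auto simp: comm_rels_def left_diff_distrib right_diff_distrib mult_single plus_list_def
      clinear_diff[OF clinear_lin_ext])

definition counit_word :: "'a list \<Rightarrow> complex"
  where "counit_word w = (if w = [] then 1 else 0)"

lemma counit_linear: "word_linear counit_word"
  by (simp add: word_linear_def counit_word_def)

lemma one_notin_ideal_gen:
  assumes "\<And>r u v. r \<in> R \<Longrightarrow> lin_ext counit_word (word u * r * word v) = 0"
  shows "0 - (1 :: 'a free_alg) \<notin> ideal_gen R"
proof
  assume "0 - (1 :: 'a free_alg) \<in> ideal_gen R"
  then have "lin_ext counit_word (0 - (1 :: 'a free_alg)) = 0"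
    by (rule lin_ext_ideal_gen[rotated]) (rule assms)
  then have "lin_ext counit_word (0 - word [] :: 'a free_alg) = 0"
    unfolding word_Nil .
  then show False
    unfolding clinear_diff[OF clinear_lin_ext] by (simp add: clinear_0[OF clinear_lin_ext] counit_word_def)
qed

subsection \<open>The tensor algebra\<close>

quotient_type (overloaded) 'a tensor_alg = "('a::complex_vector) free_alg"
  / "\<lambda>p q. p - q \<in> ideal_gen linear_rels"
  by (rule equivp_ideal_gen)

instantiation tensor_alg :: (complex_vector) complex_algebra_1
begin
lift_definition zero_tensor_alg :: "'a tensor_alg" is 0 .
lift_definition one_tensor_alg :: "'a tensor_alg" is 1 .
lift_definition plus_tensor_alg :: "'a tensor_alg \<Rightarrow> 'a tensor_alg \<Rightarrow> 'a tensor_alg" is "(+)"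
  by (rule ideal_gen_plus_cong)
lift_definition minus_tensor_alg :: "'a tensor_alg \<Rightarrow> 'a tensor_alg \<Rightarrow> 'a tensor_alg" is "(-)"
  by (rule ideal_gen_minus_cong)
lift_definition uminus_tensor_alg :: "'a tensor_alg \<Rightarrow> 'a tensor_alg" is uminus
  by (rule ideal_gen_uminus_cong)
lift_definition times_tensor_alg :: "'a tensor_alg \<Rightarrow> 'a tensor_alg \<Rightarrow> 'a tensor_alg" is "(*)"
  by (rule ideal_gen_times_cong)
lift_definition scaleC_tensor_alg :: "complex \<Rightarrow> 'a tensor_alg \<Rightarrow> 'a tensor_alg" is scaleC
  by (rule ideal_gen_scaleC_cong)
instance
proof
  show "(0 :: 'a tensor_alg) \<noteq> 1"
    by transfer (rule one_notin_ideal_gen[OF lin_ext_linear_rels[OF counit_linear]])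
  fix a :: complex and x y :: "'a tensor_alg"
  show "a *\<^sub>C x * y = a *\<^sub>C (x * y)"
    by transfer (simp add: scaleC_free_alg mult.assoc ideal_gen.zero)
  show "x * a *\<^sub>C y = a *\<^sub>C (x * y)"
    by transfer (simp add: scaleC_free_alg' mult.assoc ideal_gen.zero)
qed (transfer, simp add: ideal_gen.zero algebra_simps scaleC_add_right scaleC_add_left)+
end

lift_definition tensor_word :: "'a::complex_vector list \<Rightarrow> 'a tensor_alg" is word .

text \<open>The linear map out of the quotient that takes prescribed values on words.  It is
  computed on a chosen representative; this is independent of the choice, and hence linear,
  whenever the prescribed values respect the defining relations.\<close>

definition tensor_lift :: "('a::complex_vector list \<Rightarrow> 'b::complex_vector) \<Rightarrow> 'a tensor_alg \<Rightarrow> 'b"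
  where "tensor_lift f t = lin_ext f (rep_tensor_alg t)"

lemma tensor_lift_abs:
  assumes "word_linear f"
  shows "tensor_lift f (abs_tensor_alg p) = lin_ext f p"
proof -
  have "rep_tensor_alg (abs_tensor_alg p) - p \<in> ideal_gen linear_rels"
    by (rule Quotient3_rep_abs[OF Quotient3_tensor_alg]) (simp add: ideal_gen.zero)
  then have "lin_ext f (rep_tensor_alg (abs_tensor_alg p) - p) = 0"
    by (rule lin_ext_ideal_gen[rotated]) (rule lin_ext_linear_rels[OF assms])
  then show ?thesis by (simp add: tensor_lift_def clinear_diff[OF clinear_lin_ext])
qed

lemma tensor_lift_word: "word_linear f \<Longrightarrow> tensor_lift f (tensor_word w) = f w"
  by (simp add: tensor_word.abs_eq tensor_lift_abs)

lemma clinear_tensor_lift: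
  assumes "word_linear f"
  shows "clinear (tensor_lift f)"
proof (rule clinearI)
  fix x y :: "'a tensor_alg" and c :: complex
  show "tensor_lift f (x + y) = tensor_lift f x + tensor_lift f y"
    by (induction x; induction y)
       (simp add: plus_tensor_alg.abs_eq tensor_lift_abs[OF assms] clinear_add[OF clinear_lin_ext])
  show "tensor_lift f (c *\<^sub>C x) = c *\<^sub>C tensor_lift f x"
    by (induction x)
       (simp add: scaleC_tensor_alg.abs_eq tensor_lift_abs[OF assms] clinear_scale[OF clinear_lin_ext])
qed

lemma tensor_word_append: "tensor_word (u @ v) = tensor_word u * tensor_word v"
  by transfer (simp add: word_append ideal_gen.zero)

lemma tensor_word_linear: "word_linear tensor_word"
proof -
  have 1: "tensor_word [x + y] = tensor_word [x] + tensor_word [y]" for x y :: 'a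
    by transfer (rule ideal_gen.gen, auto simp: linear_rels_def diff_diff_eq)
  have 2: "tensor_word [c *\<^sub>C x] = c *\<^sub>C tensor_word [x]" for c and x :: 'a
    by transfer (rule ideal_gen.gen, unfold linear_rels_def, blast)
  have 3: "tensor_word (u @ x # v) = tensor_word u * tensor_word [x] * tensor_word v" for u v and x :: 'a
    by (simp flip: tensor_word_append)
  show ?thesis
    unfolding word_linear_def 3 1 2 by (simp add: algebra_simps)
qed

subsection \<open>The symmetric algebra\<close>

quotient_type (overloaded) 'a sym_alg = "('a::complex_vector) free_alg"
  / "\<lambda>p q. p - q \<in> ideal_gen (linear_rels \<union> comm_rels)"
  by (rule equivp_ideal_gen)

lift_definition sym_word :: "'a::complex_vector list \<Rightarrow> 'a sym_alg" is word .

lemma lin_ext_sym_rels: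
  assumes "word_linear f" "\<And>u v x y. f (u @ x # y # v) = f (u @ y # x # v)"
    and "r \<in> linear_rels \<union> comm_rels"
  shows "lin_ext f (word u * r * word v) = 0"
  using assms lin_ext_linear_rels lin_ext_comm_rels by blast

lemma counit_sym_rels:
  "r \<in> linear_rels \<union> comm_rels \<Longrightarrow> lin_ext counit_word (word u * r * word v) = 0"
  by (rule lin_ext_sym_rels[OF counit_linear]) (simp_all add: counit_word_def)

lemma free_alg_comm:
  "(p :: 'a free_alg) * q - q * p \<in> ideal_gen (R \<union> comm_rels)"
proof -
  let ?I = "ideal_gen (R \<union> comm_rels) :: 'a free_alg set"
  have 1: "word [x] * word v - word v * word [x] \<in> ?I" for x :: 'a and v
  proof (induction v)
    case (Cons y v)
    have "word [x] * word [y] - word [y] * word [x] \<in> ?I"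
      by (rule ideal_gen.gen) (auto simp: comm_rels_def simp flip: word_append)
    from ideal_gen.add[OF ideal_gen.mult_right[OF this] ideal_gen.mult_left[OF Cons]]
    have "(word [x] * word [y] - word [y] * word [x]) * word v
        + word [y] * (word [x] * word v - word v * word [x]) \<in> ?I" .
    moreover have "word (y # v) = word [y] * word v"
      using word_append[of "[y]" v] by simp
    ultimately show ?case by (simp add: algebra_simps)
  qed (simp add: word_Nil ideal_gen.zero)
  have 2: "word u * word v - word v * word u \<in> ?I" for u v :: "'a list"
  proof (induction u)
    case (Cons x u)
    from ideal_gen.add[OF ideal_gen.mult_right[OF 1[of x v]] ideal_gen.mult_left[OF Cons]]
    have "(word [x] * word v - word v * word [x]) * word u
        + word [x] * (word u * word v - word v * word u) \<in> ?I" .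
    moreover have "word (x # u) = word [x] * word u"
      using word_append[of "[x]" u] by simp
    ultimately show ?case by (simp add: algebra_simps)
  qed (simp add: word_Nil ideal_gen.zero)
  have "Poly_Mapping.single u c * q - q * Poly_Mapping.single u c \<in> ?I" for u c
  proof (induction q rule: poly_mapping_single_induct)
    case (single v d)
    have "Poly_Mapping.single u c * Poly_Mapping.single v d
        - Poly_Mapping.single v d * Poly_Mapping.single u c
        = (c * d) *\<^sub>C (word u * word v - word v * word u)"
      by (simp add: mult_single mult.commute cvec.scale_right_diff_distrib)
    with 2 show ?case by (simp add: ideal_gen_scaleC)
  next
    case (add p q)
    from ideal_gen.add[OF add] show ?case by (simp add: algebra_simps)
  qed
  note 3 = this
  show ?thesis
  proof (induction p rule: poly_mapping_single_induct)
    case (add p p')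
    from ideal_gen.add[OF add] show ?case by (simp add: algebra_simps)
  qed (rule 3)
qed

instantiation sym_alg :: (complex_vector) "{complex_algebra_1, comm_ring_1}"
begin
lift_definition zero_sym_alg :: "'a sym_alg" is 0 .
lift_definition one_sym_alg :: "'a sym_alg" is 1 .
lift_definition plus_sym_alg :: "'a sym_alg \<Rightarrow> 'a sym_alg \<Rightarrow> 'a sym_alg" is "(+)"
  by (rule ideal_gen_plus_cong)
lift_definition minus_sym_alg :: "'a sym_alg \<Rightarrow> 'a sym_alg \<Rightarrow> 'a sym_alg" is "(-)"
  by (rule ideal_gen_minus_cong)
lift_definition uminus_sym_alg :: "'a sym_alg \<Rightarrow> 'a sym_alg" is uminus
  by (rule ideal_gen_uminus_cong)
lift_definition times_sym_alg :: "'a sym_alg \<Rightarrow> 'a sym_alg \<Rightarrow> 'a sym_alg" is "(*)"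
  by (rule ideal_gen_times_cong)
lift_definition scaleC_sym_alg :: "complex \<Rightarrow> 'a sym_alg \<Rightarrow> 'a sym_alg" is scaleC
  by (rule ideal_gen_scaleC_cong)
instance
proof
  show "(0 :: 'a sym_alg) \<noteq> 1"
    by transfer (rule one_notin_ideal_gen[OF counit_sym_rels])
  fix a :: complex and x y :: "'a sym_alg"
  show "a *\<^sub>C x * y = a *\<^sub>C (x * y)"
    by transfer (simp add: scaleC_free_alg mult.assoc ideal_gen.zero)
  show "x * a *\<^sub>C y = a *\<^sub>C (x * y)"
    by transfer (simp add: scaleC_free_alg' mult.assoc ideal_gen.zero)
  show "x * y = y * x"
    by transfer (rule free_alg_comm)
qed (transfer, simp add: ideal_gen.zero algebra_simps scaleC_add_right scaleC_add_left)+
end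

definition sym_lift :: "('a::complex_vector list \<Rightarrow> 'b::complex_vector) \<Rightarrow> 'a sym_alg \<Rightarrow> 'b"
  where "sym_lift f s = lin_ext f (rep_sym_alg s)"

definition sym_word_linear :: "('a::complex_vector list \<Rightarrow> 'b::complex_vector) \<Rightarrow> bool"
  where "sym_word_linear f \<longleftrightarrow>
    word_linear f \<and> (\<forall>u v x y. f (u @ x # y # v) = f (u @ y # x # v))"

lemma sym_lift_abs:
  assumes "sym_word_linear f"
  shows "sym_lift f (abs_sym_alg p) = lin_ext f p"
proof -
  have "rep_sym_alg (abs_sym_alg p) - p \<in> ideal_gen (linear_rels \<union> comm_rels)"
    by (rule Quotient3_rep_abs[OF Quotient3_sym_alg]) (simp add: ideal_gen.zero)
  then have "lin_ext f (rep_sym_alg (abs_sym_alg p) - p) = 0"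
    by (rule lin_ext_ideal_gen[rotated])
       (use assms in \<open>auto simp: sym_word_linear_def intro!: lin_ext_sym_rels\<close>)
  then show ?thesis by (simp add: sym_lift_def clinear_diff[OF clinear_lin_ext])
qed

lemma sym_lift_word: "sym_word_linear f \<Longrightarrow> sym_lift f (sym_word w) = f w"
  by (simp add: sym_word.abs_eq sym_lift_abs)

lemma clinear_sym_lift:
  assumes "sym_word_linear f"
  shows "clinear (sym_lift f)"
proof (rule clinearI)
  fix x y :: "'a sym_alg" and c :: complex
  show "sym_lift f (x + y) = sym_lift f x + sym_lift f y"
    by (induction x; induction y)
       (simp add: plus_sym_alg.abs_eq sym_lift_abs[OF assms] clinear_add[OF clinear_lin_ext])
  show "sym_lift f (c *\<^sub>C x) = c *\<^sub>C sym_lift f x"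
    by (induction x)
       (simp add: scaleC_sym_alg.abs_eq sym_lift_abs[OF assms] clinear_scale[OF clinear_lin_ext])
qed

lemma sym_word_append: "sym_word (u @ v) = sym_word u * sym_word v"
  by transfer (simp add: word_append ideal_gen.zero)

lemma sym_word_linear: "sym_word_linear sym_word"
proof -
  have 1: "sym_word [x + y] = sym_word [x] + sym_word [y]" for x y :: 'a
    by transfer (rule ideal_gen.gen, auto simp: linear_rels_def diff_diff_eq)
  have 2: "sym_word [c *\<^sub>C x] = c *\<^sub>C sym_word [x]" for c and x :: 'a
    by transfer (rule ideal_gen.gen, unfold linear_rels_def, blast)
  have 3: "sym_word (x # v) = sym_word [x] * sym_word v" for v and x :: 'a
    by (simp flip: sym_word_append)
  have 4: "sym_word (u @ x # v) = sym_word u * sym_word [x] * sym_word v" for u v and x :: 'a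
    by (simp flip: sym_word_append)
  have "word_linear (sym_word :: 'a list \<Rightarrow> _)"
    unfolding word_linear_def 4 1 2 by (simp add: algebra_simps)
  moreover have "sym_word (u @ x # y # v) = sym_word (u @ y # x # v)" for u v and x y :: 'a
    unfolding sym_word_append 3[of _ "_ # _"] 3[of _ v] by (simp add: mult_ac)
  ultimately show ?thesis by (simp add: sym_word_linear_def)
qed

definition sym_power :: "nat \<Rightarrow> 'a::complex_vector sym_alg set"
  where "sym_power k = cvec.span {sym_word w | w. length w = k}"

section \<open>Lie algebras\<close>

class lie_algebra = complex_vector +
  fixes bracket :: "'a \<Rightarrow> 'a \<Rightarrow> 'a"
  assumes bracket_add_left: "bracket (x + y) z = bracket x z + bracket y z"
    and bracket_add_right: "bracket x (y + z) = bracket x y + bracket x z"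
    and bracket_scaleC_left: "bracket (c *\<^sub>C x) y = c *\<^sub>C bracket x y"
    and bracket_scaleC_right: "bracket x (c *\<^sub>C y) = c *\<^sub>C bracket x y"
    and bracket_self [simp]: "bracket x x = 0"
    and jacobi: "bracket x (bracket y z) + bracket y (bracket z x) + bracket z (bracket x y) = 0"
begin

lemma bracket_zero [simp]: "bracket 0 x = 0" "bracket x 0 = 0"
  using bracket_add_left[of 0 0 x] bracket_add_right[of x 0 0] by simp_all

lemma bracket_antisym: "bracket x y = - bracket y x"
proof -
  have "bracket (x + y) (x + y) = 0" by (rule bracket_self)
  then have "bracket x y + bracket y x = 0"
    unfolding bracket_add_left bracket_add_right by (simp add: add.commute)
  then show ?thesis by (simp add: eq_neg_iff_add_eq_0)
qed

lemma bracket_minus_left: "bracket (- x) y = - bracket x y"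
  using bracket_add_left[of x "- x" y] by (simp add: eq_neg_iff_add_eq_0 add.commute)

lemma bracket_minus_right: "bracket x (- y) = - bracket x y"
  using bracket_add_right[of x y "- y"] by (simp add: eq_neg_iff_add_eq_0 add.commute)

end

lemma clinear_bracket: "clinear (bracket (x :: 'a::lie_algebra))"
  by (rule clinearI) (simp_all add: bracket_add_right bracket_scaleC_right)

lemma bracket_bracket:
  "bracket (bracket x y) (z :: 'a::lie_algebra)
    = bracket x (bracket y z) - bracket y (bracket x z)"
proof -
  have "bracket (bracket x y) z = - bracket z (bracket x y)"
    by (rule bracket_antisym)
  also have "\<dots> = bracket x (bracket y z) + bracket y (bracket z x)"
    using jacobi[of x y z] by (simp add: neg_eq_iff_add_eq_0 add.commute)
  also have "bracket z x = - bracket x z" by (rule bracket_antisym)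
  finally show ?thesis by (simp add: bracket_minus_right)
qed

class fd_lie_algebra = lie_algebra +
  assumes finite_dimensional: "\<exists>B. finite B \<and> (\<forall>x. \<exists>c. x = (\<Sum>b\<in>B. c b *\<^sub>C b))"

definition lie_ideal :: "'a::lie_algebra set \<Rightarrow> bool"
  where "lie_ideal I \<longleftrightarrow> cvec.subspace I \<and> (\<forall>x. \<forall>y\<in>I. bracket x y \<in> I)"

definition derived :: "'a::lie_algebra set \<Rightarrow> 'a set"
  where "derived A = cvec.span {bracket x y | x y. x \<in> A \<and> y \<in> A}"

definition solvable :: "'a::lie_algebra set \<Rightarrow> bool"
  where "solvable A \<longleftrightarrow> (\<exists>n. (derived ^^ n) A = {0})"

definition semisimple :: "'a::fd_lie_algebra itself \<Rightarrow> bool"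
  where "semisimple _ \<longleftrightarrow> (\<forall>I::'a set. lie_ideal I \<longrightarrow> solvable I \<longrightarrow> I = {0})"

subsection \<open>Traces and the Killing form\<close>

abbreviation chosen_basis :: "'a::complex_vector set"
  where "chosen_basis \<equiv> cvec.extend_basis {}"

definition ctrace :: "('a::complex_vector \<Rightarrow> 'a) \<Rightarrow> complex"
  where "ctrace f = (\<Sum>b\<in>chosen_basis. cvec.representation chosen_basis (f b) b)"

definition killing :: "'a::fd_lie_algebra \<Rightarrow> 'a \<Rightarrow> complex"
  where "killing x y = ctrace (\<lambda>z. bracket x (bracket y z))"

lemma chosen_basis:
  "cvec.independent (chosen_basis :: 'a::fd_lie_algebra set)"
  "cvec.span (chosen_basis :: 'a set) = UNIV"
  "finite (chosen_basis :: 'a set)"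
proof -
  have 0: "cvec.independent ({} :: 'a set)" by (rule cvec.independent_empty)
  show 1: "cvec.independent (chosen_basis :: 'a set)"
    using 0 by (rule cvec.independent_extend_basis)
  show "cvec.span (chosen_basis :: 'a set) = UNIV"
    using 0 by (rule cvec.span_extend_basis)
  obtain B :: "'a set" where B: "finite B" "\<forall>x. \<exists>c. x = (\<Sum>b\<in>B. c b *\<^sub>C b)"
    using finite_dimensional by blast
  have "x \<in> cvec.span B" for x
  proof -
    obtain c where "x = (\<Sum>b\<in>B. c b *\<^sub>C b)" using B(2) by blast
    then show ?thesis by (simp add: cvec.span_base cvec.span_scale cvec.span_sum)
  qed
  with B have "finite B" "cvec.span B = UNIV"
    by auto
  with 1 show "finite (chosen_basis :: 'a set)"
    using cvec.independent_span_bound[of B chosen_basis] by auto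
qed

lemma ctrace_commute:
  fixes f g :: "'a::fd_lie_algebra \<Rightarrow> 'a"
  assumes "clinear f" "clinear g"
  shows "ctrace (\<lambda>x. f (g x)) = ctrace (\<lambda>x. g (f x))"
proof -
  let ?B = "chosen_basis :: 'a set" and ?R = "cvec.representation (chosen_basis :: 'a set)"
  have exp: "(\<Sum>b\<in>?B. ?R v b *\<^sub>C b) = v" for v
    using cvec.sum_representation_eq[of ?B v ?B] chosen_basis by auto
  have clin: "clinear (\<lambda>v. ?R v b)" for b
    by (rule clinearI) (simp_all add: cvec.representation_add cvec.representation_scale chosen_basis)
  have *: "ctrace (\<lambda>x. f (g x)) = (\<Sum>b\<in>?B. \<Sum>c\<in>?B. ?R (g b) c * ?R (f c) b)"
    if f: "clinear f" for f g :: "'a \<Rightarrow> 'a"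
  proof -
    have "?R (f (g b)) b = (\<Sum>c\<in>?B. ?R (g b) c * ?R (f c) b)" for b
    proof -
      have "?R (f (g b)) b = ?R (f (\<Sum>c\<in>?B. ?R (g b) c *\<^sub>C c)) b" by (simp add: exp)
      also have "\<dots> = (\<Sum>c\<in>?B. ?R (g b) c * ?R (f c) b)"
        by (simp add: clinear_sum[OF f] clinear_sum[OF clin] clinear_scale[OF f] clinear_scale[OF clin])
      finally show ?thesis .
    qed
    then show ?thesis by (simp add: ctrace_def)
  qed
  show ?thesis
    unfolding *[OF assms(1)] *[OF assms(2)] by (subst sum.swap) (simp add: mult.commute)
qed

lemma ctrace_linear:
  fixes f g :: "'a::fd_lie_algebra \<Rightarrow> 'a"
  shows "ctrace (\<lambda>x. f x + g x) = ctrace f + ctrace g"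
    and "ctrace (\<lambda>x. c *\<^sub>C f x) = c * ctrace f"
    and "ctrace (\<lambda>x. f x - g x) = ctrace f - ctrace g"
  by (simp_all add: ctrace_def cvec.representation_add cvec.representation_scale
      cvec.representation_diff chosen_basis sum.distrib sum_distrib_left sum_subtractf)

lemma killing_bilinear:
  "killing (x + y) z = killing x z + killing y z"
  "killing z (x + y) = killing z x + killing z y"
  "killing (c *\<^sub>C x) z = c * killing x z"
  "killing z (c *\<^sub>C x) = c * killing z x"
  by (simp_all add: killing_def ctrace_linear bracket_add_left bracket_add_right
      bracket_scaleC_left bracket_scaleC_right)

lemma killing_zero [simp]: "killing 0 x = 0" "killing x 0 = 0"
  using killing_bilinear(3)[of 0 0 x] killing_bilinear(4)[of x 0 0] by simp_all

lemma killing_sym: "killing x y = killing y x"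
  unfolding killing_def by (rule ctrace_commute) (rule clinear_bracket)+

lemma killing_invariant: "killing (bracket x y) z = killing x (bracket y z)"
proof -
  have "clinear (\<lambda>v. bracket x (bracket z v))"
    by (rule clinearI) (simp_all add: bracket_add_right bracket_scaleC_right)
  then have "ctrace (\<lambda>v. bracket y (bracket x (bracket z v)))
      = ctrace (\<lambda>v. bracket x (bracket z (bracket y v)))"
    by (rule ctrace_commute[OF clinear_bracket])
  then show ?thesis
    unfolding killing_def bracket_bracket
    by (simp add: ctrace_linear clinear_diff[OF clinear_bracket])
qed

subsection \<open>The universal enveloping algebra\<close>

definition lie_rels :: "'a::lie_algebra free_alg set"
  where "lie_rels = {word [x, y] - word [y, x] - word [bracket x y] | x y. True}"

quotient_type (overloaded) 'a uea = "('a::lie_algebra) free_alg"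
  / "\<lambda>p q. p - q \<in> ideal_gen (linear_rels \<union> lie_rels)"
  by (rule equivp_ideal_gen)

lift_definition uea_word :: "'a::lie_algebra list \<Rightarrow> 'a uea" is word .

definition uea_word_linear :: "('a::lie_algebra list \<Rightarrow> 'b::complex_vector) \<Rightarrow> bool"
  where "uea_word_linear f \<longleftrightarrow> word_linear f \<and>
    (\<forall>u v x y. f (u @ x # y # v) = f (u @ y # x # v) + f (u @ bracket x y # v))"

lemma lin_ext_uea_rels:
  assumes "uea_word_linear f" "r \<in> linear_rels \<union> lie_rels"
  shows "lin_ext f (word u * r * word v) = 0"
proof (cases "r \<in> linear_rels")
  case True
  with assms lin_ext_linear_rels show ?thesis unfolding uea_word_linear_def by blast
next
  case False
  with assms(2) obtain x y where r: "r = word [x, y] - word [y, x] - word [bracket x y]"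
    by (auto simp: lie_rels_def)
  have "lin_ext f (word u * r * word v)
      = f (u @ x # y # v) - f (u @ y # x # v) - f (u @ bracket x y # v)"
    by (simp add: r left_diff_distrib right_diff_distrib mult_single plus_list_def
        clinear_diff[OF clinear_lin_ext])
  moreover have "f (u @ x # y # v) = f (u @ y # x # v) + f (u @ bracket x y # v)"
    using assms(1) unfolding uea_word_linear_def by blast
  ultimately show ?thesis by simp
qed

lemma counit_uea_linear: "uea_word_linear counit_word"
  using counit_linear by (simp add: uea_word_linear_def counit_word_def)

instantiation uea :: (lie_algebra) complex_algebra_1
begin
lift_definition zero_uea :: "'a uea" is 0 .
lift_definition one_uea :: "'a uea" is 1 .
lift_definition plus_uea :: "'a uea \<Rightarrow> 'a uea \<Rightarrow> 'a uea" is "(+)"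
  by (rule ideal_gen_plus_cong)
lift_definition minus_uea :: "'a uea \<Rightarrow> 'a uea \<Rightarrow> 'a uea" is "(-)"
  by (rule ideal_gen_minus_cong)
lift_definition uminus_uea :: "'a uea \<Rightarrow> 'a uea" is uminus
  by (rule ideal_gen_uminus_cong)
lift_definition times_uea :: "'a uea \<Rightarrow> 'a uea \<Rightarrow> 'a uea" is "(*)"
  by (rule ideal_gen_times_cong)
lift_definition scaleC_uea :: "complex \<Rightarrow> 'a uea \<Rightarrow> 'a uea" is scaleC
  by (rule ideal_gen_scaleC_cong)
instance
proof
  show "(0 :: 'a uea) \<noteq> 1"
    by transfer (rule one_notin_ideal_gen[OF lin_ext_uea_rels[OF counit_uea_linear]])
  fix a :: complex and x y :: "'a uea"
  show "a *\<^sub>C x * y = a *\<^sub>C (x * y)"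
    by transfer (simp add: scaleC_free_alg mult.assoc ideal_gen.zero)
  show "x * a *\<^sub>C y = a *\<^sub>C (x * y)"
    by transfer (simp add: scaleC_free_alg' mult.assoc ideal_gen.zero)
qed (transfer, simp add: ideal_gen.zero algebra_simps scaleC_add_right scaleC_add_left)+
end

definition uea_lift :: "('a::lie_algebra list \<Rightarrow> 'b::complex_vector) \<Rightarrow> 'a uea \<Rightarrow> 'b"
  where "uea_lift f u = lin_ext f (rep_uea u)"

lemma uea_lift_abs:
  assumes "uea_word_linear f"
  shows "uea_lift f (abs_uea p) = lin_ext f p"
proof -
  have "rep_uea (abs_uea p) - p \<in> ideal_gen (linear_rels \<union> lie_rels)"
    by (rule Quotient3_rep_abs[OF Quotient3_uea]) (simp add: ideal_gen.zero)
  then have "lin_ext f (rep_uea (abs_uea p) - p) = 0"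
    by (rule lin_ext_ideal_gen[rotated]) (rule lin_ext_uea_rels[OF assms])
  then show ?thesis by (simp add: uea_lift_def clinear_diff[OF clinear_lin_ext])
qed

lemma uea_lift_word: "uea_word_linear f \<Longrightarrow> uea_lift f (uea_word w) = f w"
  by (simp add: uea_word.abs_eq uea_lift_abs)

lemma clinear_uea_lift:
  assumes "uea_word_linear f"
  shows "clinear (uea_lift f)"
proof (rule clinearI)
  fix x y :: "'a uea" and c :: complex
  show "uea_lift f (x + y) = uea_lift f x + uea_lift f y"
    by (induction x; induction y)
       (simp add: plus_uea.abs_eq uea_lift_abs[OF assms] clinear_add[OF clinear_lin_ext])
  show "uea_lift f (c *\<^sub>C x) = c *\<^sub>C uea_lift f x"
    by (induction x)
       (simp add: scaleC_uea.abs_eq uea_lift_abs[OF assms] clinear_scale[OF clinear_lin_ext])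
qed

lemma uea_word_append: "uea_word (u @ v) = uea_word u * uea_word v"
  by transfer (simp add: word_append ideal_gen.zero)

lemma uea_word_linear: "uea_word_linear uea_word"
proof -
  have 1: "uea_word [x + y] = uea_word [x] + uea_word [y]" for x y :: 'a
    by transfer (rule ideal_gen.gen, auto simp: linear_rels_def diff_diff_eq)
  have 2: "uea_word [c *\<^sub>C x] = c *\<^sub>C uea_word [x]" for c and x :: 'a
    by transfer (rule ideal_gen.gen, unfold linear_rels_def, blast)
  have 3: "uea_word [x, y] = uea_word [y, x] + uea_word [bracket x y]" for x y :: 'a
    by transfer (rule ideal_gen.gen, auto simp: lie_rels_def diff_diff_eq)
  have 4: "uea_word (u @ x # v) = uea_word u * uea_word [x] * uea_word v" for u v and x :: 'a
    by (simp flip: uea_word_append)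
  have 5: "uea_word (u @ x # y # v) = uea_word u * uea_word [x, y] * uea_word v" for u v and x y :: 'a
    by (simp flip: uea_word_append)
  have "word_linear (uea_word :: 'a list \<Rightarrow> _)"
    unfolding word_linear_def 4 1 2 by (simp add: algebra_simps)
  moreover have "uea_word (u @ x # y # v) = uea_word (u @ y # x # v) + uea_word (u @ bracket x y # v)"
    for u v and x y :: 'a
    unfolding 5 4[of _ "bracket x y"] 3[of x y] by (simp add: algebra_simps)
  ultimately show ?thesis unfolding uea_word_linear_def by blast
qed

section \<open>Symmetrisation\<close>

definition average :: "('a::complex_vector list \<Rightarrow> 'b::complex_vector) \<Rightarrow> 'a list \<Rightarrow> 'b"
  where "average f xs = (1 / fact (length xs)) *\<^sub>C
    (\<Sum>\<sigma> | \<sigma> permutes {..<length xs}. f (permute_list \<sigma> xs))"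

lemma word_linear_update:
  assumes "word_linear f" "i < length xs"
  shows "f (xs[i := x + y]) = f (xs[i := x]) + f (xs[i := y])"
    "f (xs[i := c *\<^sub>C x]) = c *\<^sub>C f (xs[i := x])"
  using assms by (simp_all add: upd_conv_take_nth_drop word_linearD)

lemma sym_word_linear_average:
  assumes f: "word_linear f"
  shows "sym_word_linear (average f)"
proof -
  have perm: "permute_list \<sigma> (u @ z # v)
      = (permute_list \<sigma> (u @ 0 # v))[inv \<sigma> (length u) := z]"
    if \<sigma>: "\<sigma> permutes {..<Suc (length u + length v)}" for \<sigma> z and u v :: "'a list"
  proof (rule nth_equalityI)
    fix i assume i: "i < length (permute_list \<sigma> (u @ z # v))"
    then have "\<sigma> i < Suc (length u + length v)"
      using permutes_in_image[OF \<sigma>, of i] by simp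
    moreover have "inv \<sigma> (length u) = i \<longleftrightarrow> \<sigma> i = length u"
      using permutes_inv_eq[OF \<sigma>] by metis
    ultimately show "permute_list \<sigma> (u @ z # v) ! i
        = (permute_list \<sigma> (u @ 0 # v))[inv \<sigma> (length u) := z] ! i"
      using i \<sigma> by (auto simp: permute_list_nth nth_append nth_list_update nth_Cons')
  qed simp
  have inv: "inv \<sigma> (length u) < Suc (length u + length v)"
    if "\<sigma> permutes {..<Suc (length u + length v)}" for \<sigma> and u v :: "'a list"
    using permutes_in_image[OF permutes_inv[OF that], of "length u"] by simp
  have avg: "average f (u @ z # v) = (1 / fact (Suc (length u + length v))) *\<^sub>C
      (\<Sum>\<sigma> | \<sigma> permutes {..<Suc (length u + length v)}.
        f ((permute_list \<sigma> (u @ 0 # v))[inv \<sigma> (length u) := z]))" for u v z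
  proof -
    have "(\<Sum>\<sigma> | \<sigma> permutes {..<Suc (length u + length v)}. f (permute_list \<sigma> (u @ z # v)))
      = (\<Sum>\<sigma> | \<sigma> permutes {..<Suc (length u + length v)}.
          f ((permute_list \<sigma> (u @ 0 # v))[inv \<sigma> (length u) := z]))"
      by (rule sum.cong[OF refl], subst perm) auto
    then show ?thesis by (simp add: average_def)
  qed
  have "average f (u @ (x + y) # v) = average f (u @ x # v) + average f (u @ y # v)"
    "average f (u @ (c *\<^sub>C x) # v) = c *\<^sub>C average f (u @ x # v)" for u v x y c
    unfolding avg
    by (simp_all add: inv word_linear_update[OF f] sum.distrib scaleC_add_right
        cvec.scale_sum_right mult.commute)
  moreover have "average f (u @ x # y # v) = average f (u @ y # x # v)" for u v x y
  proof -
    let ?\<tau> = "Transposition.transpose (length u) (Suc (length u))" and ?S = "{..<length (u @ x # y # v)}"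
    have \<tau>: "?\<tau> permutes ?S" by (rule permutes_swap_id) auto
    have eq: "permute_list ?\<tau> (u @ x # y # v) = u @ y # x # v"
    proof (rule nth_equalityI)
      fix i assume i: "i < length (permute_list ?\<tau> (u @ x # y # v))"
      consider "i < length u" | "i = length u" | "i = Suc (length u)"
        | k where "i = Suc (Suc (length u + k))"
        by (metis add_Suc_right less_imp_Suc_add linorder_neqE_nat add.commute not_less_eq)
      then show "permute_list ?\<tau> (u @ x # y # v) ! i = (u @ y # x # v) ! i"
        using i by cases (auto simp: permute_list_def nth_append Transposition.transpose_def simp del: upt_Suc)
    qed simp
    have "(\<Sum>\<sigma> | \<sigma> permutes ?S. f (permute_list \<sigma> (u @ x # y # v)))
        = (\<Sum>\<sigma> | \<sigma> permutes ?S. f (permute_list (?\<tau> \<circ> \<sigma>) (u @ x # y # v)))"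
      by (rule setum_permutations_compose_left[OF \<tau>])
    also have "\<dots> = (\<Sum>\<sigma> | \<sigma> permutes ?S. f (permute_list \<sigma> (u @ y # x # v)))"
      by (intro sum.cong refl) (simp add: permute_list_compose eq)
    finally show ?thesis by (simp add: average_def)
  qed
  ultimately show ?thesis
    unfolding sym_word_linear_def word_linear_def by blast
qed

definition symmetrise_tensor :: "'a::complex_vector sym_alg \<Rightarrow> 'a tensor_alg"
  where "symmetrise_tensor = sym_lift (average tensor_word)"

definition symmetrise :: "'a::lie_algebra sym_alg \<Rightarrow> 'a uea"
  where "symmetrise = sym_lift (average uea_word)"

lemma symmetrise_tensor_word: "symmetrise_tensor (sym_word xs) = average tensor_word xs"
  unfolding symmetrise_tensor_def
  by (rule sym_lift_word[OF sym_word_linear_average[OF tensor_word_linear]])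

lemma symmetrise_word: "symmetrise (sym_word xs) = average uea_word xs"
  unfolding symmetrise_def
  by (rule sym_lift_word[OF sym_word_linear_average])
     (use uea_word_linear uea_word_linear_def in blast)

lemma clinear_symmetrise_tensor: "clinear symmetrise_tensor"
  unfolding symmetrise_tensor_def
  by (rule clinear_sym_lift[OF sym_word_linear_average[OF tensor_word_linear]])

lemma clinear_symmetrise: "clinear symmetrise"
  unfolding symmetrise_def
  by (rule clinear_sym_lift[OF sym_word_linear_average])
     (use uea_word_linear uea_word_linear_def in blast)

section \<open>Invariants\<close>

text \<open>The adjoint action, extended to the symmetric algebra by the Leibniz rule.\<close>

fun ad_word :: "'a::lie_algebra \<Rightarrow> 'a list \<Rightarrow> 'a sym_alg"
  where
    "ad_word x [] = 0"
  | "ad_word x (y # w) = sym_word (bracket x y # w) + sym_word [y] * ad_word x w"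

lemma sym_word_1:
  fixes x y :: "'a::complex_vector"
  shows "sym_word [x + y] = sym_word [x] + sym_word [y]"
    and "sym_word [c *\<^sub>C x] = c *\<^sub>C sym_word [x]"
proof -
  have "word_linear (sym_word :: 'a list \<Rightarrow> _)"
    using sym_word_linear unfolding sym_word_linear_def by blast
  from word_linearD[OF this, of "[]" _ _ "[]"]
  show "sym_word [x + y] = sym_word [x] + sym_word [y]"
    and "sym_word [c *\<^sub>C x] = c *\<^sub>C sym_word [x]"
    by simp_all
qed

lemma sym_word_Cons: "sym_word (x # w) = sym_word [x] * sym_word w"
  by (simp flip: sym_word_append)

lemma sym_word_Nil: "sym_word [] = 1"
  by transfer (simp add: word_Nil ideal_gen.zero)

lemma ad_word_append: "ad_word x (u @ v) = ad_word x u * sym_word v + sym_word u * ad_word x v"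
proof (induction u)
  case (Cons y u)
  then show ?case
    by (simp add: sym_word_Cons[of _ "u @ v"] sym_word_Cons[of _ u] sym_word_append algebra_simps)
qed (simp add: sym_word_Nil)

lemma sym_word_linear_ad: "sym_word_linear (ad_word x)"
proof -
  have 1: "ad_word x (u @ z # v) = ad_word x u * (sym_word [z] * sym_word v)
      + sym_word u * (sym_word [bracket x z] * sym_word v + sym_word [z] * ad_word x v)" for u z v
    unfolding ad_word_append ad_word.simps sym_word_Cons[of z v] sym_word_Cons[of "bracket x z" v] ..
  have "word_linear (ad_word x)"
    unfolding word_linear_def 1 bracket_add_right bracket_scaleC_right sym_word_1
    by (simp add: algebra_simps scaleC_add_right)
  moreover have "ad_word x (u @ y # z # v) = ad_word x (u @ z # y # v)" for u y z v
    unfolding ad_word_append ad_word.simps sym_word_Cons[of y "z # v"] sym_word_Cons[of z "y # v"]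
      sym_word_Cons[of z v] sym_word_Cons[of y v] sym_word_Cons[of "bracket x z" "y # v"]
      sym_word_Cons[of "bracket x y" "z # v"] sym_word_Cons[of "bracket x y" v] sym_word_Cons[of "bracket x z" v]
    by (simp add: algebra_simps)
  ultimately show ?thesis by (simp add: sym_word_linear_def)
qed

definition ad_sym :: "'a::lie_algebra \<Rightarrow> 'a sym_alg \<Rightarrow> 'a sym_alg"
  where "ad_sym x = sym_lift (ad_word x)"

lemma ad_sym_word: "ad_sym x (sym_word w) = ad_word x w"
  unfolding ad_sym_def by (rule sym_lift_word[OF sym_word_linear_ad])

lemma clinear_ad_sym: "clinear (ad_sym x)"
  unfolding ad_sym_def by (rule clinear_sym_lift[OF sym_word_linear_ad])

definition sym_invariants :: "'a::lie_algebra sym_alg set"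
  where "sym_invariants = {F. \<forall>x. ad_sym x F = 0}"

section \<open>The map m\<close>

typedef (overloaded) 'a gl = "{f :: 'a::complex_vector \<Rightarrow> 'a. clinear f}"
  by (intro exI[of _ "\<lambda>x. x"]) (simp add: clinearI)

setup_lifting type_definition_gl

instantiation gl :: (complex_vector) complex_vector
begin
lift_definition zero_gl :: "'a gl" is "\<lambda>_. 0" by (simp add: clinearI)
lift_definition plus_gl :: "'a gl \<Rightarrow> 'a gl \<Rightarrow> 'a gl" is "\<lambda>f g x. f x + g x"
  by (simp add: Vector_Spaces.linear_iff scaleC_add_right algebra_simps)
lift_definition minus_gl :: "'a gl \<Rightarrow> 'a gl \<Rightarrow> 'a gl" is "\<lambda>f g x. f x - g x"
  by (simp add: Vector_Spaces.linear_iff cvec.scale_right_diff_distrib algebra_simps)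
lift_definition uminus_gl :: "'a gl \<Rightarrow> 'a gl" is "\<lambda>f x. - f x"
  by (simp add: Vector_Spaces.linear_iff)
lift_definition scaleC_gl :: "complex \<Rightarrow> 'a gl \<Rightarrow> 'a gl" is "\<lambda>c f x. c *\<^sub>C f x"
  by (simp add: Vector_Spaces.linear_iff scaleC_add_right mult.commute)
instance
  by standard
     (transfer, simp add: scaleC_add_right scaleC_add_left add.assoc add.commute fun_eq_iff)+
end

lift_definition gl_comp :: "'a::complex_vector gl \<Rightarrow> 'a gl \<Rightarrow> 'a gl" is "(\<circ>)"
  by (simp add: Vector_Spaces.linear_iff)

lift_definition ad :: "'a::lie_algebra \<Rightarrow> 'a gl" is bracket
  by (rule clinear_bracket)

fun m_word :: "'a::lie_algebra list \<Rightarrow> ('a gl, 'a tensor_alg) tensor_prod"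
  where
    "m_word (y1 # y2 # y3 # w) = gl_comp (ad y1) (gl_comp (ad y2) (ad y3)) \<otimes>\<^sub>C tensor_word w"
  | "m_word _ = 0"

lemma gl_comp_bilinear:
  "gl_comp (f + g) h = gl_comp f h + gl_comp g h"
  "gl_comp h (f + g) = gl_comp h f + gl_comp h g"
  "gl_comp (c *\<^sub>C f) h = c *\<^sub>C gl_comp f h"
  "gl_comp h (c *\<^sub>C f) = c *\<^sub>C gl_comp h f"
  by (transfer, simp add: fun_eq_iff clinear_add clinear_scale)+

lemma ad_linear: "ad (x + y) = ad x + ad y" "ad (c *\<^sub>C x) = c *\<^sub>C ad x"
  by (transfer, simp add: fun_eq_iff bracket_add_left bracket_scaleC_left)+

lemma word_linear_m_word: "word_linear m_word"
proof -
  have "m_word (u @ (x + y) # v) = m_word (u @ x # v) + m_word (u @ y # v)"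
    "m_word (u @ (c *\<^sub>C x) # v) = c *\<^sub>C m_word (u @ x # v)" for u v c and x y :: 'a
    by (cases u rule: m_word.cases; cases v rule: m_word.cases;
        simp add: ad_linear gl_comp_bilinear tensor_bilinear word_linearD[OF tensor_word_linear])+
  then show ?thesis by (simp add: word_linear_def)
qed

text \<open>Following the convention that symmetric tensors sit inside the tensor algebra by
  symmetrisation, the target \<open>gl(g) \<otimes> S(g)\<close> of the map is regarded as a subspace of
  \<open>gl(g) \<otimes> T(g)\<close>.\<close>

definition m_map :: "'a::lie_algebra sym_alg \<Rightarrow> ('a gl, 'a tensor_alg) tensor_prod"
  where "m_map F = tensor_lift m_word (symmetrise_tensor F)"

lemma clinear_m_map: "clinear m_map"
  by (rule clinearI)
     (simp_all add: m_map_def clinear_add[OF clinear_symmetrise_tensor]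
       clinear_scale[OF clinear_symmetrise_tensor]
       clinear_add[OF clinear_tensor_lift[OF word_linear_m_word]]
       clinear_scale[OF clinear_tensor_lift[OF word_linear_m_word]])

lemma m_map_word: "m_map (sym_word xs) = average m_word xs"
  by (simp add: m_map_def symmetrise_tensor_word average_def tensor_lift_word[OF word_linear_m_word]
      clinear_scale[OF clinear_tensor_lift[OF word_linear_m_word]]
      clinear_sum[OF clinear_tensor_lift[OF word_linear_m_word]])

section \<open>Current algebras and the affine Lie algebra\<close>

text \<open>\<open>int \<Rightarrow>\<^sub>0 g\<close> is the loop algebra, with \<^term>\<open>Poly_Mapping.single m x\<close> standing for \<open>x t\<^sup>m\<close>.\<close>

definition current_bracket ::
    "('k::comm_monoid_add \<Rightarrow>\<^sub>0 'a::lie_algebra) \<Rightarrow> ('k \<Rightarrow>\<^sub>0 'a) \<Rightarrow> 'k \<Rightarrow>\<^sub>0 'a"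
  where "current_bracket p q =
    (\<Sum>m\<in>Poly_Mapping.keys p. \<Sum>n\<in>Poly_Mapping.keys q.
      Poly_Mapping.single (m + n) (bracket (Poly_Mapping.lookup p m) (Poly_Mapping.lookup q n)))"

lemma current_bracket_superset:
  assumes "finite S" "finite T" "Poly_Mapping.keys p \<subseteq> S" "Poly_Mapping.keys q \<subseteq> T"
  shows "current_bracket p q = (\<Sum>m\<in>S. \<Sum>n\<in>T.
      Poly_Mapping.single (m + n) (bracket (Poly_Mapping.lookup p m) (Poly_Mapping.lookup q n)))"
  unfolding current_bracket_def
  by (rule sum.mono_neutral_cong_left[OF assms(1,3)])
     (use assms in \<open>auto simp: Poly_Mapping.in_keys_iff intro!: sum.mono_neutral_left\<close>)

lemma keys_bounds:
  "Poly_Mapping.keys (p + q) \<subseteq> Poly_Mapping.keys p \<union> Poly_Mapping.keys (q :: 'k \<Rightarrow>\<^sub>0 'a::complex_vector)"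
  "Poly_Mapping.keys (c *\<^sub>C p) \<subseteq> Poly_Mapping.keys p"
  by (auto simp: Poly_Mapping.in_keys_iff Poly_Mapping.lookup_add)

lemma current_bracket_add_left:
  "current_bracket (p + q) r = current_bracket p r + current_bracket q r"
proof -
  let ?S = "Poly_Mapping.keys p \<union> Poly_Mapping.keys q"
  have "finite ?S" by simp
  note * = current_bracket_superset[OF this, of "Poly_Mapping.keys r" _ r]
  show ?thesis
    by (simp add: * keys_bounds Poly_Mapping.lookup_add bracket_add_left Poly_Mapping.single_add
        sum.distrib)
qed

lemma current_bracket_add_right:
  "current_bracket r (p + q) = current_bracket r p + current_bracket r q"
proof -
  let ?S = "Poly_Mapping.keys p \<union> Poly_Mapping.keys q"
  have "finite ?S" by simp
  note * = current_bracket_superset[OF _ this, of "Poly_Mapping.keys r" r]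
  show ?thesis
    by (simp add: * keys_bounds Poly_Mapping.lookup_add bracket_add_right Poly_Mapping.single_add
        sum.distrib)
qed

lemma current_bracket_scaleC_left: "current_bracket (c *\<^sub>C p) q = c *\<^sub>C current_bracket p q"
  by (subst current_bracket_superset[of "Poly_Mapping.keys p" "Poly_Mapping.keys q"])
     (simp_all add: keys_bounds current_bracket_def cvec.scale_sum_right bracket_scaleC_left)

lemma current_bracket_scaleC_right: "current_bracket p (c *\<^sub>C q) = c *\<^sub>C current_bracket p q"
  by (subst current_bracket_superset[of "Poly_Mapping.keys p" "Poly_Mapping.keys q"])
     (simp_all add: keys_bounds current_bracket_def cvec.scale_sum_right bracket_scaleC_right)

lemma current_bracket_single:
  "current_bracket (Poly_Mapping.single m x) (Poly_Mapping.single n y)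
    = Poly_Mapping.single (m + n) (bracket x y)"
  by (subst current_bracket_superset[of "{m}" "{n}"]) (auto simp: split: if_splits)

lemmas current_bracket_simps =
  current_bracket_add_left current_bracket_add_right current_bracket_single

lemma current_bracket_antisym: "current_bracket p q = - current_bracket q p"
proof (induction p rule: poly_mapping_single_induct)
  case (single m x)
  show ?case
  proof (induction q rule: poly_mapping_single_induct)
    case (single n y)
    have "bracket x y = - bracket y x" by (rule bracket_antisym)
    then show ?case
      by (simp add: current_bracket_single Poly_Mapping.single_uminus add.commute)
  qed (simp add: current_bracket_simps)
qed (simp add: current_bracket_simps)

lemma current_bracket_jacobi:
  "current_bracket p (current_bracket q r) + current_bracket q (current_bracket r p)
    + current_bracket r (current_bracket p q) = 0" (is "?J p q r = 0")
proof -
  have add: "?J (p + p') q r = ?J p q r + ?J p' q r" "?J p (q + q') r = ?J p q r + ?J p q' r"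
    "?J p q (r + r') = ?J p q r + ?J p q r'" for p q r p' q' r'
    by (simp_all add: current_bracket_simps algebra_simps)
  have 1: "?J (Poly_Mapping.single l x) (Poly_Mapping.single m y) (Poly_Mapping.single n z) = 0"
    for l m n x y z
    using jacobi[of x y z]
    by (simp add: current_bracket_single ac_simps flip: Poly_Mapping.single_add)
  have 2: "?J (Poly_Mapping.single l x) (Poly_Mapping.single m y) r = 0" for l m x y r
    by (induction r rule: poly_mapping_single_induct) (simp_all only: 1 add, simp)
  have 3: "?J (Poly_Mapping.single l x) q r = 0" for l x q r
    by (induction q rule: poly_mapping_single_induct) (simp_all only: 2 add, simp)
  show ?thesis
    by (induction p rule: poly_mapping_single_induct) (simp_all only: 3 add, simp)
qed

instantiation poly_mapping :: (comm_monoid_add, lie_algebra) lie_algebra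
begin
definition bracket_poly_mapping :: "('a \<Rightarrow>\<^sub>0 'b) \<Rightarrow> ('a \<Rightarrow>\<^sub>0 'b) \<Rightarrow> 'a \<Rightarrow>\<^sub>0 'b"
  where "bracket_poly_mapping = current_bracket"
instance
proof
  fix p :: "'a \<Rightarrow>\<^sub>0 'b"
  have "current_bracket p p + current_bracket p p = 0"
    using current_bracket_antisym[of p p] by (simp add: eq_neg_iff_add_eq_0)
  then have "(1 + 1) *\<^sub>C current_bracket p p = 0"
    unfolding scaleC_add_left by simp
  then show "bracket p p = 0" by (simp add: bracket_poly_mapping_def)
qed (simp_all add: bracket_poly_mapping_def current_bracket_add_left current_bracket_add_right
    current_bracket_scaleC_left current_bracket_scaleC_right current_bracket_jacobi)
end

lemma bracket_single: "bracket (Poly_Mapping.single m x) (Poly_Mapping.single n y)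
    = Poly_Mapping.single (m + n) (bracket x y)"
  by (simp add: bracket_poly_mapping_def current_bracket_single)


definition cocycle :: "(int \<Rightarrow>\<^sub>0 'a::fd_lie_algebra) \<Rightarrow> (int \<Rightarrow>\<^sub>0 'a) \<Rightarrow> complex"
  where "cocycle p q = (\<Sum>m\<in>Poly_Mapping.keys p.
    of_int m * killing (Poly_Mapping.lookup p m) (Poly_Mapping.lookup q (- m)))"

lemma cocycle_superset:
  assumes "finite S" "Poly_Mapping.keys p \<subseteq> S"
  shows "cocycle p q = (\<Sum>m\<in>S.
    of_int m * killing (Poly_Mapping.lookup p m) (Poly_Mapping.lookup q (- m)))"
  unfolding cocycle_def
  by (rule sum.mono_neutral_left[OF assms]) (auto simp: Poly_Mapping.in_keys_iff)

lemma cocycle_add_left: "cocycle (p + q) r = cocycle p r + cocycle q r"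
  by (simp add: cocycle_superset[of "Poly_Mapping.keys p \<union> Poly_Mapping.keys q"] keys_bounds
      Poly_Mapping.lookup_add killing_bilinear distrib_left sum.distrib)

lemma cocycle_add_right: "cocycle p (q + r) = cocycle p q + cocycle p r"
  by (simp add: cocycle_def Poly_Mapping.lookup_add killing_bilinear distrib_left sum.distrib)

lemma cocycle_scaleC_left: "cocycle (c *\<^sub>C p) q = c * cocycle p q"
  by (simp add: cocycle_superset[of "Poly_Mapping.keys p"] keys_bounds killing_bilinear
      sum_distrib_left mult_ac)

lemma cocycle_scaleC_right: "cocycle p (c *\<^sub>C q) = c * cocycle p q"
  by (simp add: cocycle_def killing_bilinear sum_distrib_left mult_ac)

lemma cocycle_single:
  "cocycle (Poly_Mapping.single m x) (Poly_Mapping.single n y)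
    = (if m + n = 0 then of_int m * killing x y else 0)"
  by (subst cocycle_superset[of "{m}"])
     (auto simp: Poly_Mapping.lookup_single when_def split: if_splits)

lemma cocycle_antisym: "cocycle p q = - cocycle q p"
proof (induction p rule: poly_mapping_single_induct)
  case (single m x)
  show ?case
  proof (induction q rule: poly_mapping_single_induct)
    case (single n y)
    show ?case
    proof (cases "m + n = 0")
      case True
      then have "n = - m" by linarith
      then show ?thesis by (simp add: cocycle_single killing_sym[of y x])
    qed (simp add: cocycle_single add.commute)
  qed (simp add: cocycle_add_left cocycle_add_right)
qed (simp add: cocycle_add_left cocycle_add_right)

lemma cocycle_jacobi:
  "cocycle p (bracket q r) + cocycle q (bracket r p) + cocycle r (bracket p q) = 0"
  (is "?J p q r = 0")
proof -
  have add: "?J (p + p') q r = ?J p q r + ?J p' q r" "?J p (q + q') r = ?J p q r + ?J p q' r"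
    "?J p q (r + r') = ?J p q r + ?J p q r'" for p q r p' q' r'
    by (simp_all add: bracket_add_left bracket_add_right cocycle_add_left cocycle_add_right)
  have 1: "?J (Poly_Mapping.single l x) (Poly_Mapping.single m y) (Poly_Mapping.single n z) = 0"
    for l m n x y z
  proof (cases "l + m + n = 0")
    case True
    have "killing y (bracket z x) = killing x (bracket y z)"
      "killing z (bracket x y) = killing x (bracket y z)"
      by (metis killing_sym killing_invariant)+
    moreover have "l + (m + n) = 0" "m + (n + l) = 0" "n + (l + m) = 0" using True by auto
    moreover have "of_int l + of_int m + of_int n = (0 :: complex)"
      by (metis True of_int_add of_int_0)
    ultimately show ?thesis
      by (simp add: bracket_single cocycle_single flip: distrib_right)
  next
    case False
    then have "l + (m + n) \<noteq> 0" "m + (n + l) \<noteq> 0" "n + (l + m) \<noteq> 0" by auto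
    then show ?thesis by (simp add: bracket_single cocycle_single)
  qed
  have 2: "?J (Poly_Mapping.single l x) (Poly_Mapping.single m y) r = 0" for l m x y r
    by (induction r rule: poly_mapping_single_induct) (simp_all only: 1 add, simp)
  have 3: "?J (Poly_Mapping.single l x) q r = 0" for l x q r
    by (induction q rule: poly_mapping_single_induct) (simp_all only: 2 add, simp)
  show ?thesis
    by (induction p rule: poly_mapping_single_induct) (simp_all only: 3 add, simp)
qed

text \<open>\<open>Affine p a\<close> is \<open>p + a K\<close> in \<open>g[t, t\<^sup>-\<^sup>1] \<oplus> \<complex>K\<close>.\<close>

context
  notes [[typedef_overloaded]]
begin
datatype 'a affine = Affine (loop_part: "int \<Rightarrow>\<^sub>0 'a::zero") (central_part: complex)
end

instantiation affine :: (fd_lie_algebra) lie_algebra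
begin
definition zero_affine :: "'a affine"
  where "0 = Affine 0 0"
definition plus_affine :: "'a affine \<Rightarrow> 'a affine \<Rightarrow> 'a affine"
  where "x + y = Affine (loop_part x + loop_part y) (central_part x + central_part y)"
definition minus_affine :: "'a affine \<Rightarrow> 'a affine \<Rightarrow> 'a affine"
  where "x - y = Affine (loop_part x - loop_part y) (central_part x - central_part y)"
definition uminus_affine :: "'a affine \<Rightarrow> 'a affine"
  where "- x = Affine (- loop_part x) (- central_part x)"
definition scaleC_affine :: "complex \<Rightarrow> 'a affine \<Rightarrow> 'a affine"
  where "c *\<^sub>C x = Affine (c *\<^sub>C loop_part x) (c * central_part x)"
definition bracket_affine :: "'a affine \<Rightarrow> 'a affine \<Rightarrow> 'a affine"
  where "bracket x y =
    Affine (bracket (loop_part x) (loop_part y)) (cocycle (loop_part x) (loop_part y))"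
instance
proof
  fix x :: "'a affine"
  have "cocycle (loop_part x) (loop_part x) = 0"
    using cocycle_antisym[of "loop_part x" "loop_part x"] by simp
  then show "bracket x x = 0" by (simp add: bracket_affine_def zero_affine_def)
qed (simp_all add: zero_affine_def plus_affine_def minus_affine_def uminus_affine_def
    scaleC_affine_def bracket_affine_def bracket_add_left bracket_add_right bracket_scaleC_left
    bracket_scaleC_right cocycle_add_left cocycle_add_right cocycle_scaleC_left
    cocycle_scaleC_right scaleC_add_left scaleC_add_right algebra_simps jacobi[unfolded add.assoc]
    cocycle_jacobi[unfolded add.assoc])
end

text \<open>The subalgebra \<open>t\<^sup>-\<^sup>1g[t\<^sup>-\<^sup>1]\<close> of the loop algebra, and \<open>x \<mapsto> x[-1]\<close>.\<close>

typedef (overloaded) 'a neg_current =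
    "{p :: int \<Rightarrow>\<^sub>0 'a::lie_algebra. \<forall>n\<ge>0. Poly_Mapping.lookup p n = 0}"
  morphisms neg_loop Neg_current
  by (rule exI[of _ 0]) simp

setup_lifting type_definition_neg_current

lemma neg_current_bracket:
  fixes p q :: "int \<Rightarrow>\<^sub>0 'a::lie_algebra"
  assumes p: "\<And>n. 0 \<le> n \<Longrightarrow> Poly_Mapping.lookup p n = 0"
    and q: "\<And>n. 0 \<le> n \<Longrightarrow> Poly_Mapping.lookup q n = 0" and "0 \<le> n"
  shows "Poly_Mapping.lookup (bracket p q) n = 0"
proof -
  have "k < 0" if "k \<in> Poly_Mapping.keys p" for k
    using p[of k] that by (cases "0 \<le> k") (auto simp: Poly_Mapping.in_keys_iff)
  moreover have "k < 0" if "k \<in> Poly_Mapping.keys q" for k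
    using q[of k] that by (cases "0 \<le> k") (auto simp: Poly_Mapping.in_keys_iff)
  ultimately have "k + l \<noteq> n" if "k \<in> Poly_Mapping.keys p" "l \<in> Poly_Mapping.keys q" for k l
    using that \<open>0 \<le> n\<close> by fastforce
  then show ?thesis
    unfolding bracket_poly_mapping_def current_bracket_def
    by (simp add: Poly_Mapping.lookup_sum Poly_Mapping.lookup_single when_def)
qed

instantiation neg_current :: (lie_algebra) lie_algebra
begin
lift_definition zero_neg_current :: "'a neg_current" is 0 by simp
lift_definition plus_neg_current :: "'a neg_current \<Rightarrow> 'a neg_current \<Rightarrow> 'a neg_current" is "(+)"
  by (simp add: Poly_Mapping.lookup_add)
lift_definition minus_neg_current :: "'a neg_current \<Rightarrow> 'a neg_current \<Rightarrow> 'a neg_current" is "(-)"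
  by (simp add: Poly_Mapping.lookup_minus)
lift_definition uminus_neg_current :: "'a neg_current \<Rightarrow> 'a neg_current" is uminus
  by simp
lift_definition scaleC_neg_current :: "complex \<Rightarrow> 'a neg_current \<Rightarrow> 'a neg_current" is scaleC
  by simp
lift_definition bracket_neg_current :: "'a neg_current \<Rightarrow> 'a neg_current \<Rightarrow> 'a neg_current" is bracket
  by (rule neg_current_bracket)
instance
  by standard
     (simp_all only: neg_loop_inject[symmetric] zero_neg_current.rep_eq plus_neg_current.rep_eq
       minus_neg_current.rep_eq uminus_neg_current.rep_eq scaleC_neg_current.rep_eq
       bracket_neg_current.rep_eq, simp_all add: bracket_add_left bracket_add_right
       bracket_scaleC_left bracket_scaleC_right scaleC_add_left scaleC_add_right add.assoc jacobi
       add.commute jacobi[unfolded add.assoc])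
end

lift_definition shift_minus_one :: "'a::lie_algebra \<Rightarrow> 'a neg_current"
  is "\<lambda>x. Poly_Mapping.single (- 1) x"
  by (simp add: Poly_Mapping.lookup_single when_def)

definition at_minus_one :: "'a::lie_algebra sym_alg \<Rightarrow> 'a neg_current sym_alg"
  where "at_minus_one = sym_lift (\<lambda>w. sym_word (map shift_minus_one w))"

lemma sym_word_linear_at_minus_one: "sym_word_linear (\<lambda>w. sym_word (map shift_minus_one w))"
proof -
  have 1: "shift_minus_one (x + y) = shift_minus_one x + shift_minus_one y" for x y :: 'a
    by transfer (rule Poly_Mapping.single_add)
  have 2: "shift_minus_one (c *\<^sub>C x) = c *\<^sub>C shift_minus_one x" for c and x :: 'a
    by transfer simp
  show ?thesis
    using sym_word_linear[where 'a = "'a neg_current"]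
    unfolding sym_word_linear_def word_linear_def map_append list.map 1 2 by blast
qed

lemma at_minus_one_word: "at_minus_one (sym_word w) = sym_word (map shift_minus_one w)"
  unfolding at_minus_one_def by (rule sym_lift_word[OF sym_word_linear_at_minus_one])

definition uea_incl :: "'a::fd_lie_algebra neg_current uea \<Rightarrow> 'a affine uea"
  where "uea_incl = uea_lift (\<lambda>w. uea_word (map (\<lambda>p. Affine (neg_loop p) 0) w))"

lemma uea_word_linear_incl:
  "uea_word_linear (\<lambda>w. uea_word (map (\<lambda>p. Affine (neg_loop p) 0 :: 'a::fd_lie_algebra affine) w))"
proof -
  let ?i = "\<lambda>p. Affine (neg_loop p) 0 :: 'a affine"
  have 1: "?i (x + y) = ?i x + ?i y" for x y
    by (simp add: plus_affine_def plus_neg_current.rep_eq)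
  have 2: "?i (c *\<^sub>C x) = c *\<^sub>C ?i x" for c x
    by (simp add: scaleC_affine_def scaleC_neg_current.rep_eq)
  have "cocycle (neg_loop x) (neg_loop y) = 0" for x y :: "'a neg_current"
    using neg_loop[of x] neg_loop[of y]
    by (auto simp: cocycle_def intro!: sum.neutral)
       (metis killing_zero le_cases neg_0_le_iff_le)
  then have 3: "?i (bracket x y) = bracket (?i x) (?i y)" for x y
    by (simp add: bracket_affine_def bracket_neg_current.rep_eq)
  show ?thesis
    using uea_word_linear[where 'a = "'a affine"]
    unfolding uea_word_linear_def word_linear_def map_append list.map 1 2 3 by blast
qed

lemma uea_incl_word:
  "uea_incl (uea_word w) = uea_word (map (\<lambda>p. Affine (neg_loop p) 0) w)"
  unfolding uea_incl_def by (rule uea_lift_word[OF uea_word_linear_incl])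

section \<open>The vacuum module at the critical level\<close>

inductive_set left_ideal_gen :: "'r::ring_1 set \<Rightarrow> 'r set" for R
  where
    gen: "r \<in> R \<Longrightarrow> r \<in> left_ideal_gen R"
  | zero: "0 \<in> left_ideal_gen R"
  | add: "p \<in> left_ideal_gen R \<Longrightarrow> q \<in> left_ideal_gen R \<Longrightarrow> p + q \<in> left_ideal_gen R"
  | mult_left: "p \<in> left_ideal_gen R \<Longrightarrow> a * p \<in> left_ideal_gen R"

lemma left_ideal_gen_uminus: "p \<in> left_ideal_gen R \<Longrightarrow> - p \<in> left_ideal_gen R"
  using left_ideal_gen.mult_left[of p R "- 1"] by simp

definition nonneg_currents :: "(int \<Rightarrow>\<^sub>0 'a::zero) set"
  where "nonneg_currents = {p. \<forall>n<0. Poly_Mapping.lookup p n = 0}"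

text \<open>The cocycle is normalised by the Killing form.  With respect to the Killing form the
  Casimir element \<open>\<Sum>\<^sub>i ad(x\<^sub>i)\<^sup>2\<close> acts on \<open>g\<close> as the identity, so the critical level (minus half
  of its eigenvalue) is \<open>-1/2\<close>; another admissible scalar product rescales \<open>K\<close> and the level
  and gives the same module.\<close>

definition critical_level :: complex
  where "critical_level = - 1 / 2"

definition vacuum_rels :: "'a::fd_lie_algebra affine uea set"
  where "vacuum_rels = {uea_word [Affine p 0] | p. p \<in> nonneg_currents}
    \<union> {uea_word [Affine 0 1] - critical_level *\<^sub>C 1}"

quotient_type (overloaded) 'a vacuum_module = "('a::fd_lie_algebra) affine uea"
  / "\<lambda>u v. u - v \<in> left_ideal_gen vacuum_rels"
proof (rule equivpI)
  show "symp (\<lambda>u v :: 'a affine uea. u - v \<in> left_ideal_gen vacuum_rels)"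
    by (rule sympI) (drule left_ideal_gen_uminus, simp)
  show "transp (\<lambda>u v :: 'a affine uea. u - v \<in> left_ideal_gen vacuum_rels)"
    by (rule transpI) (drule (1) left_ideal_gen.add, simp)
qed (simp add: reflpI left_ideal_gen.zero)

instantiation vacuum_module :: (fd_lie_algebra) ab_group_add
begin
lift_definition zero_vacuum_module :: "'a vacuum_module" is 0 .
lift_definition plus_vacuum_module ::
    "'a vacuum_module \<Rightarrow> 'a vacuum_module \<Rightarrow> 'a vacuum_module" is "(+)"
  by (drule (1) left_ideal_gen.add) (simp add: algebra_simps)
lift_definition uminus_vacuum_module :: "'a vacuum_module \<Rightarrow> 'a vacuum_module" is uminus
  by (drule left_ideal_gen_uminus) simp
lift_definition minus_vacuum_module ::
    "'a vacuum_module \<Rightarrow> 'a vacuum_module \<Rightarrow> 'a vacuum_module" is "(-)"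
  by (drule left_ideal_gen_uminus[of "_ - _" for x], drule (1) left_ideal_gen.add)
     (simp add: algebra_simps)
instance
  by standard (transfer, simp add: left_ideal_gen.zero add.assoc add.commute)+
end

text \<open>The left factor of the action below is not to be unfolded to representatives.\<close>

lifting_forget uea.lifting

lift_definition vacuum_action ::
    "'a::fd_lie_algebra affine uea \<Rightarrow> 'a vacuum_module \<Rightarrow> 'a vacuum_module" is "(*)"
  by (drule left_ideal_gen.mult_left) (simp add: right_diff_distrib)

lift_definition vacuum :: "'a::fd_lie_algebra vacuum_module" is 1 .

definition vacuum_state :: "'a::fd_lie_algebra neg_current uea \<Rightarrow> 'a vacuum_module"
  where "vacuum_state u = vacuum_action (uea_incl u) vacuum"

text \<open>By the Poincare-Birkhoff-Witt theorem \<^const>\<open>vacuum_state\<close> is a linear isomorphism; the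
  Feigin-Frenkel centre is the preimage of the \<open>g[t]\<close>-invariant vectors.\<close>

definition feigin_frenkel_centre :: "'a::fd_lie_algebra neg_current uea set"
  where "feigin_frenkel_centre =
    {u. \<forall>p\<in>nonneg_currents. vacuum_action (uea_word [Affine p 0]) (vacuum_state u) = 0}"

end

(*
The symmetric algebra is spanned by powers, so write F = \<Sum>\<^sub>y c\<^sub>y y\<^sup>m, put Y = y[-1] and
w\<^sub>s = (-ad y)\<^sup>s x, and let the modes x[n] act on Y\<^sup>m in the vacuum module.  The mode x[0] gives zero by
invariance, and for n \<ge> 2 three commutations already produce w\<^sub>3[n - 3], which m(F) controls.  For
n = 1 one obtains \<Sum>\<^sub>s (s + 1) Y\<^sup>s w\<^sub>2[-1] Y\<^sup>m\<^sup>-\<^sup>2\<^sup>-\<^sup>s plus a multiple of the Killing form term; differentiating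
the invariance of F along the trace tensor identifies that term, the critical level being exactly the one
for which the symmetric part cancels.  Summation by parts leaves
-1/2 \<Sum>\<^sub>s (s + 1) (m - 2 - s) Y\<^sup>s w\<^sub>3[-2] Y\<^sup>m\<^sup>-\<^sup>3\<^sup>-\<^sup>s, with coefficients of one sign.

For the converse this expression has to be detected in the vacuum module.  Instead of the
Poincare-Birkhoff-Witt theorem, the loop algebra acts on the polynomial functions on the big cell
Hom(H\<^sub>+, H\<^sub>-) of the Sato Grassmannian of H = g((t)) by Riccati vector fields; adding a multiple of the
trace of the block H\<^sub>- \<rightarrow> H\<^sub>+ gives an anti-representation of the affine algebra of any level.  Evaluation
at the origin of iterated operators applied to a function factors through the vacuum module, and on a
product of coordinates it sees the leading symbol only.  Since g has trivial centre, the matrix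
coefficients of ad separate points, so that these functionals recover m(F).
*)
theory Submission
  imports Defs
begin

text \<open>A single power y^m is not invariant, so invariance enters only through sums over y;
  every commutator is computed for one y and summed afterwards. Powers are convenient because the
  symmetrisation of y^m is simply y[-1]^m.

  For n = 1 the weights s + 1, with s from 0 to m - 2, have mean m/2. The level -1/2 subtracts
  precisely this mean, and weights of sum zero are what summation by parts needs.

  The obstacle in the converse is to show that an element lies outside the left ideal defining the
  vacuum module. The Grassmannian supplies functionals for this: its point H_+ is fixed by g[t], so
  evaluation there is killed by g[t] like the vacuum vector, while the determinant line bundle
  supplies the central charge. For the adjoint action on g((t)) its cocycle is that of the Killing
  form, so the level is just the coefficient of the trace. Operators forming an anti-representation
  are what matches a left ideal. To leading order the functionals ignore the order of the factors:
  all summands give the same number, and coefficients of one sign cannot cancel.\<close>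

section \<open>Polarisation\<close>

lemma of_nat_mult_scaleC: "of_nat n * x = of_nat n *\<^sub>C (x :: 'a::complex_algebra_1)"
  by (induction n) (simp_all add: scaleC_add_left distrib_right)

lemma clinear_compose: "clinear g \<Longrightarrow> clinear f \<Longrightarrow> clinear (\<lambda>x. g (f x))"
  by (simp add: Vector_Spaces.linear_iff)

text \<open>Replacing t by 2t and subtracting \<open>2 ^ Suc n\<close> times the original removes
  the top coefficient and multiplies the i-th one by \<open>2 ^ i - 2 ^ Suc n\<close>, nonzero for
  smaller i. This takes the place of a Vandermonde determinant.\<close>

lemma coefficients_in_subspace:
  fixes v :: "nat \<Rightarrow> 'a::complex_vector"
  assumes W: "cvec.subspace W" and "\<And>t. (\<Sum>i\<le>n. t ^ i *\<^sub>C v i) \<in> W" and "i \<le> n"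
  shows "v i \<in> W"
  using assms(2,3)
proof (induction n arbitrary: v i)
  case 0
  from "0.prems"(1)[of 0] "0.prems"(2) show ?case by simp
next
  case (Suc n)
  define u where "u i = (2 ^ i - 2 ^ Suc n) *\<^sub>C v i" for i
  have "(\<Sum>i\<le>n. t ^ i *\<^sub>C u i) \<in> W" for t
  proof -
    have "(\<Sum>i\<le>Suc n. (2 * t) ^ i *\<^sub>C v i) - 2 ^ Suc n *\<^sub>C (\<Sum>i\<le>Suc n. t ^ i *\<^sub>C v i) \<in> W"
      using Suc.prems(1) by (intro cvec.subspace_diff[OF W] cvec.subspace_scale[OF W])
    also have "(\<Sum>i\<le>Suc n. (2 * t) ^ i *\<^sub>C v i) - 2 ^ Suc n *\<^sub>C (\<Sum>i\<le>Suc n. t ^ i *\<^sub>C v i)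
        = (\<Sum>i\<le>Suc n. t ^ i *\<^sub>C u i)"
      unfolding u_def cvec.scale_sum_right sum_subtractf[symmetric] scaleC_scaleC
        cvec.scale_left_diff_distrib[symmetric]
      by (intro sum.cong refl arg_cong2[where f = scaleC]) (simp add: power_mult_distrib algebra_simps)
    also have "\<dots> = (\<Sum>i\<le>n. t ^ i *\<^sub>C u i)" by (simp add: u_def)
    finally show ?thesis .
  qed
  then have u: "u i \<in> W" if "i \<le> n" for i
    using Suc.IH that by blast
  have low: "v i \<in> W" if "i \<le> n" for i
  proof -
    have "(2::complex) ^ i \<noteq> 2 ^ Suc n"
    proof
      assume "(2::complex) ^ i = 2 ^ Suc n"
      then have "(of_nat (2 ^ i) :: complex) = of_nat (2 ^ Suc n)" by simp
      then have "(2::nat) ^ i = 2 ^ Suc n" by (simp only: of_nat_eq_iff)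
      with that show False by (simp del: power_Suc)
    qed
    then have "v i = (1 / (2 ^ i - 2 ^ Suc n)) *\<^sub>C u i" by (simp add: u_def)
    with u[OF that] show ?thesis by (simp only: cvec.subspace_scale[OF W])
  qed
  have "(\<Sum>i\<le>Suc n. v i) \<in> W" using Suc.prems(1)[of 1] by (simp only: power_one scaleC_one)
  then have "(\<Sum>i\<le>Suc n. v i) - (\<Sum>i\<le>n. v i) \<in> W"
    by (rule cvec.subspace_diff[OF W]) (rule cvec.subspace_sum[OF W], simp add: low)
  then have "v (Suc n) \<in> W" by simp
  with low Suc.prems(2) show ?case by (cases "i = Suc n") simp_all
qed

text \<open>Polarisation needs only the coefficient of t. The sum runs to \<open>Suc n\<close> so
  that index 1 is in range even for n = 0. As z need not commute with y, one expansion serves both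
  the symmetric and the enveloping algebra.\<close>

lemma power_expansion:
  fixes y z :: "'a::complex_algebra_1"
  obtains v where "v 1 = (\<Sum>p<n. y ^ p * z * y ^ (n - Suc p))"
    and "\<And>t. (y + t *\<^sub>C z) ^ n = (\<Sum>i\<le>Suc n. t ^ i *\<^sub>C v i)"
proof -
  \<comment> \<open>The induction also carries \<open>v 0\<close>, which enters the next coefficient
    of t, and the vanishing beyond \<open>Suc n\<close>, which lets the summation range
    grow.\<close>
  have "\<exists>v. v 0 = y ^ n \<and> v 1 = (\<Sum>p<n. y ^ p * z * y ^ (n - Suc p)) \<and> (\<forall>i>Suc n. v i = 0) \<and>
    (\<forall>t. (y + t *\<^sub>C z) ^ n = (\<Sum>i\<le>Suc n. t ^ i *\<^sub>C v i))"
  proof (induction n)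
    case 0
    show ?case by (intro exI[of _ "\<lambda>i. if i = 0 then 1 else 0"]) auto
  next
    case (Suc n)
    then obtain v where v: "v 0 = y ^ n" "v 1 = (\<Sum>p<n. y ^ p * z * y ^ (n - Suc p))"
      "\<And>i. i > Suc n \<Longrightarrow> v i = 0" "\<And>t. (y + t *\<^sub>C z) ^ n = (\<Sum>i\<le>Suc n. t ^ i *\<^sub>C v i)"
      by blast
    let ?v = "\<lambda>i. y * v i + (if i = 0 then 0 else z * v (i - 1))"
    have "(y + t *\<^sub>C z) ^ Suc n = (\<Sum>i\<le>Suc (Suc n). t ^ i *\<^sub>C ?v i)" for t
    proof -
      have "(y + t *\<^sub>C z) ^ Suc n
          = (\<Sum>i\<le>Suc n. t ^ i *\<^sub>C (y * v i)) + (\<Sum>i\<le>Suc n. t ^ Suc i *\<^sub>C (z * v i))"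
        by (simp only: power_Suc v(4) distrib_right sum_distrib_left mult_scaleC_left
            mult_scaleC_right scaleC_scaleC mult.commute[of t] scaleC_add_right sum.distrib)
      also have "(\<Sum>i\<le>Suc n. t ^ i *\<^sub>C (y * v i)) = (\<Sum>i\<le>Suc (Suc n). t ^ i *\<^sub>C (y * v i))"
        by (simp add: v(3))
      also have "(\<Sum>i\<le>Suc n. t ^ Suc i *\<^sub>C (z * v i))
          = (\<Sum>i\<le>Suc (Suc n). t ^ i *\<^sub>C (if i = 0 then 0 else z * v (i - 1)))"
        by (simp only: sum.atMost_Suc_shift[of _ "Suc n"]) simp
      finally show ?thesis
        by (simp only: scaleC_add_right flip: sum.distrib)
    qed
    moreover have "?v 1 = (\<Sum>p<Suc n. y ^ p * z * y ^ (Suc n - Suc p))"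
      by (simp only: sum.lessThan_Suc_shift) (simp add: v(1,2)[unfolded One_nat_def] sum_distrib_left mult.assoc)
    ultimately show ?case
      using v(1,3) by (intro exI[of _ ?v]) auto
  qed
  with that show ?thesis by blast
qed

lemma sum_powers_commute:
  fixes y z :: "'a::{complex_algebra_1, comm_ring_1}"
  shows "(\<Sum>p<n. y ^ p * z * y ^ (n - Suc p)) = of_nat n *\<^sub>C (z * y ^ (n - 1))"
proof -
  have "y ^ p * z * y ^ (n - Suc p) = z * y ^ (n - 1)" if "p < n" for p
  proof -
    have "y ^ (n - 1) = y ^ p * y ^ (n - Suc p)" using that by (simp flip: power_add)
    then show ?thesis by (simp add: mult_ac)
  qed
  then show ?thesis by (simp add: of_nat_mult_scaleC)
qed

lemma sym_word_replicate: "sym_word (replicate n y) = sym_word [y] ^ n"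
  by (induction n) (simp_all add: sym_word_Nil sym_word_Cons[of _ "replicate _ _"])

lemma uea_word_Cons: "uea_word (x # w) = uea_word [x] * uea_word w"
  by (simp flip: uea_word_append)

lemma uea_word_Nil: "uea_word [] = 1"
  by (simp add: uea_word.abs_eq word_Nil one_uea.abs_eq)

lemma uea_word_replicate: "uea_word (replicate n y) = uea_word [y] ^ n"
  by (induction n) (simp_all add: uea_word_Nil uea_word_Cons[of _ "replicate _ _"])

lemma uea_word_1:
  fixes x y :: "'a::lie_algebra"
  shows "uea_word [x + y] = uea_word [x] + uea_word [y]"
    and "uea_word [c *\<^sub>C x] = c *\<^sub>C uea_word [x]"
    and "uea_word [bracket x y] = uea_word [x] * uea_word [y] - uea_word [y] * uea_word [x]"
proof -
  have lin: "word_linear (uea_word :: 'a list \<Rightarrow> _)"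
    using uea_word_linear unfolding uea_word_linear_def by blast
  from word_linearD[OF lin, of "[]" _ _ "[]"]
  show "uea_word [x + y] = uea_word [x] + uea_word [y]" "uea_word [c *\<^sub>C x] = c *\<^sub>C uea_word [x]"
    by simp_all
  have "uea_word ([] @ x # y # []) = uea_word ([] @ y # x # []) + uea_word ([] @ bracket x y # [])"
    using uea_word_linear unfolding uea_word_linear_def by blast
  then show "uea_word [bracket x y] = uea_word [x] * uea_word [y] - uea_word [y] * uea_word [x]"
    by (simp add: uea_word_Cons[of _ "[_]"])
qed

lemma sym_power_subset_span_powers:
  "sym_power k \<subseteq> cvec.span (range (\<lambda>y. sym_word [y] ^ k))" (is "_ \<subseteq> ?W")
proof -
  have W: "cvec.subspace ?W" by (rule cvec.subspace_span)
  \<comment> \<open>The letters of w have been split off, the remaining ones are all equal to an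
    arbitrary a. Moving a along the line \<open>a + t *\<^sub>C b\<close> and taking the coefficient
    of t splits off b as well.\<close>
  have *: "sym_word w * sym_word [a] ^ (k - length w) \<in> ?W" if "length w \<le> k" for w and a :: 'a
    using that
  proof (induction w arbitrary: a)
    case Nil
    then show ?case by (auto simp: sym_word_Nil intro: cvec.span_base)
  next
    case (Cons b w)
    define n where "n = k - length w"
    then have n: "n > 0" using Cons.prems by simp
    obtain v where v: "v 1 = (\<Sum>p<n. sym_word [a] ^ p * sym_word [b] * sym_word [a] ^ (n - Suc p))"
      "\<And>t. (sym_word [a] + t *\<^sub>C sym_word [b]) ^ n = (\<Sum>i\<le>Suc n. t ^ i *\<^sub>C v i)"
      using power_expansion[where n = n and y = "sym_word [a]" and z = "sym_word [b]"] by blast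
    have "(\<Sum>i\<le>Suc n. t ^ i *\<^sub>C (sym_word w * v i)) \<in> ?W" for t
    proof -
      have "sym_word w * sym_word [a + t *\<^sub>C b] ^ n \<in> ?W"
        using Cons.IH[of "a + t *\<^sub>C b"] Cons.prems by (simp add: n_def)
      then show ?thesis
        by (simp only: sym_word_1 v(2) sum_distrib_left mult_scaleC_right)
    qed
    then have "sym_word w * v 1 \<in> ?W"
      by (rule coefficients_in_subspace[OF W]) (use n in simp)
    also have "v 1 = of_nat n *\<^sub>C (sym_word [b] * sym_word [a] ^ (n - 1))"
    unfolding v(1) by (rule sum_powers_commute)
    finally have "(1 / of_nat n) *\<^sub>C (sym_word w * of_nat n *\<^sub>C (sym_word [b] * sym_word [a] ^ (n - 1))) \<in> ?W"
      by (rule cvec.span_scale)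
    with n have "sym_word w * (sym_word [b] * sym_word [a] ^ (n - 1)) \<in> ?W" by simp
    then show ?case by (simp add: sym_word_Cons[of b w] n_def mult_ac)
  qed
  have "sym_word w \<in> ?W" if "length w = k" for w
    \<comment> \<open>The exponent of a is 0 here, so any a will do.\<close>
    using *[of w undefined] that by simp
  then show ?thesis
    unfolding sym_power_def by (intro cvec.span_minimal W) blast
qed

lemma average_replicate:
  fixes f :: "'a::complex_vector list \<Rightarrow> 'b::complex_vector"
  shows "average f (replicate n y) = f (replicate n y)"
proof -
  have "permute_list \<sigma> (replicate n y) = replicate n y" if "\<sigma> permutes {..<n}" for \<sigma>
    using permutes_in_image[OF that] that
    by (intro nth_equalityI) (auto simp: permute_list_nth)
  then have "(\<Sum>\<sigma> | \<sigma> permutes {..<n}. f (permute_list \<sigma> (replicate n y)))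
      = of_nat (card {\<sigma>. \<sigma> permutes {..<n}}) *\<^sub>C f (replicate n y)"
    by (simp add: cvec.sum_constant_scale)
  then show ?thesis by (simp add: average_def card_permutations[of _ n])
qed

lemma symmetrise_power: "symmetrise (sym_word [y] ^ n) = uea_word [y] ^ n"
  by (simp add: symmetrise_word average_replicate uea_word_replicate flip: sym_word_replicate)

text \<open>The coefficient of \<open>t\<close> in \<open>symmetrise ((y + tz)\<^sup>n) = (y + tz)\<^sup>n\<close>.\<close>

lemma symmetrise_power_times:
  "of_nat n *\<^sub>C symmetrise (sym_word [z] * sym_word [y] ^ (n - 1))
    = (\<Sum>p<n. uea_word [y] ^ p * uea_word [z] * uea_word [y] ^ (n - Suc p))"
proof -
  obtain v where v: "v 1 = (\<Sum>p<n. sym_word [y] ^ p * sym_word [z] * sym_word [y] ^ (n - Suc p))"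
    "\<And>t. (sym_word [y] + t *\<^sub>C sym_word [z]) ^ n = (\<Sum>i\<le>Suc n. t ^ i *\<^sub>C v i)"
    using power_expansion[where n = n and y = "sym_word [y]" and z = "sym_word [z]"] by blast
  obtain u where u: "u 1 = (\<Sum>p<n. uea_word [y] ^ p * uea_word [z] * uea_word [y] ^ (n - Suc p))"
    "\<And>t. (uea_word [y] + t *\<^sub>C uea_word [z]) ^ n = (\<Sum>i\<le>Suc n. t ^ i *\<^sub>C u i)"
    using power_expansion[where n = n and y = "uea_word [y]" and z = "uea_word [z]"] by blast
  note lin = clinear_symmetrise[where ?'a = 'a]
  have "(\<Sum>i\<le>Suc n. t ^ i *\<^sub>C (symmetrise (v i) - u i)) \<in> {0}" for t
  proof -
    have "symmetrise (\<Sum>i\<le>Suc n. t ^ i *\<^sub>C v i) = (\<Sum>i\<le>Suc n. t ^ i *\<^sub>C u i)"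
      using symmetrise_power[of "y + t *\<^sub>C z" n] by (simp only: v u sym_word_1 uea_word_1)
    then show ?thesis
      by (simp only: clinear_sum[OF lin] clinear_scale[OF lin] cvec.scale_right_diff_distrib
          sum_subtractf) simp
  qed
  then have "symmetrise (v 1) - u 1 \<in> {0}"
    by (rule coefficients_in_subspace[rotated]) (auto simp: cvec.subspace_single_0)
  moreover have "v 1 = of_nat n *\<^sub>C (sym_word [z] * sym_word [y] ^ (n - 1))"
    unfolding v(1) by (rule sum_powers_commute)
  ultimately show ?thesis by (simp add: u(1)[unfolded One_nat_def] clinear_scale[OF lin])
qed

section \<open>Derivations of the symmetric algebra\<close>

lemma sym_alg_induct [case_names word add]:
  assumes "\<And>c w. P (c *\<^sub>C sym_word w)" "\<And>p q. P p \<Longrightarrow> P q \<Longrightarrow> P (p + q)"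
  shows "P (p :: 'a::complex_vector sym_alg)"
proof -
  have "P (abs_sym_alg q)" for q :: "'a free_alg"
  proof (induction q rule: poly_mapping_single_induct)
    case (single k c)
    have "abs_sym_alg (Poly_Mapping.single k c) = c *\<^sub>C sym_word k"
      by (simp add: sym_word.abs_eq scaleC_sym_alg.abs_eq)
    with assms(1) show ?case by simp
  next
    case (add p q)
    with assms(2) show ?case by (simp flip: plus_sym_alg.abs_eq)
  qed
  then show ?thesis by (induction p) simp
qed

text \<open>The images of the generators may have any degree: brackets give the adjoint action,
  constants give contraction with a covector, and quadratic polynomials give the Riccati fields
  below.\<close>

fun der_word :: "('a::complex_vector \<Rightarrow> 'a sym_alg) \<Rightarrow> 'a list \<Rightarrow> 'a sym_alg"
  where
    "der_word \<xi> [] = 0"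
  | "der_word \<xi> (y # w) = \<xi> y * sym_word w + sym_word [y] * der_word \<xi> w"

definition sym_der :: "('a::complex_vector \<Rightarrow> 'a sym_alg) \<Rightarrow> 'a sym_alg \<Rightarrow> 'a sym_alg"
  where "sym_der \<xi> = sym_lift (der_word \<xi>)"

lemma der_word_append: "der_word \<xi> (u @ v) = der_word \<xi> u * sym_word v + sym_word u * der_word \<xi> v"
proof (induction u)
  case (Cons y u)
  then show ?case by (simp add: sym_word_Cons[of _ u] sym_word_append algebra_simps)
qed (simp add: sym_word_Nil)

lemma sym_word_linear_der:
  assumes \<xi>: "clinear \<xi>"
  shows "sym_word_linear (der_word \<xi>)"
proof -
  have 1: "der_word \<xi> (u @ z # v) = der_word \<xi> u * (sym_word [z] * sym_word v)
      + sym_word u * (\<xi> z * sym_word v + sym_word [z] * der_word \<xi> v)" for u z v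
    unfolding der_word_append der_word.simps sym_word_Cons[of z v] ..
  have "word_linear (der_word \<xi>)"
    unfolding word_linear_def 1 clinear_add[OF \<xi>] clinear_scale[OF \<xi>] sym_word_1
    by (simp add: algebra_simps scaleC_add_right)
  moreover have "der_word \<xi> (u @ y # z # v) = der_word \<xi> (u @ z # y # v)" for u y z v
    unfolding der_word_append der_word.simps sym_word_Cons[of y "z # v"] sym_word_Cons[of z "y # v"]
      sym_word_Cons[of z v] sym_word_Cons[of y v]
    by (simp add: algebra_simps)
  ultimately show ?thesis by (simp add: sym_word_linear_def)
qed

context
  fixes \<xi> :: "'a::complex_vector \<Rightarrow> 'a sym_alg"
  assumes \<xi>: "clinear \<xi>"
begin

lemma sym_der_word: "sym_der \<xi> (sym_word w) = der_word \<xi> w"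
  unfolding sym_der_def by (rule sym_lift_word[OF sym_word_linear_der[OF \<xi>]])

lemma clinear_sym_der: "clinear (sym_der \<xi>)"
  unfolding sym_der_def by (rule clinear_sym_lift[OF sym_word_linear_der[OF \<xi>]])

lemma sym_der_1: "sym_der \<xi> 1 = 0"
  using sym_der_word[of "[]"] by (simp add: sym_word_Nil)

lemma sym_der_gen: "sym_der \<xi> (sym_word [y]) = \<xi> y"
  by (simp add: sym_der_word sym_word_Nil)

lemma sym_der_mult: "sym_der \<xi> (p * q) = sym_der \<xi> p * q + p * sym_der \<xi> q"
proof (induction p rule: sym_alg_induct)
  case (word c u)
  have "sym_der \<xi> (sym_word u * q) = sym_der \<xi> (sym_word u) * q + sym_word u * sym_der \<xi> q"
  proof (induction q rule: sym_alg_induct)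
    case (word d v)
    show ?case
      by (simp add: clinear_scale[OF clinear_sym_der] sym_der_word der_word_append scaleC_add_right
          flip: sym_word_append)
  qed (simp add: clinear_add[OF clinear_sym_der] algebra_simps)
  then show ?case by (simp add: clinear_scale[OF clinear_sym_der] scaleC_add_right)
qed (simp add: clinear_add[OF clinear_sym_der] algebra_simps)

lemma sym_der_power: "sym_der \<xi> (p ^ n) = of_nat n *\<^sub>C (sym_der \<xi> p * p ^ (n - 1))"
proof (induction n)
  case (Suc n)
  have "p * of_nat n *\<^sub>C (sym_der \<xi> p * p ^ (n - 1)) = of_nat n *\<^sub>C (sym_der \<xi> p * p ^ n)"
    by (cases n) (simp_all add: mult_ac)
  with Suc show ?case
    by (simp add: sym_der_mult scaleC_add_left)
qed (simp add: sym_der_1)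

end

lemma derivation_eqI:
  fixes d d' :: "'a::complex_vector sym_alg \<Rightarrow> 'a sym_alg"
  assumes "clinear d" "clinear d'"
    and "\<And>p q. d (p * q) = d p * q + p * d q" "\<And>p q. d' (p * q) = d' p * q + p * d' q"
    and gen: "\<And>y. d (sym_word [y]) = d' (sym_word [y])"
  shows "d p = d' p"
proof -
  have 1: "d 1 = 0" "d' 1 = 0" using assms(3)[of 1 1] assms(4)[of 1 1] by simp_all
  have "d (sym_word w) = d' (sym_word w)" for w
  proof (induction w)
    case (Cons y w)
    then show ?case by (simp add: sym_word_Cons[of y w] assms(3,4) gen)
  qed (simp add: sym_word_Nil 1)
  then show ?thesis
    by (induction p rule: sym_alg_induct)
       (simp_all add: clinear_scale[OF assms(1)] clinear_scale[OF assms(2)]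
         clinear_add[OF assms(1)] clinear_add[OF assms(2)])
qed

lemma ad_word_eq_der_word: "ad_word x w = der_word (\<lambda>y. sym_word [bracket x y]) w"
proof (induction w)
  case (Cons y w)
  then show ?case by (simp add: sym_word_Cons[of "bracket x y" w])
qed simp

lemma clinear_sym_word_bracket: "clinear (\<lambda>y. sym_word [bracket (x::'a::lie_algebra) y])"
  by (rule clinearI) (simp_all add: bracket_add_right bracket_scaleC_right sym_word_1)

lemma ad_sym_power:
  "ad_sym x (sym_word [y] ^ n) = of_nat n *\<^sub>C (sym_word [bracket x y] * sym_word [y] ^ (n - 1))"
proof -
  have "ad_sym x = sym_der (\<lambda>y. sym_word [bracket x y])"
    by (simp add: ad_sym_def sym_der_def ad_word_eq_der_word[abs_def])
  then show ?thesis
    by (simp add: sym_der_power[OF clinear_sym_word_bracket] sym_der_gen[OF clinear_sym_word_bracket])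
qed

section \<open>Finitely supported sums\<close>

lemma finite_supportI: "finite A \<Longrightarrow> (\<And>a. f a \<noteq> 0 \<Longrightarrow> a \<in> A) \<Longrightarrow> finite {a. f a \<noteq> 0}"
  by (rule finite_subset[of _ A]) auto

lemma finite_support_scaleC:
  fixes g :: "'i \<Rightarrow> 'a::complex_vector"
  shows "finite {i. c i \<noteq> 0} \<Longrightarrow> finite {i. c i *\<^sub>C g i \<noteq> 0}"
  by (erule finite_supportI) auto

lemma Sum_any_clinear:
  assumes D: "clinear D" and "finite {a. f a \<noteq> 0}"
  shows "D (Sum_any f) = Sum_any (\<lambda>a. D (f a))"
proof -
  have "Sum_any (\<lambda>a. D (f a)) = (\<Sum>a | f a \<noteq> 0. D (f a))"
    using assms by (intro Sum_any.expand_superset) (auto simp: clinear_0[OF D])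
  then show ?thesis by (simp add: Sum_any.expand_set clinear_sum[OF D])
qed

lemma Sum_any_diff:
  fixes f g :: "'i \<Rightarrow> 'a::ab_group_add"
  assumes "finite {a. f a \<noteq> 0}" "finite {a. g a \<noteq> 0}"
  shows "Sum_any (\<lambda>a. f a - g a) = Sum_any f - Sum_any g"
proof -
  have "finite {a. f a - g a \<noteq> 0}"
    by (rule finite_subset[of _ "{a. f a \<noteq> 0} \<union> {a. g a \<noteq> 0}"]) (use assms in auto)
  then have "Sum_any (\<lambda>a. f a - g a + g a) = Sum_any (\<lambda>a. f a - g a) + Sum_any g"
    using assms(2) by (rule Sum_any.distrib)
  then show ?thesis by simp
qed

lemma nonzero_in_projections:
  assumes "g a b \<noteq> 0"
  shows "a \<in> fst ` {p. g (fst p) (snd p) \<noteq> 0}" "b \<in> snd ` {p. g (fst p) (snd p) \<noteq> 0}"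
  by (rule image_eqI[of _ _ "(a, b)"]; use assms in simp)+

lemma Sum_any_nested:
  assumes "finite {p. g (fst p) (snd p) \<noteq> 0}"
  shows "Sum_any (\<lambda>a. Sum_any (g a)) = Sum_any (\<lambda>(a, b). g a b)"
    and "Sum_any (\<lambda>b. Sum_any (\<lambda>a. g a b)) = Sum_any (\<lambda>(a, b). g a b)"
proof -
  let ?S = "{p. g (fst p) (snd p) \<noteq> 0}"
  have fin: "finite (fst ` ?S \<times> snd ` ?S)" using assms by simp
  have sub: "{a. \<exists>b. g a b \<noteq> 0} \<times> {b. \<exists>a. g a b \<noteq> 0} \<subseteq> fst ` ?S \<times> snd ` ?S"
    using nonzero_in_projections[of g] by blast
  show 1: "Sum_any (\<lambda>a. Sum_any (g a)) = Sum_any (\<lambda>(a, b). g a b)"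
    by (rule Sum_any.cartesian_product[OF fin sub])
  show "Sum_any (\<lambda>b. Sum_any (\<lambda>a. g a b)) = Sum_any (\<lambda>(a, b). g a b)"
    unfolding 1[symmetric] by (rule Sum_any.swap[OF fin sub, symmetric])
qed

lemma finite_support_Sum_any:
  assumes "finite {p. g (fst p) (snd p) \<noteq> 0}"
  shows "finite {a. Sum_any (g a) \<noteq> 0}" and "finite {b. Sum_any (\<lambda>a. g a b) \<noteq> 0}"
proof -
  let ?S = "{p. g (fst p) (snd p) \<noteq> 0}"
  show "finite {a. Sum_any (g a) \<noteq> 0}"
  proof (rule finite_supportI[of "fst ` ?S"])
    fix a assume "Sum_any (g a) \<noteq> 0"
    then obtain b where "g a b \<noteq> 0" by (rule Sum_any.not_neutral_obtains_not_neutral)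
    then show "a \<in> fst ` ?S" by (rule nonzero_in_projections)
  qed (use assms in simp)
  show "finite {b. Sum_any (\<lambda>a. g a b) \<noteq> 0}"
  proof (rule finite_supportI[of "snd ` ?S"])
    fix b assume "Sum_any (\<lambda>a. g a b) \<noteq> 0"
    then obtain a where "g a b \<noteq> 0" by (rule Sum_any.not_neutral_obtains_not_neutral)
    then show "b \<in> snd ` ?S" by (rule nonzero_in_projections)
  qed (use assms in simp)
qed

lemma clinear_mult: "clinear (\<lambda>x. a * x :: 'a::complex_algebra_1)" "clinear (\<lambda>x. x * a :: 'a)"
  by (rule clinearI; simp add: algebra_simps)+

lemma clinear_scaleC: "clinear (\<lambda>x. c *\<^sub>C x)" "clinear (\<lambda>c. c *\<^sub>C x)"
  by (rule clinearI; simp add: scaleC_add_right scaleC_add_left mult.commute)+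

section \<open>The big cell of the Sato Grassmannian\<close>

type_synonym 'j cell_fun = "(('j \<times> 'j) \<Rightarrow>\<^sub>0 complex) sym_alg"

definition mat_mult :: "('j \<Rightarrow> 'j \<Rightarrow> complex) \<Rightarrow> ('j \<Rightarrow> 'j \<Rightarrow> complex) \<Rightarrow> 'j \<Rightarrow> 'j \<Rightarrow> complex"
  where "mat_mult x y i j = Sum_any (\<lambda>k. x i k * y k j)"

locale polarization =
  fixes P :: "'j set"
begin

text \<open>Finite rows and columns make products and the linear terms of \<open>U\<close> finite
  sums; finiteness of the block from H_- to H_+ does the same for the quadratic term and for traces.
  Multiplication by a Laurent polynomial has such a block because it pushes only finitely many
  powers of t across 0.\<close>

definition admissible :: "('j \<Rightarrow> 'j \<Rightarrow> complex) \<Rightarrow> bool"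
  where "admissible x \<longleftrightarrow> (\<forall>i. finite {j. x i j \<noteq> 0}) \<and> (\<forall>j. finite {i. x i j \<noteq> 0}) \<and>
    finite {(i, j). i \<in> P \<and> j \<notin> P \<and> x i j \<noteq> 0}"

definition Z :: "'j \<Rightarrow> 'j \<Rightarrow> 'j cell_fun"
  where "Z j i = (if j \<notin> P \<and> i \<in> P then sym_word [Poly_Mapping.single (j, i) 1] else 0)"

definition Q :: "('j \<Rightarrow> 'j \<Rightarrow> complex) \<Rightarrow> 'j \<Rightarrow> 'j \<Rightarrow> 'j cell_fun"
  where "Q x n k = x n k *\<^sub>C 1 - Sum_any (\<lambda>i. x i k *\<^sub>C Z n i)"

definition G :: "('j \<Rightarrow> 'j \<Rightarrow> complex) \<Rightarrow> 'j \<Rightarrow> 'j \<Rightarrow> 'j cell_fun"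
  where "G x k m = x k m *\<^sub>C 1 + Sum_any (\<lambda>j. x k j *\<^sub>C Z j m)"

text \<open>The velocity of a point of the cell: to first order in e, 1 + e x carries the graph of Z
  to the graph of Z + e U(x), where U(x) = x_-+ - Z x_++ + x_-- Z - Z x_+- Z. The sums need no range
  because \<open>Z\<close> vanishes outside its block.\<close>

definition U :: "('j \<Rightarrow> 'j \<Rightarrow> complex) \<Rightarrow> 'j \<Rightarrow> 'j \<Rightarrow> 'j cell_fun"
  where "U x n m = x n m *\<^sub>C 1 - Sum_any (\<lambda>i. x i m *\<^sub>C Z n i) + Sum_any (\<lambda>j. x n j *\<^sub>C Z j m)
    - Sum_any (\<lambda>(i, j). x i j *\<^sub>C (Z n i * Z j m))"

lemma Z_nonzeroD: "Z j i \<noteq> 0 \<Longrightarrow> j \<notin> P \<and> i \<in> P"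
  by (auto simp: Z_def split: if_splits)

lemma Z_Z_nonzeroD: "Z n i * Z j m \<noteq> 0 \<Longrightarrow> i \<in> P \<and> j \<notin> P"
  by (metis mult_zero_left mult_zero_right Z_nonzeroD)

context
  fixes x :: "'j \<Rightarrow> 'j \<Rightarrow> complex"
  assumes x: "admissible x"
begin

lemma finite_row: "finite {j. x i j \<noteq> 0}"
  and finite_col: "finite {i. x i j \<noteq> 0}"
  and finite_block: "finite {(i, j). i \<in> P \<and> j \<notin> P \<and> x i j \<noteq> 0}"
  using x by (auto simp: admissible_def)

lemma finite_support_block:
  assumes "\<And>i j. F i j \<noteq> 0 \<Longrightarrow> i \<in> P \<and> j \<notin> P"
  shows "finite {p. x (fst p) (snd p) *\<^sub>C F (fst p) (snd p) \<noteq> (0 :: 'j cell_fun)}"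
  by (rule finite_supportI[OF finite_block]) (use assms in fastforce)

lemma Sum_any_Q:
  assumes W: "\<And>j. W j \<noteq> 0 \<Longrightarrow> j \<notin> P"
  shows "Sum_any (\<lambda>j. Q x n j * W j)
    = Sum_any (\<lambda>j. x n j *\<^sub>C W j) - Sum_any (\<lambda>(i, j). x i j *\<^sub>C (Z n i * W j))"
proof -
  have fin: "finite {p. x (fst p) (snd p) *\<^sub>C (Z n (fst p) * W (snd p)) \<noteq> 0}"
    by (rule finite_support_block) (metis W Z_nonzeroD mult_zero_left mult_zero_right)
  have "Q x n j * W j = x n j *\<^sub>C W j - Sum_any (\<lambda>i. x i j *\<^sub>C (Z n i * W j))" for j
    using Sum_any_clinear[OF clinear_mult(2)[of "W j"] finite_support_scaleC[OF finite_col[of j]], of "Z n"]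
    by (simp add: Q_def left_diff_distrib)
  moreover have "Sum_any (\<lambda>j. x n j *\<^sub>C W j - Sum_any (\<lambda>i. x i j *\<^sub>C (Z n i * W j)))
      = Sum_any (\<lambda>j. x n j *\<^sub>C W j) - Sum_any (\<lambda>j. Sum_any (\<lambda>i. x i j *\<^sub>C (Z n i * W j)))"
    by (rule Sum_any_diff) (rule finite_support_scaleC[OF finite_row] finite_support_Sum_any(2)[OF fin])+
  ultimately show ?thesis
    unfolding Sum_any_nested(2)[OF fin] by simp
qed

lemma Sum_any_G:
  assumes W: "\<And>i. W i \<noteq> 0 \<Longrightarrow> i \<in> P"
  shows "Sum_any (\<lambda>i. W i * G x i m)
    = Sum_any (\<lambda>i. x i m *\<^sub>C W i) + Sum_any (\<lambda>(i, j). x i j *\<^sub>C (W i * Z j m))"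
proof -
  have fin: "finite {p. x (fst p) (snd p) *\<^sub>C (W (fst p) * Z (snd p) m) \<noteq> 0}"
    by (rule finite_support_block) (metis W Z_nonzeroD mult_zero_left mult_zero_right)
  have "W i * G x i m = x i m *\<^sub>C W i + Sum_any (\<lambda>j. x i j *\<^sub>C (W i * Z j m))" for i
    using Sum_any_clinear[OF clinear_mult(1)[of "W i"] finite_support_scaleC[OF finite_row[of i]], of "\<lambda>j. Z j m"]
    by (simp add: G_def distrib_left)
  moreover have "Sum_any (\<lambda>i. x i m *\<^sub>C W i + Sum_any (\<lambda>j. x i j *\<^sub>C (W i * Z j m)))
      = Sum_any (\<lambda>i. x i m *\<^sub>C W i) + Sum_any (\<lambda>i. Sum_any (\<lambda>j. x i j *\<^sub>C (W i * Z j m)))"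
    by (rule Sum_any.distrib) (rule finite_support_scaleC[OF finite_col] finite_support_Sum_any(1)[OF fin])+
  ultimately show ?thesis
    unfolding Sum_any_nested(1)[OF fin] by simp
qed

lemma U_eq_Q: "U x n m = Q x n m + Sum_any (\<lambda>j. Q x n j * Z j m)"
  by (subst Sum_any_Q) (auto simp: U_def Q_def dest: Z_nonzeroD)

lemma U_eq_G: "U x n m = G x n m - Sum_any (\<lambda>i. Z n i * G x i m)"
  by (subst Sum_any_G) (auto simp: U_def G_def dest: Z_nonzeroD)

text \<open>For j outside \<open>P\<close>, an entry that does not come from row n of x needs a
  nonzero entry of column j in the block of x from H_- to H_+, and that block is finite.\<close>

lemma finite_support_Q: "finite {j. j \<notin> P \<and> Q x n j \<noteq> 0}"
proof -
  have "j \<in> {j. x n j \<noteq> 0} \<union> snd ` {(i, j). i \<in> P \<and> j \<notin> P \<and> x i j \<noteq> 0}"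
    if "j \<notin> P" "Q x n j \<noteq> 0" for j
  proof (rule ccontr)
    assume j: "\<not> ?thesis"
    have "x i j *\<^sub>C Z n i = 0" for i
    proof (cases "Z n i = 0")
      case False
      then have "x i j = 0"
        using that(1) Z_nonzeroD[of n i] j by (auto intro: rev_image_eqI)
      then show ?thesis by simp
    qed simp
    with j that(2) show False by (simp add: Q_def Sum_any.neutral)
  qed
  then have "{j. j \<notin> P \<and> Q x n j \<noteq> 0}
      \<subseteq> {j. x n j \<noteq> 0} \<union> snd ` {(i, j). i \<in> P \<and> j \<notin> P \<and> x i j \<noteq> 0}" by blast
  then show ?thesis
    by (rule finite_subset) (intro finite_UnI finite_imageI finite_row finite_block)
qed

lemma finite_support_G: "finite {i. i \<in> P \<and> G x i m \<noteq> 0}"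
proof -
  have "i \<in> {i. x i m \<noteq> 0} \<union> fst ` {(i, j). i \<in> P \<and> j \<notin> P \<and> x i j \<noteq> 0}"
    if "i \<in> P" "G x i m \<noteq> 0" for i
  proof (rule ccontr)
    assume i: "\<not> ?thesis"
    have "x i j *\<^sub>C Z j m = 0" for j
    proof (cases "Z j m = 0")
      case False
      then have "x i j = 0"
        using that(1) Z_nonzeroD[of j m] i by (auto intro: rev_image_eqI)
      then show ?thesis by simp
    qed simp
    with i that(2) show False by (simp add: G_def Sum_any.neutral)
  qed
  then have "{i. i \<in> P \<and> G x i m \<noteq> 0}
      \<subseteq> {i. x i m \<noteq> 0} \<union> fst ` {(i, j). i \<in> P \<and> j \<notin> P \<and> x i j \<noteq> 0}" by blast
  then show ?thesis
    by (rule finite_subset) (intro finite_UnI finite_imageI finite_col finite_block)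
qed

end

text \<open>A path from j outside \<open>P\<close> to i in \<open>P\<close> through k crosses
  between the two halves in one of the factors: in the finite block of y if k lies in
  \<open>P\<close>, in that of x otherwise.\<close>

lemma admissible_mat_mult:
  assumes x: "admissible x" and y: "admissible y"
  shows "admissible (mat_mult x y)"
proof -
  have nz: "\<exists>k. x i k \<noteq> 0 \<and> y k j \<noteq> 0" if "mat_mult x y i j \<noteq> 0" for i j
    using that Sum_any.not_neutral_obtains_not_neutral[of "\<lambda>k. x i k * y k j"] unfolding mat_mult_def
    by (metis mult_zero_left mult_zero_right)
  have "finite {j. mat_mult x y i j \<noteq> 0}" for i
    by (rule finite_subset[of _ "\<Union>k\<in>{k. x i k \<noteq> 0}. {j. y k j \<noteq> 0}"])
       (use finite_row[OF x] finite_row[OF y] in \<open>auto dest: nz\<close>)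
  moreover have "finite {i. mat_mult x y i j \<noteq> 0}" for j
    by (rule finite_subset[of _ "\<Union>k\<in>{k. y k j \<noteq> 0}. {i. x i k \<noteq> 0}"])
       (use finite_col[OF x] finite_col[OF y] in \<open>auto dest: nz\<close>)
  moreover have "finite {(i, j). i \<in> P \<and> j \<notin> P \<and> mat_mult x y i j \<noteq> 0}"
  proof (rule finite_subset)
    let ?A = "\<lambda>x. {(i, j). i \<in> P \<and> j \<notin> P \<and> x i j \<noteq> (0::complex)}"
    show "finite ((\<Union>(k, j)\<in>?A y. {i. x i k \<noteq> 0} \<times> {j}) \<union> (\<Union>(i, k)\<in>?A x. {i} \<times> {j. y k j \<noteq> 0}))"
      using finite_col[OF x] finite_row[OF y]
      by (intro finite_UnI finite_UN_I finite_block x y) (auto split: prod.splits)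
    show "{(i, j). i \<in> P \<and> j \<notin> P \<and> mat_mult x y i j \<noteq> 0}
        \<subseteq> (\<Union>(k, j)\<in>?A y. {i. x i k \<noteq> 0} \<times> {j}) \<union> (\<Union>(i, k)\<in>?A x. {i} \<times> {j. y k j \<noteq> 0})"
    proof safe
      fix i j assume ij: "i \<in> P" "j \<notin> P" "mat_mult x y i j \<noteq> 0"
        "(i, j) \<notin> (\<Union>(i, k)\<in>?A x. {i} \<times> {j. y k j \<noteq> 0})"
      with nz obtain k where "x i k \<noteq> 0" "y k j \<noteq> 0" by blast
      with ij have "k \<in> P" by blast
      with ij \<open>x i k \<noteq> 0\<close> \<open>y k j \<noteq> 0\<close>
      show "(i, j) \<in> (\<Union>(k, j)\<in>?A y. {i. x i k \<noteq> 0} \<times> {j})" by blast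
    qed
  qed
  ultimately show ?thesis by (simp add: admissible_def)
qed

lemma finite_support_QG:
  assumes "admissible x" "admissible y"
  shows "finite {k. Q x n k * G y k m \<noteq> 0}"
  by (rule finite_supportI[OF finite_UnI[OF finite_support_Q[OF assms(1), of n] finite_support_G[OF assms(2), of m]]])
     (metis (mono_tags, lifting) UnI1 UnI2 mem_Collect_eq mult_zero_left mult_zero_right)

text \<open>\<open>Q\<close> and \<open>G\<close> are the block matrices \<open>(-Z, 1) x\<close> and \<open>x (1, Z)\<^sup>T\<close>, and \<open>U\<close> is \<open>(-Z, 1) x (1, Z)\<^sup>T\<close>.  The
  next identity holds because \<open>(1, Z)\<^sup>T (1, 0) + (0, 1)\<^sup>T (-Z, 1)\<close> is the identity matrix.\<close>

lemma U_G_plus_Q_U: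
  assumes x: "admissible x" and y: "admissible y"
  shows "Sum_any (\<lambda>i. if i \<in> P then U x n i * G y i m else 0)
    + Sum_any (\<lambda>j. if j \<notin> P then Q x n j * U y j m else 0) = Sum_any (\<lambda>k. Q x n k * G y k m)"
proof -
  \<comment> \<open>The cross term Q Z G. It enters the first sum with a plus sign through
    \<open>U_eq_Q\<close> and the second with a minus sign through \<open>U_eq_G\<close>.\<close>
  define h where "h j i = Q x n j * Z j i * G y i m" for j i
  have fin: "finite {p. h (fst p) (snd p) \<noteq> 0}"
  proof (rule finite_supportI)
    show "finite ({j. j \<notin> P \<and> Q x n j \<noteq> 0} \<times> {i. i \<in> P \<and> G y i m \<noteq> 0})"
      by (intro finite_cartesian_product finite_support_Q finite_support_G x y)
    fix p assume p: "h (fst p) (snd p) \<noteq> 0"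
    then have "Q x n (fst p) \<noteq> 0" "Z (fst p) (snd p) \<noteq> 0" "G y (snd p) m \<noteq> 0"
      unfolding h_def by auto
    with Z_nonzeroD show "p \<in> {j. j \<notin> P \<and> Q x n j \<noteq> 0} \<times> {i. i \<in> P \<and> G y i m \<noteq> 0}"
      by (auto simp: mem_Times_iff)
  qed
  have finQ: "finite {j. (if j \<notin> P then Q x n j * G y j m else 0) \<noteq> 0}"
    and finG: "finite {i. (if i \<in> P then Q x n i * G y i m else 0) \<noteq> 0}"
    using finite_support_QG[OF x y, of n m] by (auto elim!: finite_subset[rotated])
  have "(if i \<in> P then U x n i * G y i m else 0)
      = (if i \<in> P then Q x n i * G y i m else 0) + Sum_any (\<lambda>j. h j i)" for i
  proof (cases "i \<in> P")
    case True
    have "finite {j. Q x n j * Z j i \<noteq> 0}"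
      by (rule finite_supportI[OF finite_support_Q[OF x, of n]])
         (metis (mono_tags, lifting) Z_nonzeroD mem_Collect_eq mult_zero_left mult_zero_right)
    from Sum_any_clinear[OF clinear_mult(2) this, of "G y i m"] True show ?thesis
      by (simp add: U_eq_Q[OF x] distrib_right h_def)
  next
    case False
    then have "Z j i = 0" for j using Z_nonzeroD[of j i] by blast
    then have "h j i = 0" for j by (simp add: h_def)
    with False show ?thesis by simp
  qed
  then have 1: "Sum_any (\<lambda>i. if i \<in> P then U x n i * G y i m else 0)
      = Sum_any (\<lambda>i. if i \<in> P then Q x n i * G y i m else 0) + Sum_any (\<lambda>(j, i). h j i)"
    by (simp only: Sum_any.distrib[OF finG finite_support_Sum_any(2)[OF fin]] Sum_any_nested(2)[OF fin])
  have "(if j \<notin> P then Q x n j * U y j m else 0)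
      = (if j \<notin> P then Q x n j * G y j m else 0) - Sum_any (h j)" for j
  proof (cases "j \<notin> P")
    case True
    have "finite {i. Z j i * G y i m \<noteq> 0}"
      by (rule finite_supportI[OF finite_support_G[OF y, of m]])
         (metis (mono_tags, lifting) Z_nonzeroD mem_Collect_eq mult_zero_left mult_zero_right)
    from Sum_any_clinear[OF clinear_mult(1) this, of "Q x n j"] True show ?thesis
      by (simp add: U_eq_G[OF y] right_diff_distrib h_def[abs_def] mult.assoc)
  next
    case False
    then have "Z j i = 0" for i using Z_nonzeroD[of j i] by blast
    then have "h j i = 0" for i by (simp add: h_def)
    with False show ?thesis by simp
  qed
  then have 2: "Sum_any (\<lambda>j. if j \<notin> P then Q x n j * U y j m else 0)
      = Sum_any (\<lambda>j. if j \<notin> P then Q x n j * G y j m else 0) - Sum_any (\<lambda>(j, i). h j i)"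
    by (simp only: Sum_any_diff[OF finQ finite_support_Sum_any(1)[OF fin]] Sum_any_nested(1)[OF fin])
  have "Sum_any (\<lambda>k. Q x n k * G y k m) = Sum_any (\<lambda>k. (if k \<in> P then Q x n k * G y k m else 0)
      + (if k \<notin> P then Q x n k * G y k m else 0))"
    by (rule arg_cong[of _ _ Sum_any]) (simp add: fun_eq_iff)
  also have "\<dots> = Sum_any (\<lambda>k. if k \<in> P then Q x n k * G y k m else 0)
      + Sum_any (\<lambda>k. if k \<notin> P then Q x n k * G y k m else 0)"
    by (rule Sum_any.distrib[OF finG finQ])
  finally show ?thesis unfolding 1 2 by simp
qed

lemma Sum_any_scaleC_left:
  fixes v :: "'a::complex_vector"
  shows "finite {k. c k \<noteq> 0} \<Longrightarrow> Sum_any c *\<^sub>C v = Sum_any (\<lambda>k. c k *\<^sub>C v)"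
  by (rule Sum_any_clinear[OF clinear_scaleC(2)])

lemma mat_mult_scaleC:
  assumes "admissible x"
  shows "mat_mult x y i j *\<^sub>C (v :: 'j cell_fun) = Sum_any (\<lambda>k. (x i k * y k j) *\<^sub>C v)"
  unfolding mat_mult_def
  by (rule Sum_any_scaleC_left) (rule finite_supportI[OF finite_row[OF assms, of i]], simp)

text \<open>The crossing argument again, now for the triples (i, k, j) themselves, so that the sums
  over k and over (i, j) may be exchanged.\<close>

lemma finite_support_triple:
  assumes x: "admissible x" and y: "admissible y"
    and F: "\<And>i j. F i j \<noteq> 0 \<Longrightarrow> i \<in> P \<and> j \<notin> P"
  shows "finite {p. (x (fst (fst p)) (snd p) * y (snd p) (snd (fst p)))
    *\<^sub>C F (fst (fst p)) (snd (fst p)) \<noteq> (0 :: 'j cell_fun)}"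
proof (rule finite_supportI)
  let ?A = "\<lambda>x. {(i, j). i \<in> P \<and> j \<notin> P \<and> x i j \<noteq> (0::complex)}"
  let ?S = "(\<Union>(k, j)\<in>?A y. (\<lambda>i. ((i, j), k)) ` {i. x i k \<noteq> 0})
    \<union> (\<Union>(i, k)\<in>?A x. (\<lambda>j. ((i, j), k)) ` {j. y k j \<noteq> 0})"
  show "finite ?S"
    using finite_col[OF x] finite_row[OF y]
    by (intro finite_UnI finite_UN_I finite_block x y) (auto split: prod.splits)
  fix p assume p: "(x (fst (fst p)) (snd p) * y (snd p) (snd (fst p)))
    *\<^sub>C F (fst (fst p)) (snd (fst p)) \<noteq> (0 :: 'j cell_fun)"
  obtain i j k where p_eq: "p = ((i, j), k)" by (metis surj_pair)
  have "i \<in> P" "j \<notin> P" "x i k \<noteq> 0" "y k j \<noteq> 0" using p F[of i j] by (auto simp: p_eq)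
  then show "p \<in> ?S" unfolding p_eq by (cases "k \<in> P") blast+
qed

text \<open>Associativity of (-Z, 1) x y (1, Z)^T. The families a, b, c, d correspond to the four
  terms of \<open>U\<close>; each is finitely supported as a double family, which justifies summing
  over the middle index k first.\<close>

lemma Q_G_eq_U:
  assumes x: "admissible x" and y: "admissible y"
  shows "Sum_any (\<lambda>k. Q x n k * G y k m) = U (mat_mult x y) n m"
proof -
  define a where "a k = (x n k * y k m) *\<^sub>C (1 :: 'j cell_fun)" for k
  define b where "b j k = (x n k * y k j) *\<^sub>C Z j m" for j k
  define c where "c i k = (x i k * y k m) *\<^sub>C Z n i" for i k
  define d where "d p k = (x (fst p) k * y k (snd p)) *\<^sub>C (Z n (fst p) * Z (snd p) m)" for p k
  have fa: "finite {k. a k \<noteq> 0}"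
    unfolding a_def by (rule finite_supportI[OF finite_row[OF x, of n]]) auto
  have fb: "finite {p. b (fst p) (snd p) \<noteq> 0}"
    by (rule finite_supportI[of "\<Union>k\<in>{k. x n k \<noteq> 0}. (\<lambda>j. (j, k)) ` {j. y k j \<noteq> 0}"])
       (use finite_row[OF x] finite_row[OF y] in \<open>force simp: b_def\<close>)+
  have fc: "finite {p. c (fst p) (snd p) \<noteq> 0}"
    by (rule finite_supportI[of "\<Union>k\<in>{k. y k m \<noteq> 0}. (\<lambda>i. (i, k)) ` {i. x i k \<noteq> 0}"])
       (use finite_col[OF x] finite_col[OF y] in \<open>force simp: c_def\<close>)+
  have fd: "finite {p. d (fst p) (snd p) \<noteq> 0}"
    unfolding d_def by (rule finite_support_triple[OF x y]) (rule Z_Z_nonzeroD)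
  have QG: "Q x n k * G y k m = a k + Sum_any (\<lambda>j. b j k) - (Sum_any (\<lambda>i. c i k) + Sum_any (\<lambda>p. d p k))" for k
  proof -
    have 1: "Sum_any (\<lambda>j. b j k) = x n k *\<^sub>C Sum_any (\<lambda>j. y k j *\<^sub>C Z j m)"
      by (simp add: b_def Sum_any_clinear[OF clinear_scaleC(1) finite_support_scaleC[OF finite_row[OF y]]])
    have 2: "Sum_any (\<lambda>i. c i k) = y k m *\<^sub>C Sum_any (\<lambda>i. x i k *\<^sub>C Z n i)"
      by (simp add: c_def mult.commute[of _ "y k m"]
          Sum_any_clinear[OF clinear_scaleC(1) finite_support_scaleC[OF finite_col[OF x]]])
    have "Sum_any (\<lambda>i. x i k *\<^sub>C Z n i) * Sum_any (\<lambda>j. y k j *\<^sub>C Z j m)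
        = Sum_any (\<lambda>i. Sum_any (\<lambda>j. d (i, j) k))"
      by (subst Sum_any_product)
         (simp_all add: finite_support_scaleC finite_col[OF x] finite_row[OF y] d_def mult.commute[of "y _ _"])
    also have "\<dots> = Sum_any (\<lambda>p. d p k)"
    proof -
      have "finite {p. d (fst p, snd p) k \<noteq> 0}"
        by (rule finite_supportI[of "{i. x i k \<noteq> 0} \<times> {j. y k j \<noteq> 0}"])
           (use finite_col[OF x] finite_row[OF y] in \<open>auto simp: d_def mem_Times_iff\<close>)
      from Sum_any_nested(1)[of "\<lambda>i j. d (i, j) k", OF this] show ?thesis by simp
    qed
    finally show ?thesis
      unfolding Q_def G_def 1 2 by (simp add: a_def algebra_simps)
  qed
  have "Sum_any (\<lambda>k. Q x n k * G y k m)
      = (Sum_any a + Sum_any (\<lambda>k. Sum_any (\<lambda>j. b j k)))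
        - (Sum_any (\<lambda>k. Sum_any (\<lambda>i. c i k)) + Sum_any (\<lambda>k. Sum_any (\<lambda>p. d p k)))"
  proof -
    note fs = fa finite_support_Sum_any(2)[OF fb] finite_support_Sum_any(2)[OF fc] finite_support_Sum_any(2)[OF fd]
    have plus: "finite {k. f k + g k \<noteq> 0}" if "finite {k. f k \<noteq> 0}" "finite {k. g k \<noteq> 0}"
      for f g :: "'j \<Rightarrow> 'j cell_fun"
      by (rule finite_subset[OF _ finite_UnI[OF that]]) auto
    show ?thesis
      unfolding QG by (simp only: Sum_any_diff[OF plus plus, OF fs] Sum_any.distrib fs)
  qed
  also have "Sum_any a = mat_mult x y n m *\<^sub>C 1"
    by (simp add: a_def[abs_def] mat_mult_scaleC[OF x])
  also have "Sum_any (\<lambda>k. Sum_any (\<lambda>j. b j k)) = Sum_any (\<lambda>j. mat_mult x y n j *\<^sub>C Z j m)"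
    unfolding Sum_any_nested(2)[OF fb] Sum_any_nested(1)[OF fb, symmetric]
    by (simp add: b_def[abs_def] mat_mult_scaleC[OF x])
  also have "Sum_any (\<lambda>k. Sum_any (\<lambda>i. c i k)) = Sum_any (\<lambda>i. mat_mult x y i m *\<^sub>C Z n i)"
    unfolding Sum_any_nested(2)[OF fc] Sum_any_nested(1)[OF fc, symmetric]
    by (simp add: c_def[abs_def] mat_mult_scaleC[OF x])
  also have "Sum_any (\<lambda>k. Sum_any (\<lambda>p. d p k)) = Sum_any (\<lambda>(i, j). mat_mult x y i j *\<^sub>C (Z n i * Z j m))"
    unfolding Sum_any_nested(2)[OF fd] Sum_any_nested(1)[OF fd, symmetric]
    by (simp add: d_def[abs_def] mat_mult_scaleC[OF x] case_prod_unfold)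
  finally show ?thesis by (simp add: U_def algebra_simps)
qed

subsection \<open>Riccati vector fields\<close>

definition D :: "('j \<Rightarrow> 'j \<Rightarrow> complex) \<Rightarrow> 'j cell_fun \<Rightarrow> 'j cell_fun"
  where "D x = sym_der (lin_ext (\<lambda>(j, i). if j \<notin> P \<and> i \<in> P then U x j i else 0))"

lemma clinear_D: "clinear (D x)"
  unfolding D_def by (rule clinear_sym_der[OF clinear_lin_ext])

lemma D_mult: "D x (p * q) = D x p * q + p * D x q"
  unfolding D_def by (rule sym_der_mult[OF clinear_lin_ext])

lemma D_1: "D x 1 = 0"
  unfolding D_def by (rule sym_der_1[OF clinear_lin_ext])

lemma D_gen: "D x (sym_word [Poly_Mapping.single (j, i) 1]) = (if j \<notin> P \<and> i \<in> P then U x j i else 0)"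
  unfolding D_def sym_der_gen[OF clinear_lin_ext] by simp

lemma D_Z: "D x (Z j i) = (if j \<notin> P \<and> i \<in> P then U x j i else 0)"
  by (simp add: Z_def D_gen clinear_0[OF clinear_D])

text \<open>The product rule for (-Z, 1) y (1, Z)^T, in which the derivative of Z along x is
  U(x).\<close>

lemma D_U:
  assumes y: "admissible y" and nm: "n \<notin> P" "m \<in> P"
  shows "D x (U y n m) = Sum_any (\<lambda>j. if j \<notin> P then Q y n j * U x j m else 0)
    - Sum_any (\<lambda>i. if i \<in> P then U x n i * G y i m else 0)"
proof -
  have supp: "D x (Z j i) \<noteq> 0 \<Longrightarrow> j \<notin> P \<and> i \<in> P" for j i by (simp add: D_Z split: if_splits)
  have fin: "finite {p. y (fst p) (snd p) *\<^sub>C (D x (Z n (fst p)) * Z (snd p) m) \<noteq> 0}"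
    "finite {p. y (fst p) (snd p) *\<^sub>C (Z n (fst p) * D x (Z (snd p) m)) \<noteq> 0}"
    by (rule finite_support_block[OF y]; metis supp Z_nonzeroD mult_zero_left mult_zero_right)+
  have finZ: "finite {p. y (fst p) (snd p) *\<^sub>C (Z n (fst p) * Z (snd p) m) \<noteq> 0}"
    by (rule finite_support_block[OF y]) (rule Z_Z_nonzeroD)
  have "D x (U y n m) = - Sum_any (\<lambda>i. y i m *\<^sub>C D x (Z n i)) + Sum_any (\<lambda>j. y n j *\<^sub>C D x (Z j m))
      - (Sum_any (\<lambda>(i, j). y i j *\<^sub>C (D x (Z n i) * Z j m))
        + Sum_any (\<lambda>(i, j). y i j *\<^sub>C (Z n i * D x (Z j m))))"
  proof -
    have "D x (Sum_any (\<lambda>i. y i m *\<^sub>C Z n i)) = Sum_any (\<lambda>i. y i m *\<^sub>C D x (Z n i))"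
      by (subst Sum_any_clinear[OF clinear_D finite_support_scaleC[OF finite_col[OF y]]])
         (simp add: clinear_scale[OF clinear_D])
    moreover have "D x (Sum_any (\<lambda>j. y n j *\<^sub>C Z j m)) = Sum_any (\<lambda>j. y n j *\<^sub>C D x (Z j m))"
      by (subst Sum_any_clinear[OF clinear_D finite_support_scaleC[OF finite_row[OF y]]])
         (simp add: clinear_scale[OF clinear_D])
    moreover have "D x (Sum_any (\<lambda>(i, j). y i j *\<^sub>C (Z n i * Z j m)))
        = Sum_any (\<lambda>p. y (fst p) (snd p) *\<^sub>C (D x (Z n (fst p)) * Z (snd p) m)
          + y (fst p) (snd p) *\<^sub>C (Z n (fst p) * D x (Z (snd p) m)))"
      unfolding case_prod_unfold
      by (subst Sum_any_clinear[OF clinear_D finZ])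
         (simp add: clinear_scale[OF clinear_D] D_mult scaleC_add_right)
    ultimately show ?thesis
      unfolding U_def
      by (simp add: clinear_add[OF clinear_D] clinear_diff[OF clinear_D] clinear_scale[OF clinear_D] D_1
          Sum_any.distrib[OF fin] case_prod_unfold)
  qed
  also have "\<dots> = Sum_any (\<lambda>j. Q y n j * D x (Z j m)) - Sum_any (\<lambda>i. D x (Z n i) * G y i m)"
    by (subst Sum_any_Q[OF y], use supp in blast, subst Sum_any_G[OF y], use supp in blast) simp
  also have "(\<lambda>j. Q y n j * D x (Z j m)) = (\<lambda>j. if j \<notin> P then Q y n j * U x j m else 0)"
    using nm by (auto simp: D_Z)
  also have "(\<lambda>i. D x (Z n i) * G y i m) = (\<lambda>i. if i \<in> P then U x n i * G y i m else 0)"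
    using nm by (auto simp: D_Z)
  finally show ?thesis .
qed

text \<open>By \<open>D_U\<close> the left side consists of four products;
  \<open>U_G_plus_Q_U\<close> for (x, y) and for (y, x) groups them in pairs. The products come out
  in reversed order, hence an anti-representation.\<close>

lemma D_commute_Z:
  assumes "admissible x" "admissible y"
  shows "D x (D y (Z n m)) - D y (D x (Z n m))
    = (if n \<notin> P \<and> m \<in> P then U (mat_mult y x) n m - U (mat_mult x y) n m else 0)"
proof (cases "n \<notin> P \<and> m \<in> P")
  case True
  then show ?thesis
    using U_G_plus_Q_U[OF assms, of n m, unfolded Q_G_eq_U[OF assms]]
      U_G_plus_Q_U[OF assms(2,1), of n m, unfolded Q_G_eq_U[OF assms(2,1)]]
    by (simp add: D_Z D_U assms flip: add_diff_eq diff_diff_eq2) (simp add: algebra_simps)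
next
  case False
  then have "Z n m = 0" by (auto simp: Z_def)
  with False show ?thesis by (auto simp: clinear_0[OF clinear_D])
qed

end

section \<open>Linearity and commutators of the Riccati fields; the trace cocycle\<close>

context polarization
begin

lemma U_scale:
  assumes "admissible x"
  shows "U (\<lambda>i j. c * x i j) n m = c *\<^sub>C U x n m"
proof -
  have fin: "finite {p. x (fst p) (snd p) *\<^sub>C (Z n (fst p) * Z (snd p) m) \<noteq> 0}"
    by (rule finite_support_block[OF assms]) (rule Z_Z_nonzeroD)
  note lin = Sum_any_clinear[OF clinear_scaleC(1), of _ c]
  have "c *\<^sub>C Sum_any (\<lambda>(i, j). x i j *\<^sub>C (Z n i * Z j m))
      = Sum_any (\<lambda>(i, j). (c * x i j) *\<^sub>C (Z n i * Z j m))"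
    unfolding case_prod_unfold by (subst lin[OF fin]) simp
  then show ?thesis
    by (simp add: U_def scaleC_add_right cvec.scale_right_diff_distrib
        lin[OF finite_support_scaleC[OF finite_row[OF assms]]]
        lin[OF finite_support_scaleC[OF finite_col[OF assms]]])
qed

lemma U_add:
  assumes x: "admissible x" and y: "admissible y"
  shows "U (\<lambda>i j. x i j + y i j) n m = U x n m + U y n m"
proof -
  have fin: "finite {p. x (fst p) (snd p) *\<^sub>C (Z n (fst p) * Z (snd p) m) \<noteq> 0}" if "admissible x" for x
    by (rule finite_support_block[OF that]) (rule Z_Z_nonzeroD)
  have "Sum_any (\<lambda>(i, j). (x i j + y i j) *\<^sub>C (Z n i * Z j m))
      = Sum_any (\<lambda>(i, j). x i j *\<^sub>C (Z n i * Z j m)) + Sum_any (\<lambda>(i, j). y i j *\<^sub>C (Z n i * Z j m))"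
    unfolding case_prod_unfold scaleC_add_left by (rule Sum_any.distrib[OF fin[OF x] fin[OF y]])
  moreover have "Sum_any (\<lambda>i. (x i m + y i m) *\<^sub>C Z n i)
      = Sum_any (\<lambda>i. x i m *\<^sub>C Z n i) + Sum_any (\<lambda>i. y i m *\<^sub>C Z n i)"
    unfolding scaleC_add_left
    by (rule Sum_any.distrib; rule finite_support_scaleC; rule finite_col[OF x] finite_col[OF y])
  moreover have "Sum_any (\<lambda>j. (x n j + y n j) *\<^sub>C Z j m)
      = Sum_any (\<lambda>j. x n j *\<^sub>C Z j m) + Sum_any (\<lambda>j. y n j *\<^sub>C Z j m)"
    unfolding scaleC_add_left
    by (rule Sum_any.distrib; rule finite_support_scaleC; rule finite_row[OF x] finite_row[OF y])
  ultimately show ?thesis by (simp add: U_def scaleC_add_left)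
qed

lemma admissible_add: "admissible x \<Longrightarrow> admissible y \<Longrightarrow> admissible (\<lambda>i j. x i j + y i j)"
  unfolding admissible_def
proof (intro conjI allI)
  assume x: "(\<forall>i. finite {j. x i j \<noteq> 0}) \<and> (\<forall>j. finite {i. x i j \<noteq> 0}) \<and>
      finite {(i, j). i \<in> P \<and> j \<notin> P \<and> x i j \<noteq> 0}"
    and y: "(\<forall>i. finite {j. y i j \<noteq> 0}) \<and> (\<forall>j. finite {i. y i j \<noteq> 0}) \<and>
      finite {(i, j). i \<in> P \<and> j \<notin> P \<and> y i j \<noteq> 0}"
  show "finite {j. x i j + y i j \<noteq> 0}" for i
    by (rule finite_subset[of _ "{j. x i j \<noteq> 0} \<union> {j. y i j \<noteq> 0}"]) (use x y in auto)
  show "finite {i. x i j + y i j \<noteq> 0}" for j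
    by (rule finite_subset[of _ "{i. x i j \<noteq> 0} \<union> {i. y i j \<noteq> 0}"]) (use x y in auto)
  show "finite {(i, j). i \<in> P \<and> j \<notin> P \<and> x i j + y i j \<noteq> 0}"
    by (rule finite_subset[of _ "{(i, j). i \<in> P \<and> j \<notin> P \<and> x i j \<noteq> 0}
        \<union> {(i, j). i \<in> P \<and> j \<notin> P \<and> y i j \<noteq> 0}"]) (use x y in auto)
qed

lemma admissible_scale: "admissible x \<Longrightarrow> admissible (\<lambda>i j. c * x i j)"
  unfolding admissible_def by (auto elim!: finite_subset[rotated] allE)

lemma U_commutator:
  assumes "admissible x" "admissible y"
  shows "U (\<lambda>i j. mat_mult x y i j - mat_mult y x i j) n m = U (mat_mult x y) n m - U (mat_mult y x) n m"
  using U_add[OF admissible_mat_mult[OF assms] admissible_scale[OF admissible_mat_mult[OF assms(2,1)], of "- 1"], of n m]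
    U_scale[OF admissible_mat_mult[OF assms(2,1)], of "- 1" n m] by simp

lemma cell_derivation_eqI:
  fixes d d' :: "'j cell_fun \<Rightarrow> 'j cell_fun"
  assumes "clinear d" "clinear d'"
    and "\<And>p q. d (p * q) = d p * q + p * d q" "\<And>p q. d' (p * q) = d' p * q + p * d' q"
    and gen: "\<And>j i. d (sym_word [Poly_Mapping.single (j, i) 1]) = d' (sym_word [Poly_Mapping.single (j, i) 1])"
  shows "d p = d' p"
proof (rule derivation_eqI[OF assms(1-4)])
  fix y :: "('j \<times> 'j) \<Rightarrow>\<^sub>0 complex"
  show "d (sym_word [y]) = d' (sym_word [y])"
  proof (induction y rule: poly_mapping_single_induct)
    case (single k c)
    have "Poly_Mapping.single k c = c *\<^sub>C Poly_Mapping.single (fst k, snd k) 1" by simp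
    then show ?case
      by (simp only: sym_word_1(2) clinear_scale[OF assms(1)] clinear_scale[OF assms(2)] gen)
  qed (simp add: sym_word_1(1) clinear_add[OF assms(1)] clinear_add[OF assms(2)])
qed

lemma D_eq_combination:
  assumes "\<And>j i. j \<notin> P \<Longrightarrow> i \<in> P \<Longrightarrow> U z j i = U x j i + c *\<^sub>C U y j i"
  shows "D z p = D x p + c *\<^sub>C D y p"
proof (rule cell_derivation_eqI[OF clinear_D])
  show "clinear (\<lambda>p. D x p + c *\<^sub>C D y p)"
    by (rule clinearI) (simp_all add: clinear_add[OF clinear_D] clinear_scale[OF clinear_D]
        scaleC_add_right mult.commute)
qed (auto simp: D_mult D_gen assms scaleC_add_right algebra_simps)

lemma D_add: "admissible x \<Longrightarrow> admissible y \<Longrightarrow> D (\<lambda>i j. x i j + y i j) p = D x p + D y p"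
  using D_eq_combination[of "\<lambda>i j. x i j + y i j" x 1 y p] by (simp add: U_add)

lemma D_zero: "D (\<lambda>i j. 0) p = 0"
proof -
  \<comment> \<open>Since U of the zero matrix vanishes, it is a combination of itself with itself,
    which doubles \<open>D\<close> as well.\<close>
  have "D (\<lambda>i j. 0) p = D (\<lambda>i j. 0) p + D (\<lambda>i j. 0) p"
    using D_eq_combination[of "\<lambda>i j. 0" "\<lambda>i j. 0" 1 "\<lambda>i j. 0" p] by (simp add: U_def case_prod_unfold)
  then show ?thesis by simp
qed

lemma D_scale: "admissible x \<Longrightarrow> D (\<lambda>i j. c * x i j) p = c *\<^sub>C D x p"
  using D_eq_combination[of "\<lambda>i j. c * x i j" "\<lambda>i j. 0" c x p]
  by (simp add: U_scale D_zero) (simp add: U_def case_prod_unfold)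

lemma D_commute:
  assumes x: "admissible x" and y: "admissible y"
  shows "D x (D y p) - D y (D x p) = - D (\<lambda>i j. mat_mult x y i j - mat_mult y x i j) p"
proof (rule cell_derivation_eqI[where d = "\<lambda>p. D x (D y p) - D y (D x p)"
      and d' = "\<lambda>p. - D (\<lambda>i j. mat_mult x y i j - mat_mult y x i j) p"])
  show "clinear (\<lambda>p. D x (D y p) - D y (D x p))"
    by (rule clinearI) (simp_all add: clinear_add[OF clinear_D] clinear_scale[OF clinear_D]
        cvec.scale_right_diff_distrib)
  show "clinear (\<lambda>p. - D (\<lambda>i j. mat_mult x y i j - mat_mult y x i j) p)"
    by (rule clinearI) (simp_all add: clinear_add[OF clinear_D] clinear_scale[OF clinear_D])
  fix j i
  show "D x (D y (sym_word [Poly_Mapping.single (j, i) 1])) - D y (D x (sym_word [Poly_Mapping.single (j, i) 1]))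
      = - D (\<lambda>i j. mat_mult x y i j - mat_mult y x i j) (sym_word [Poly_Mapping.single (j, i) 1])"
  proof (cases "j \<notin> P \<and> i \<in> P")
    case True
    then have "sym_word [Poly_Mapping.single (j, i) 1] = Z j i" by (simp add: Z_def)
    with True show ?thesis by (simp add: D_commute_Z[OF x y]) (simp add: D_Z U_commutator[OF x y])
  next
    case False
    then show ?thesis by (auto simp: D_gen clinear_0[OF clinear_D])
  qed
qed (simp_all add: D_mult clinear_add[OF clinear_D] algebra_simps)

text \<open>The infinitesimal multiplier of the determinant line bundle: the derivative of det(1 +
  x_++ + x_+- Z) with the possibly divergent trace of x_++ omitted. The omission is what produces
  the cocycle.\<close>

definition tr :: "('j \<Rightarrow> 'j \<Rightarrow> complex) \<Rightarrow> 'j cell_fun"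
  where "tr x = Sum_any (\<lambda>(i, j). x i j *\<^sub>C Z j i)"

definition block_trace :: "('j \<Rightarrow> 'j \<Rightarrow> complex) \<Rightarrow> ('j \<Rightarrow> 'j \<Rightarrow> complex) \<Rightarrow> complex"
  where "block_trace x y = Sum_any (\<lambda>(i, j). if i \<in> P \<and> j \<notin> P then x i j * y j i else 0)"

lemma finite_support_tr:
  assumes "admissible x"
  shows "finite {p. x (fst p) (snd p) *\<^sub>C Z (snd p) (fst p) \<noteq> 0}"
  by (rule finite_support_block[OF assms]) (use Z_nonzeroD in blast)

lemma tr_add: "admissible x \<Longrightarrow> admissible y \<Longrightarrow> tr (\<lambda>i j. x i j + y i j) = tr x + tr y"
  unfolding tr_def case_prod_unfold scaleC_add_left
  by (rule Sum_any.distrib; rule finite_support_tr)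

lemma tr_scale: "admissible x \<Longrightarrow> tr (\<lambda>i j. c * x i j) = c *\<^sub>C tr x"
  unfolding tr_def case_prod_unfold
  by (subst Sum_any_clinear[OF clinear_scaleC(1) finite_support_tr]) simp_all

lemma tr_commutator:
  assumes "admissible x" "admissible y"
  shows "tr (\<lambda>i j. mat_mult x y i j - mat_mult y x i j) = tr (mat_mult x y) - tr (mat_mult y x)"
  using tr_add[OF admissible_mat_mult[OF assms] admissible_scale[OF admissible_mat_mult[OF assms(2,1)], of "- 1"]]
    tr_scale[OF admissible_mat_mult[OF assms(2,1)], of "- 1"] by simp

text \<open>The parts of the trace for a product x y are separated by the middle index: here it lies
  outside \<open>P\<close> (trace of x_+- y_-- Z), in \<open>tr_right\<close> it lies in
  \<open>P\<close> (trace of x_++ y_+- Z).\<close>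

definition tr_left :: "('j \<Rightarrow> 'j \<Rightarrow> complex) \<Rightarrow> ('j \<Rightarrow> 'j \<Rightarrow> complex) \<Rightarrow> 'j cell_fun"
  where "tr_left x y = Sum_any (\<lambda>(i, k). if i \<in> P \<and> k \<notin> P then x i k *\<^sub>C Sum_any (\<lambda>j. y k j *\<^sub>C Z j i) else 0)"

definition tr_right :: "('j \<Rightarrow> 'j \<Rightarrow> complex) \<Rightarrow> ('j \<Rightarrow> 'j \<Rightarrow> complex) \<Rightarrow> 'j cell_fun"
  where "tr_right x y = Sum_any (\<lambda>(k, j). if k \<in> P \<and> j \<notin> P then y k j *\<^sub>C Sum_any (\<lambda>i. x i k *\<^sub>C Z j i) else 0)"

lemma tr_mat_mult:
  assumes x: "admissible x" and y: "admissible y"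
  shows "tr (mat_mult x y) = tr_left x y + tr_right x y"
proof -
  define g where "g p k = (x (fst p) k * y k (snd p)) *\<^sub>C Z (snd p) (fst p)" for p k
  define gL where "gL p k = (if k \<in> P then 0 else g p k)" for p k
  define gR where "gR p k = (if k \<in> P then g p k else 0)" for p k
  have fin: "finite {p. g (fst p) (snd p) \<noteq> 0}"
    unfolding g_def by (rule finite_support_triple[OF x y, of "\<lambda>i j. Z j i"]) (use Z_nonzeroD in blast)
  then have finL: "finite {p. gL (fst p) (snd p) \<noteq> 0}" and finR: "finite {p. gR (fst p) (snd p) \<noteq> 0}"
    by (auto simp: gL_def gR_def elim!: finite_subset[rotated])
  have "tr (mat_mult x y) = Sum_any (\<lambda>p. Sum_any (g p))"
    by (simp add: tr_def g_def[abs_def] case_prod_unfold mat_mult_scaleC[OF x])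
  also have "\<dots> = Sum_any (\<lambda>(p, k). g p k)" by (rule Sum_any_nested(1)[OF fin])
  also have "\<dots> = Sum_any (\<lambda>q. gL (fst q) (snd q) + gR (fst q) (snd q))"
    by (rule arg_cong[of _ _ Sum_any]) (auto simp: gL_def gR_def)
  also have "\<dots> = Sum_any (\<lambda>q. gL (fst q) (snd q)) + Sum_any (\<lambda>q. gR (fst q) (snd q))"
    by (rule Sum_any.distrib[OF finL finR])
  also have "Sum_any (\<lambda>q. gL (fst q) (snd q)) = tr_left x y"
  proof -
    define l where "l = (\<lambda>((i, k), j). ((i :: 'j, j :: 'j), k :: 'j))"
    have bij: "bij l" by (rule bij_betwI[where g = "\<lambda>((i, j), k). ((i, k), j)"]) (auto simp: l_def)
    define h where "h p j = gL (fst p, j) (snd p)" for p j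
    have l: "(\<lambda>q. gL (fst q) (snd q)) \<circ> l = (\<lambda>q. h (fst q) (snd q))"
      by (auto simp: l_def h_def)
    have "finite {q. h (fst q) (snd q) \<noteq> 0}"
    proof -
      have "{q. h (fst q) (snd q) \<noteq> 0} = l -` {q. gL (fst q) (snd q) \<noteq> 0}"
        using fun_cong[OF l] by auto
      with finite_vimageI[OF finL bij_is_inj[OF bij]] show ?thesis by simp
    qed
    from Sum_any_nested(1)[OF this] Sum_any.reindex_cong[OF bij l]
    have "Sum_any (\<lambda>q. gL (fst q) (snd q)) = Sum_any (\<lambda>p. Sum_any (h p))"
      by (simp add: case_prod_unfold)
    also have "(\<lambda>p. Sum_any (h p)) = (\<lambda>p. (if fst p \<in> P \<and> snd p \<notin> P
        then x (fst p) (snd p) *\<^sub>C Sum_any (\<lambda>j. y (snd p) j *\<^sub>C Z j (fst p)) else 0))"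
    proof
      fix p
      show "Sum_any (h p) = (if fst p \<in> P \<and> snd p \<notin> P
        then x (fst p) (snd p) *\<^sub>C Sum_any (\<lambda>j. y (snd p) j *\<^sub>C Z j (fst p)) else 0)"
      proof (cases "fst p \<in> P \<and> snd p \<notin> P")
        case True
        then show ?thesis
          by (subst Sum_any_clinear[OF clinear_scaleC(1) finite_support_scaleC[OF finite_row[OF y]]])
             (simp add: h_def[abs_def] gL_def g_def)
      next
        case False
        then have "h p j = 0" for j
          using Z_nonzeroD[of j "fst p"] by (auto simp: h_def gL_def g_def)
        then have "Sum_any (h p) = 0" by simp
        with False show ?thesis by auto
      qed
    qed
    finally show ?thesis by (simp add: tr_left_def case_prod_unfold)
  qed
  also have "Sum_any (\<lambda>q. gR (fst q) (snd q)) = tr_right x y"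
  proof -
    define l where "l = (\<lambda>((k, j), i). ((i :: 'j, j :: 'j), k :: 'j))"
    have bij: "bij l" by (rule bij_betwI[where g = "\<lambda>((i, j), k). ((k, j), i)"]) (auto simp: l_def)
    define h where "h p i = gR (i, snd p) (fst p)" for p i
    have l: "(\<lambda>q. gR (fst q) (snd q)) \<circ> l = (\<lambda>q. h (fst q) (snd q))"
      by (auto simp: l_def h_def)
    have "finite {q. h (fst q) (snd q) \<noteq> 0}"
    proof -
      have "{q. h (fst q) (snd q) \<noteq> 0} = l -` {q. gR (fst q) (snd q) \<noteq> 0}"
        using fun_cong[OF l] by auto
      with finite_vimageI[OF finR bij_is_inj[OF bij]] show ?thesis by simp
    qed
    from Sum_any_nested(1)[OF this] Sum_any.reindex_cong[OF bij l]
    have "Sum_any (\<lambda>q. gR (fst q) (snd q)) = Sum_any (\<lambda>p. Sum_any (h p))"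
      by (simp add: case_prod_unfold)
    also have "(\<lambda>p. Sum_any (h p)) = (\<lambda>p. (if fst p \<in> P \<and> snd p \<notin> P
        then y (fst p) (snd p) *\<^sub>C Sum_any (\<lambda>i. x i (fst p) *\<^sub>C Z (snd p) i) else 0))"
    proof
      fix p
      show "Sum_any (h p) = (if fst p \<in> P \<and> snd p \<notin> P
        then y (fst p) (snd p) *\<^sub>C Sum_any (\<lambda>i. x i (fst p) *\<^sub>C Z (snd p) i) else 0)"
      proof (cases "fst p \<in> P \<and> snd p \<notin> P")
        case True
        then show ?thesis
          by (subst Sum_any_clinear[OF clinear_scaleC(1) finite_support_scaleC[OF finite_col[OF x]]])
             (simp add: h_def[abs_def] gR_def g_def mult.commute)
      next
        case False
        then have "h p i = 0" for i
          using Z_nonzeroD[of "snd p" i] by (auto simp: h_def gR_def g_def)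
        then have "Sum_any (h p) = 0" by simp
        with False show ?thesis by auto
      qed
    qed
    finally show ?thesis by (simp add: tr_right_def case_prod_unfold)
  qed
  finally show ?thesis .
qed

text \<open>The field replaces Z by U(x), so this is the trace of y_+- U(x), term by term; the term
  with x_++ becomes \<open>tr_right x y\<close> because a trace is cyclic.\<close>

lemma D_tr:
  assumes x: "admissible x" and y: "admissible y"
  shows "D x (tr y) = block_trace y x *\<^sub>C 1 - tr_right x y + tr_left y x
    - Sum_any (\<lambda>(p, q). (y (fst p) (snd p) * x (fst q) (snd q)) *\<^sub>C (Z (snd p) (fst q) * Z (snd q) (fst p)))"
proof -
  define blk where "blk p \<longleftrightarrow> fst p \<in> P \<and> snd p \<notin> P" for p :: "'j \<times> 'j"
  define F where "F p q = (y (fst p) (snd p) * x (fst q) (snd q)) *\<^sub>C (Z (snd p) (fst q) * Z (snd q) (fst p))"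
    for p q
  have blk_fin: "finite {p. blk p \<and> y (fst p) (snd p) \<noteq> 0}"
    using finite_block[OF y] by (simp add: blk_def case_prod_unfold conj_assoc)
  have finF: "finite {pq. F (fst pq) (snd pq) \<noteq> 0}"
  proof (rule finite_supportI)
    let ?A = "\<lambda>x. {(i, j). i \<in> P \<and> j \<notin> P \<and> x i j \<noteq> (0::complex)}"
    show "finite (?A y \<times> ?A x)" by (intro finite_cartesian_product finite_block x y)
    fix pq assume "F (fst pq) (snd pq) \<noteq> 0"
    then have "y (fst (fst pq)) (snd (fst pq)) \<noteq> 0" "x (fst (snd pq)) (snd (snd pq)) \<noteq> 0"
      "Z (snd (fst pq)) (fst (snd pq)) \<noteq> 0" "Z (snd (snd pq)) (fst (fst pq)) \<noteq> 0"
      by (auto simp: F_def)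
    with Z_nonzeroD show "pq \<in> ?A y \<times> ?A x" by (auto simp: mem_Times_iff case_prod_unfold)
  qed
  have F_blk: "F p q = 0" if "\<not> blk p" for p q
    using that Z_nonzeroD[of "snd p" "fst q"] Z_nonzeroD[of "snd q" "fst p"]
    by (cases "Z (snd p) (fst q) = 0 \<or> Z (snd q) (fst p) = 0") (auto simp: F_def blk_def)
  define a where "a p = (if blk p then (y (fst p) (snd p) * x (snd p) (fst p)) *\<^sub>C (1 :: 'j cell_fun) else 0)" for p
  define b where "b p = (if blk p then y (fst p) (snd p) *\<^sub>C Sum_any (\<lambda>h. x h (fst p) *\<^sub>C Z (snd p) h) else 0)" for p
  define c where "c p = (if blk p then y (fst p) (snd p) *\<^sub>C Sum_any (\<lambda>l. x (snd p) l *\<^sub>C Z l (fst p)) else 0)" for p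
  have "finite {p. a p \<noteq> 0}" "finite {p. b p \<noteq> 0}" "finite {p. c p \<noteq> 0}"
    by (rule finite_supportI[OF blk_fin], simp add: a_def b_def c_def split: if_splits)+
  note fins = this finite_support_Sum_any(1)[OF finF]
  have plus: "finite {k. f k + g k \<noteq> 0}" and minus: "finite {k. f k - g k \<noteq> 0}"
    if "finite {k. f k \<noteq> 0}" "finite {k. g k \<noteq> 0}" for f g :: "'j \<times> 'j \<Rightarrow> 'j cell_fun"
    by (rule finite_subset[OF _ finite_UnI[OF that]], auto)+
  have "D x (tr y) = Sum_any (\<lambda>p. y (fst p) (snd p) *\<^sub>C D x (Z (snd p) (fst p)))"
    unfolding tr_def case_prod_unfold
    by (subst Sum_any_clinear[OF clinear_D finite_support_tr[OF y]]) (simp add: clinear_scale[OF clinear_D])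
  also have "(\<lambda>p. y (fst p) (snd p) *\<^sub>C D x (Z (snd p) (fst p))) = (\<lambda>p. a p - b p + c p - Sum_any (F p))"
  proof
    fix p
    show "y (fst p) (snd p) *\<^sub>C D x (Z (snd p) (fst p)) = a p - b p + c p - Sum_any (F p)"
    proof (cases "blk p")
      case True
      have "finite {q. x (fst q) (snd q) *\<^sub>C (Z (snd p) (fst q) * Z (snd q) (fst p)) \<noteq> 0}"
        by (rule finite_support_block[OF x]) (rule Z_Z_nonzeroD)
      from Sum_any_clinear[OF clinear_scaleC(1) this, of "y (fst p) (snd p)"]
      have "Sum_any (F p) = y (fst p) (snd p) *\<^sub>C Sum_any (\<lambda>(i, j). x i j *\<^sub>C (Z (snd p) i * Z j (fst p)))"
        by (simp add: F_def[abs_def] case_prod_unfold)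
      with True show ?thesis
        by (simp add: D_Z a_def b_def c_def blk_def U_def scaleC_add_right cvec.scale_right_diff_distrib)
    next
      case False
      with F_blk have "F p q = 0" for q by blast
      with False show ?thesis by (auto simp: a_def b_def c_def D_Z blk_def)
    qed
  qed
  also have "Sum_any \<dots> = Sum_any a - Sum_any b + Sum_any c - Sum_any (\<lambda>p. Sum_any (F p))"
    by (simp only: Sum_any_diff Sum_any.distrib plus minus fins)
  also have "Sum_any a = block_trace y x *\<^sub>C 1"
  proof -
    have "finite {p. (if blk p then y (fst p) (snd p) * x (snd p) (fst p) else 0) \<noteq> 0}"
      by (rule finite_supportI[OF blk_fin]) (auto split: if_splits)
    from Sum_any_scaleC_left[OF this, of "1 :: 'j cell_fun"] show ?thesis
      by (simp add: block_trace_def blk_def case_prod_unfold a_def[abs_def] if_distrib[of "\<lambda>c. c *\<^sub>C _"] cong: if_cong)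
  qed
  also have "Sum_any b = tr_right x y"
    by (simp add: tr_right_def b_def[abs_def] blk_def case_prod_unfold)
  also have "Sum_any c = tr_left y x"
    by (simp add: tr_left_def c_def[abs_def] blk_def case_prod_unfold)
  also have "Sum_any (\<lambda>p. Sum_any (F p)) = Sum_any (\<lambda>(p, q). F p q)" by (rule Sum_any_nested(1)[OF finF])
  finally show ?thesis by (simp add: F_def)
qed

text \<open>The traces of y Z x Z are symmetric in x and y and cancel, the terms linear in Z combine
  to the trace of the commutator, and the constants remain as the cocycle of the central
  extension.\<close>

lemma tr_commute:
  assumes x: "admissible x" and y: "admissible y"
  shows "D x (tr y) - D y (tr x) = (block_trace y x - block_trace x y) *\<^sub>C 1
    - tr (\<lambda>i j. mat_mult x y i j - mat_mult y x i j)"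
proof -
  let ?F = "\<lambda>y x (p, q). (y (fst p) (snd p) * x (fst q) (snd q)) *\<^sub>C (Z (snd p) (fst q) * Z (snd q) (fst p))"
  have bij: "bij (\<lambda>(p, q). (q :: 'j \<times> 'j, p :: 'j \<times> 'j))"
    by (rule bij_betwI[where g = "\<lambda>(p, q). (q, p)"]) auto
  have "Sum_any (?F y x) = Sum_any (?F x y)"
    by (rule Sum_any.reindex_cong[OF bij]) (auto simp: fun_eq_iff mult.commute)
  then show ?thesis
    unfolding D_tr[OF x y] D_tr[OF y x] tr_commutator[OF x y] tr_mat_mult[OF x y] tr_mat_mult[OF y x]
    by (simp add: cvec.scale_left_diff_distrib)
qed

end

section \<open>The augmentation filtration\<close>

text \<open>The value at Z = 0, that is, at the point H_+ of the Grassmannian.\<close>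

definition ev :: "'a::complex_vector sym_alg \<Rightarrow> complex"
  where "ev = sym_lift counit_word"

text \<open>Functions vanishing at the origin to order n, that is, the n-th power of the
  augmentation ideal.\<close>

definition aug :: "nat \<Rightarrow> 'a::complex_vector sym_alg set"
  where "aug n = cvec.span {sym_word w | w. n \<le> length w}"

lemma sym_word_linear_counit: "sym_word_linear counit_word"
  using counit_linear by (simp add: sym_word_linear_def counit_word_def)

lemma ev_word: "ev (sym_word w) = (if w = [] then 1 else 0)"
  unfolding ev_def by (simp add: sym_lift_word[OF sym_word_linear_counit] counit_word_def)

lemma clinear_ev: "clinear ev"
  unfolding ev_def by (rule clinear_sym_lift[OF sym_word_linear_counit])

lemma ev_1 [simp]: "ev 1 = 1"
  using ev_word[of "[]"] by (simp add: sym_word_Nil)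

lemma ev_mult: "ev (p * q) = ev p * ev q"
proof (induction p rule: sym_alg_induct)
  case (word c u)
  have "ev (sym_word u * q) = ev (sym_word u) * ev q"
  proof (induction q rule: sym_alg_induct)
    case (word d v)
    show ?case
      by (simp add: clinear_scale[OF clinear_ev] ev_word flip: sym_word_append)
  qed (simp add: clinear_add[OF clinear_ev] algebra_simps)
  then show ?case by (simp add: clinear_scale[OF clinear_ev])
qed (simp add: clinear_add[OF clinear_ev] algebra_simps)

lemma aug_word: "n \<le> length w \<Longrightarrow> sym_word w \<in> aug n"
  unfolding aug_def by (rule cvec.span_base) blast

lemma aug_add: "p \<in> aug n \<Longrightarrow> q \<in> aug n \<Longrightarrow> p + q \<in> aug n"
  and aug_scale: "p \<in> aug n \<Longrightarrow> c *\<^sub>C p \<in> aug n"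
  and aug_zero: "0 \<in> aug n"
  unfolding aug_def by (rule cvec.span_add cvec.span_scale cvec.span_zero; assumption?)+

lemma aug_induct [consumes 1, case_names word add scale zero]:
  assumes "p \<in> aug n" "\<And>w. n \<le> length w \<Longrightarrow> Q (sym_word w)" "\<And>p q. Q p \<Longrightarrow> Q q \<Longrightarrow> Q (p + q)"
    "\<And>c p. Q p \<Longrightarrow> Q (c *\<^sub>C p)" "Q 0"
  shows "Q p"
proof -
  have "cvec.subspace {p. Q p}" using assms(3-5) by (simp add: cvec.subspace_def)
  with assms(1) show ?thesis
    unfolding aug_def by (rule cvec.span_induct) (use assms(2) in auto)
qed

lemma aug_mono: "m \<le> n \<Longrightarrow> p \<in> aug n \<Longrightarrow> p \<in> aug m"
  unfolding aug_def by (erule cvec.span_mono[THEN subsetD, rotated]) auto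

lemma aug_mult: "p \<in> aug m \<Longrightarrow> q \<in> aug n \<Longrightarrow> p * q \<in> aug (m + n)"
proof (induction p rule: aug_induct)
  case (word u)
  from word(2) show ?case
    by (induction q rule: aug_induct)
       (use word(1) in \<open>simp_all add: aug_word aug_add aug_scale aug_zero distrib_left flip: sym_word_append\<close>)
qed (simp_all add: distrib_right aug_add aug_scale aug_zero)

lemma aug_0: "p \<in> aug 0"
  by (induction p rule: sym_alg_induct) (simp_all add: aug_word aug_add aug_scale)

lemma aug_times: "p \<in> aug n \<Longrightarrow> q * p \<in> aug n" "p \<in> aug n \<Longrightarrow> p * q \<in> aug n"
  using aug_mult[OF aug_0[of q], of p n] aug_mult[OF _ aug_0[of q], of p n] by simp_all

lemma ev_aug: "p \<in> aug (Suc 0) \<Longrightarrow> ev p = 0"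
  by (induction rule: aug_induct)
     (auto simp: ev_word clinear_add[OF clinear_ev] clinear_scale[OF clinear_ev] clinear_0[OF clinear_ev])

lemma minus_ev_aug: "p - ev p *\<^sub>C 1 \<in> aug (Suc 0)"
proof (induction p rule: sym_alg_induct)
  case (word c w)
  show ?case
    by (cases w)
       (auto simp: clinear_scale[OF clinear_ev] ev_word sym_word_Nil aug_zero intro!: aug_scale aug_word)
next
  case (add p q)
  from aug_add[OF this] show ?case by (simp add: clinear_add[OF clinear_ev] scaleC_add_left algebra_simps)
qed

lemma ev_eq_0_iff_aug: "ev p = 0 \<longleftrightarrow> p \<in> aug (Suc 0)"
  using ev_aug minus_ev_aug[of p] by auto

lemma sym_der_aug:
  assumes \<xi>: "clinear \<xi>" and "p \<in> aug n"
  shows "sym_der \<xi> p \<in> aug (n - 1)"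
  using assms(2)
proof (induction rule: aug_induct)
  case (word w)
  have "der_word \<xi> w \<in> aug (length w - 1)"
  proof (induction w)
    case (Cons y w)
    have "sym_word [y] * der_word \<xi> w \<in> aug (length w)"
    proof (cases w)
      case (Cons a v)
      with aug_mult[OF aug_word[of 1 "[y]"] Cons.IH] show ?thesis by simp
    qed (simp add: aug_zero)
    moreover have "\<xi> y * sym_word w \<in> aug (length w)" by (simp add: aug_times(1) aug_word)
    ultimately show ?case by (simp add: aug_add)
  qed (simp add: aug_zero)
  then have "der_word \<xi> w \<in> aug (n - 1)"
    by (rule aug_mono[rotated]) (use word in simp)
  then show ?case by (simp add: sym_der_word[OF \<xi>])
qed (simp_all add: clinear_add[OF clinear_sym_der[OF \<xi>]] clinear_scale[OF clinear_sym_der[OF \<xi>]]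
    clinear_0[OF clinear_sym_der[OF \<xi>]] aug_add aug_scale aug_zero)

text \<open>A vector field that vanishes at the origin does not lower the order of vanishing. The
  maximum with 1 accounts for n = 0: derivations kill constants, so the result still vanishes at the
  origin.\<close>

lemma sym_der_cong_aug:
  assumes \<xi>: "clinear \<xi>" and \<eta>: "clinear \<eta>" and diff: "\<And>y. \<xi> y - \<eta> y \<in> aug (Suc 0)" and "p \<in> aug n"
  shows "sym_der \<xi> p - sym_der \<eta> p \<in> aug (max 1 n)"
  using assms(4)
proof (induction rule: aug_induct)
  case (word w)
  have "der_word \<xi> w - der_word \<eta> w \<in> aug (max 1 (length w))"
  proof (induction w)
    case (Cons y w)
    have "(\<xi> y - \<eta> y) * sym_word w \<in> aug (Suc (length w))"
      using aug_mult[OF diff[of y] aug_word[of "length w" w]] by simp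
    moreover have "sym_word [y] * (der_word \<xi> w - der_word \<eta> w) \<in> aug (1 + max 1 (length w))"
      by (rule aug_mult[OF aug_word Cons.IH]) simp
    then have "sym_word [y] * (der_word \<xi> w - der_word \<eta> w) \<in> aug (Suc (length w))"
      by (rule aug_mono[rotated]) simp
    ultimately have "(\<xi> y - \<eta> y) * sym_word w + sym_word [y] * (der_word \<xi> w - der_word \<eta> w) \<in> aug (Suc (length w))"
      by (rule aug_add)
    then show ?case by (simp add: algebra_simps)
  qed (simp add: aug_zero)
  then have "der_word \<xi> w - der_word \<eta> w \<in> aug (max 1 n)"
    by (rule aug_mono[rotated]) (use word in simp)
  then show ?case by (simp add: sym_der_word[OF \<xi>] sym_der_word[OF \<eta>])
next
  case (add p q)
  from aug_add[OF this] show ?case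
    by (simp add: clinear_add[OF clinear_sym_der[OF \<xi>]] clinear_add[OF clinear_sym_der[OF \<eta>]] algebra_simps)
next
  case (scale c p)
  from aug_scale[OF this, of c] show ?case
    by (simp add: clinear_scale[OF clinear_sym_der[OF \<xi>]] clinear_scale[OF clinear_sym_der[OF \<eta>]]
        cvec.scale_right_diff_distrib)
qed (simp add: clinear_0[OF clinear_sym_der[OF \<xi>]] clinear_0[OF clinear_sym_der[OF \<eta>]] aug_zero)

section \<open>The Riccati fields at the origin\<close>

context polarization
begin

text \<open>The Riccati field frozen at Z = 0, where only the block x_-+ survives: a translation of
  the cell.\<close>

definition cder :: "('j \<Rightarrow> 'j \<Rightarrow> complex) \<Rightarrow> 'j cell_fun \<Rightarrow> 'j cell_fun"
  where "cder x = sym_der (lin_ext (\<lambda>(j, i). if j \<notin> P \<and> i \<in> P then x j i *\<^sub>C 1 else 0))"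

lemma clinear_cder: "clinear (cder x)"
  unfolding cder_def by (rule clinear_sym_der[OF clinear_lin_ext])

lemma cder_mult: "cder x (p * q) = cder x p * q + p * cder x q"
  unfolding cder_def by (rule sym_der_mult[OF clinear_lin_ext])

lemma cder_1: "cder x 1 = 0"
  unfolding cder_def by (rule sym_der_1[OF clinear_lin_ext])

lemma cder_Z: "cder x (Z j i) = (if j \<notin> P \<and> i \<in> P then x j i *\<^sub>C 1 else 0)"
  unfolding cder_def Z_def by (simp add: sym_der_gen[OF clinear_lin_ext] clinear_0[OF clinear_sym_der[OF clinear_lin_ext]])

lemma cder_aug: "p \<in> aug n \<Longrightarrow> cder x p \<in> aug (n - 1)"
  unfolding cder_def by (rule sym_der_aug[OF clinear_lin_ext])

lemma ev_Z: "ev (Z j i) = 0"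
  by (simp add: Z_def ev_word clinear_0[OF clinear_ev])

lemma ev_tr: "admissible x \<Longrightarrow> ev (tr x) = 0"
  unfolding tr_def case_prod_unfold
  by (subst Sum_any_clinear[OF clinear_ev finite_support_tr]) (simp_all add: clinear_scale[OF clinear_ev] ev_Z)

lemma ev_U:
  assumes x: "admissible x"
  shows "ev (U x j i) = x j i"
proof -
  have fin: "finite {p. x (fst p) (snd p) *\<^sub>C (Z j (fst p) * Z (snd p) i) \<noteq> 0}"
    by (rule finite_support_block[OF x]) (rule Z_Z_nonzeroD)
  show ?thesis
    unfolding U_def case_prod_unfold
    by (simp add: clinear_add[OF clinear_ev] clinear_diff[OF clinear_ev] clinear_scale[OF clinear_ev]
        Sum_any_clinear[OF clinear_ev fin] Sum_any_clinear[OF clinear_ev finite_support_scaleC[OF finite_row[OF x]]]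
        Sum_any_clinear[OF clinear_ev finite_support_scaleC[OF finite_col[OF x]]] ev_Z ev_mult)
qed

lemma D_minus_cder_aug:
  assumes x: "admissible x" and p: "p \<in> aug n"
  shows "D x p - cder x p \<in> aug (max 1 n)"
  unfolding D_def cder_def
proof (rule sym_der_cong_aug[OF clinear_lin_ext clinear_lin_ext _ p])
  fix y :: "('j \<times> 'j) \<Rightarrow>\<^sub>0 complex"
  have "ev (lin_ext (\<lambda>(j, i). if j \<notin> P \<and> i \<in> P then U x j i else 0) y
      - lin_ext (\<lambda>(j, i). if j \<notin> P \<and> i \<in> P then x j i *\<^sub>C 1 else 0) y) = 0"
    by (simp add: lin_ext_def clinear_diff[OF clinear_ev] clinear_sum[OF clinear_ev] clinear_scale[OF clinear_ev]
        case_prod_unfold if_distrib[of ev] ev_U[OF x] clinear_0[OF clinear_ev] cong: if_cong)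
  then show "lin_ext (\<lambda>(j, i). if j \<notin> P \<and> i \<in> P then U x j i else 0) y
      - lin_ext (\<lambda>(j, i). if j \<notin> P \<and> i \<in> P then x j i *\<^sub>C 1 else 0) y \<in> aug (Suc 0)"
    by (simp only: ev_eq_0_iff_aug)
qed

text \<open>Such an x preserves H_+, so its vector field vanishes at the origin.\<close>

lemma ev_D_eq_0:
  assumes x: "admissible x" and "\<And>j i. j \<notin> P \<Longrightarrow> i \<in> P \<Longrightarrow> x j i = 0"
  shows "ev (D x p) = 0"
proof -
  have "lin_ext (\<lambda>(j, i). if j \<notin> P \<and> i \<in> P then x j i *\<^sub>C 1 else 0) = (\<lambda>_. 0 :: 'j cell_fun)"
    using assms(2) by (auto simp: lin_ext_def intro!: sum.neutral ext)
  moreover have "sym_der (\<lambda>_. 0) p = (0 :: 'j cell_fun)"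
  proof -
    have 0: "clinear (\<lambda>_. 0 :: 'j cell_fun)" by (rule clinearI) simp_all
    have "der_word (\<lambda>_. 0) w = (0 :: 'j cell_fun)" for w by (induction w) simp_all
    then show ?thesis
      by (induction p rule: sym_alg_induct)
         (simp_all add: clinear_add[OF clinear_sym_der[OF 0]] clinear_scale[OF clinear_sym_der[OF 0]] sym_der_word[OF 0])
  qed
  ultimately have "cder x p = 0" by (simp add: cder_def)
  with D_minus_cder_aug[OF x aug_0[of p]] show ?thesis by (simp add: ev_aug)
qed

end

section \<open>A representation of the affine Lie algebra on the big cell\<close>

text \<open>The index \<open>(n, b)\<close> stands for the vector \<open>b t\<^sup>n\<close> of \<open>g((t))\<close>.\<close>

definition loop_mat :: "(int \<Rightarrow>\<^sub>0 'g::fd_lie_algebra) \<Rightarrow> (int \<times> 'g) \<Rightarrow> (int \<times> 'g) \<Rightarrow> complex"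
  where "loop_mat p i j = (if snd i \<in> chosen_basis \<and> snd j \<in> chosen_basis
    then cvec.representation chosen_basis (bracket (Poly_Mapping.lookup p (fst i - fst j)) (snd j)) (snd i) else 0)"

interpretation loop: polarization "{j :: int \<times> 'g::fd_lie_algebra. 0 \<le> fst j}" .

lemma representation_linear:
  fixes x y :: "'g::fd_lie_algebra"
  shows "cvec.representation chosen_basis (x + y) b = cvec.representation chosen_basis x b + cvec.representation chosen_basis y b"
    and "cvec.representation chosen_basis (c *\<^sub>C x) b = c * cvec.representation chosen_basis x b"
    and "cvec.representation chosen_basis (0::'g) b = 0"
  by (simp_all add: cvec.representation_add cvec.representation_scale cvec.representation_zero chosen_basis)

lemma clinear_representation:
  "clinear (\<lambda>x :: 'g::fd_lie_algebra. cvec.representation chosen_basis x b)"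
  by (rule clinearI) (simp_all add: representation_linear)

lemma basis_expansion: "(\<Sum>b\<in>chosen_basis. cvec.representation chosen_basis x b *\<^sub>C b) = (x :: 'g::fd_lie_algebra)"
  using cvec.sum_representation_eq[of chosen_basis x chosen_basis] chosen_basis by auto

lemma loop_mat_add: "loop_mat (p + q) = (\<lambda>i j. loop_mat p i j + loop_mat q i j)"
  by (simp add: loop_mat_def fun_eq_iff Poly_Mapping.lookup_add bracket_add_left representation_linear)

lemma loop_mat_scaleC: "loop_mat (c *\<^sub>C p) = (\<lambda>i j. c * loop_mat p i j)"
  by (simp add: loop_mat_def fun_eq_iff bracket_scaleC_left representation_linear)

lemma loop_mat_nonzeroD:
  assumes "loop_mat p i j \<noteq> 0"
  shows "fst i - fst j \<in> Poly_Mapping.keys p" "snd i \<in> chosen_basis" "snd j \<in> chosen_basis"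
proof -
  show "snd i \<in> chosen_basis" "snd j \<in> chosen_basis"
    using assms by (auto simp: loop_mat_def split: if_splits)
  show "fst i - fst j \<in> Poly_Mapping.keys p"
  proof (rule ccontr)
    assume "fst i - fst j \<notin> Poly_Mapping.keys p"
    then have "Poly_Mapping.lookup p (fst i - fst j) = 0" by (simp add: Poly_Mapping.in_keys_iff)
    with assms show False by (simp add: loop_mat_def representation_linear split: if_splits)
  qed
qed

lemma admissible_loop_mat: "loop.admissible (loop_mat p)"
proof -
  note fin = chosen_basis(3)[where ?'a = 'a]
  have row: "finite {j. loop_mat p i j \<noteq> 0}" for i
  proof (rule finite_subset)
    show "{j. loop_mat p i j \<noteq> 0} \<subseteq> (\<lambda>(k, b). (fst i - k, b)) ` (Poly_Mapping.keys p \<times> chosen_basis)"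
    proof
      fix j assume "j \<in> {j. loop_mat p i j \<noteq> 0}"
      then show "j \<in> (\<lambda>(k, b). (fst i - k, b)) ` (Poly_Mapping.keys p \<times> chosen_basis)"
        using loop_mat_nonzeroD[of p i j] by (intro image_eqI[of _ _ "(fst i - fst j, snd j)"]) auto
    qed
  qed (use fin in simp)
  have col: "finite {i. loop_mat p i j \<noteq> 0}" for j
  proof (rule finite_subset)
    show "{i. loop_mat p i j \<noteq> 0} \<subseteq> (\<lambda>(k, b). (fst j + k, b)) ` (Poly_Mapping.keys p \<times> chosen_basis)"
    proof
      fix i assume "i \<in> {i. loop_mat p i j \<noteq> 0}"
      then show "i \<in> (\<lambda>(k, b). (fst j + k, b)) ` (Poly_Mapping.keys p \<times> chosen_basis)"
        using loop_mat_nonzeroD[of p i j] by (intro image_eqI[of _ _ "(fst i - fst j, snd i)"]) auto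
    qed
  qed (use fin in simp)
  have blk: "finite {(i, j). i \<in> {j. 0 \<le> fst j} \<and> j \<notin> {j. 0 \<le> fst j} \<and> loop_mat p i j \<noteq> 0}"
  proof (rule finite_subset)
    \<comment> \<open>k is the shift in degree and n the degree reached. Starting below 0 and
      arriving at n forces n < k, so for each of the finitely many k only finitely many n
      occur.\<close>
    let ?S = "(SIGMA k:Poly_Mapping.keys p. {0..k}) \<times> (chosen_basis :: 'a set) \<times> (chosen_basis :: 'a set)"
    show "{(i, j). i \<in> {j. 0 \<le> fst j} \<and> j \<notin> {j. 0 \<le> fst j} \<and> loop_mat p i j \<noteq> 0}
        \<subseteq> (\<lambda>((k, n), c, b). ((n, c), (n - k, b))) ` ?S"
    proof
      fix q assume "q \<in> {(i, j). i \<in> {j. 0 \<le> fst j} \<and> j \<notin> {j. 0 \<le> fst j} \<and> loop_mat p i j \<noteq> 0}"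
      then obtain n c m b where q: "q = ((n, c), (m, b))" and *: "0 \<le> n" "m < 0" "loop_mat p (n, c) (m, b) \<noteq> 0"
        by (cases q) auto
      then have "((n - m, n), c, b) \<in> ?S" using loop_mat_nonzeroD[OF *(3)] by auto
      then show "q \<in> (\<lambda>((k, n), c, b). ((n, c), (n - k, b))) ` ?S"
        by (rule rev_image_eqI) (simp add: q)
    qed
    show "finite ((\<lambda>((k, n), c, b). ((n, c), (n - k, b))) ` ?S)"
      using fin by (intro finite_imageI finite_cartesian_product finite_SigmaI) auto
  qed
  from row col blk show ?thesis unfolding loop.admissible_def by blast
qed

lemma mat_mult_loop_mat_single:
  "mat_mult (loop_mat (Poly_Mapping.single k x)) (loop_mat (Poly_Mapping.single l y)) i j
    = (if snd i \<in> chosen_basis \<and> snd j \<in> chosen_basis \<and> fst i - fst j = k + l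
       then cvec.representation chosen_basis (bracket x (bracket y (snd j))) (snd i) else 0)"
proof -
  let ?X = "loop_mat (Poly_Mapping.single k x)" and ?Y = "loop_mat (Poly_Mapping.single l y)"
  let ?B = "chosen_basis :: 'a set" and ?R = "cvec.representation (chosen_basis :: 'a set)"
  have "mat_mult ?X ?Y i j = (\<Sum>q\<in>Pair (fst i - k) ` ?B. ?X i q * ?Y q j)"
    unfolding mat_mult_def
  proof (rule Sum_any.expand_superset)
    show "{q. ?X i q * ?Y q j \<noteq> 0} \<subseteq> Pair (fst i - k) ` ?B"
    proof
      fix q assume "q \<in> {q. ?X i q * ?Y q j \<noteq> 0}"
      then have "?X i q \<noteq> 0" by auto
      from loop_mat_nonzeroD[OF this] show "q \<in> Pair (fst i - k) ` ?B"
        by (intro image_eqI[of _ _ "snd q"]) (auto simp: prod_eq_iff split: if_splits)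
    qed
  qed (simp add: chosen_basis)
  also have "\<dots> = (\<Sum>d\<in>?B. ?X i (fst i - k, d) * ?Y (fst i - k, d) j)"
    by (subst sum.reindex) (auto simp: inj_on_def)
  also have "\<dots> = (if snd i \<in> ?B \<and> snd j \<in> ?B \<and> fst i - fst j = k + l
      then (\<Sum>d\<in>?B. ?R (bracket y (snd j)) d * ?R (bracket x d) (snd i)) else 0)"
    by (auto simp: loop_mat_def Poly_Mapping.lookup_single when_def representation_linear mult.commute
        intro!: sum.cong sum.neutral)
  also have "(\<Sum>d\<in>?B. ?R (bracket y (snd j)) d * ?R (bracket x d) (snd i))
      = ?R (bracket x (\<Sum>d\<in>?B. ?R (bracket y (snd j)) d *\<^sub>C d)) (snd i)"
    by (simp add: clinear_sum[OF clinear_bracket] bracket_scaleC_right representation_linear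
        clinear_sum[OF clinear_representation])
  finally show ?thesis by (simp add: basis_expansion)
qed

lemma loop_mat_bracket_single:
  "loop_mat (bracket (Poly_Mapping.single k x) (Poly_Mapping.single l y))
    = (\<lambda>i j. mat_mult (loop_mat (Poly_Mapping.single k x)) (loop_mat (Poly_Mapping.single l y)) i j
        - mat_mult (loop_mat (Poly_Mapping.single l y)) (loop_mat (Poly_Mapping.single k x)) i j)"
  by (intro ext) (auto simp: mat_mult_loop_mat_single bracket_single loop_mat_def Poly_Mapping.lookup_single
      when_def representation_linear bracket_bracket cvec.representation_diff chosen_basis add.commute)

text \<open>For l > 0 exactly the l degrees from -l to -1 are pushed across 0 by t^l, and each
  contributes the trace of ad(y) ad(x).\<close>

lemma block_trace_loop_mat_single:
  "loop.block_trace (loop_mat (Poly_Mapping.single l y)) (loop_mat (Poly_Mapping.single k x))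
    = (if k + l = 0 \<and> 0 < l then of_int l * killing y x else 0)"
proof -
  let ?X = "loop_mat (Poly_Mapping.single k x)" and ?Y = "loop_mat (Poly_Mapping.single l y)"
  let ?B = "chosen_basis :: 'a set" and ?R = "cvec.representation (chosen_basis :: 'a set)"
  let ?f = "\<lambda>(n :: int, c :: 'a, b :: 'a). ((n, c), (n - l, b))"
  let ?S = "{0..<l} \<times> ?B \<times> ?B"
  have "loop.block_trace ?Y ?X = (\<Sum>(i, j)\<in>?f ` ?S. if i \<in> {j. 0 \<le> fst j} \<and> j \<notin> {j. 0 \<le> fst j} then ?Y i j * ?X j i else 0)"
    unfolding loop.block_trace_def
  proof (rule Sum_any.expand_superset)
    show "finite (?f ` ?S)" by (simp add: chosen_basis)
    show "{p. (case p of (i, j) \<Rightarrow> if i \<in> {j. 0 \<le> fst j} \<and> j \<notin> {j. 0 \<le> fst j} then ?Y i j * ?X j i else 0) \<noteq> 0} \<subseteq> ?f ` ?S"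
    proof clarify
      fix n c m b
      assume "(if (n, c) \<in> {j. 0 \<le> fst j} \<and> (m, b) \<notin> {j. 0 \<le> fst j} then ?Y (n, c) (m, b) * ?X (m, b) (n, c) else 0) \<noteq> 0"
      then have *: "0 \<le> n" "m < 0" "?Y (n, c) (m, b) \<noteq> 0" by (auto split: if_splits)
      with loop_mat_nonzeroD[OF *(3)] show "((n, c), (m, b)) \<in> ?f ` ?S"
        by (intro image_eqI[of _ _ "(n, c, b)"]) (auto split: if_splits)
    qed
  qed
  also have "\<dots> = (\<Sum>(n, c, b)\<in>?S. if k + l = 0 then ?R (bracket y b) c * ?R (bracket x c) b else 0)"
    by (subst sum.reindex)
       (auto simp: inj_on_def loop_mat_def Poly_Mapping.lookup_single when_def representation_linear intro!: sum.cong)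
  also have "\<dots> = (if k + l = 0 then (\<Sum>n\<in>{0..<l}. \<Sum>c\<in>?B. \<Sum>b\<in>?B. ?R (bracket y b) c * ?R (bracket x c) b) else 0)"
    by (simp only: sum.cartesian_product) (auto intro!: sum.cong)
  also have "(\<Sum>c\<in>?B. \<Sum>b\<in>?B. ?R (bracket y b) c * ?R (bracket x c) b) = killing y x"
  proof -
    have "(\<Sum>b\<in>?B. ?R (bracket y b) c * ?R (bracket x c) b) = ?R (bracket y (bracket x c)) c" for c
    proof -
      have "?R (bracket y (\<Sum>b\<in>?B. ?R (bracket x c) b *\<^sub>C b)) c = (\<Sum>b\<in>?B. ?R (bracket y b) c * ?R (bracket x c) b)"
        by (simp add: clinear_sum[OF clinear_bracket] bracket_scaleC_right representation_linear
            clinear_sum[OF clinear_representation] mult.commute)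
      then show ?thesis by (simp add: basis_expansion)
    qed
    then show ?thesis by (simp add: killing_def ctrace_def)
  qed
  finally show ?thesis by auto
qed


text \<open>A constant in front of the trace function scales the cocycle of
  \<open>tr_commute\<close>, so this constant is the level; accordingly \<open>affine_op\<close>
  lets the central element act by the same number.\<close>

definition loop_op :: "(int \<Rightarrow>\<^sub>0 'g::fd_lie_algebra) \<Rightarrow> (int \<times> 'g) cell_fun \<Rightarrow> (int \<times> 'g) cell_fun"
  where "loop_op p h = loop.D (loop_mat p) h + critical_level *\<^sub>C (loop.tr (loop_mat p) * h)"

definition affine_op :: "'g::fd_lie_algebra affine \<Rightarrow> (int \<times> 'g) cell_fun \<Rightarrow> (int \<times> 'g) cell_fun"
  where "affine_op a h = loop_op (loop_part a) h + (critical_level * central_part a) *\<^sub>C h"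

lemma loop_op_linear:
  "loop_op (p + q) h = loop_op p h + loop_op q h"
  "loop_op (c *\<^sub>C p) h = c *\<^sub>C loop_op p h"
  by (simp_all add: loop_op_def loop_mat_add loop_mat_scaleC loop.D_add loop.D_scale loop.tr_add loop.tr_scale
      admissible_loop_mat scaleC_add_right distrib_right mult.commute[of critical_level])

lemma clinear_loop_op: "clinear (loop_op p)"
  by (rule clinearI)
     (simp_all add: loop_op_def clinear_add[OF loop.clinear_D] clinear_scale[OF loop.clinear_D]
       scaleC_add_right distrib_left mult.commute[of critical_level])

lemma loop_op_commute_single:
  fixes x y :: "'g::fd_lie_algebra" and k l :: int
  defines "p \<equiv> Poly_Mapping.single k x" and "q \<equiv> Poly_Mapping.single l y"
  shows "loop_op p (loop_op q h) - loop_op q (loop_op p h)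
    = - (loop_op (bracket p q) h + (critical_level * cocycle p q) *\<^sub>C h)"
proof -
  let ?X = "loop_mat p" and ?Y = "loop_mat q" and ?c = critical_level
  note adm = admissible_loop_mat[of p] admissible_loop_mat[of q]
  \<comment> \<open>For k + l = 0 at most one of the two block traces is nonzero, depending on the
    sign of k; in either case the difference is l times the Killing form, and l = -k.\<close>
  have co: "loop.block_trace ?Y ?X - loop.block_trace ?X ?Y = - cocycle p q"
  proof (cases "k + l = 0")
    case True
    then have l: "l = - k" by simp
    show ?thesis
      unfolding p_def q_def block_trace_loop_mat_single cocycle_single l by (simp add: killing_sym[of y x])
  qed (simp add: p_def q_def block_trace_loop_mat_single cocycle_single add.commute[of l k])
  have "loop_op p (loop_op q h) - loop_op q (loop_op p h)
      = (loop.D ?X (loop.D ?Y h) - loop.D ?Y (loop.D ?X h))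
        + ?c *\<^sub>C ((loop.D ?X (loop.tr ?Y) - loop.D ?Y (loop.tr ?X)) * h)"
    unfolding loop_op_def clinear_add[OF loop.clinear_D] clinear_scale[OF loop.clinear_D] loop.D_mult
      scaleC_add_right cvec.scale_right_diff_distrib distrib_left left_diff_distrib mult_scaleC_right
    by (simp add: mult.left_commute)
  also have "\<dots> = - loop.D (loop_mat (bracket p q)) h
      + ?c *\<^sub>C ((- cocycle p q *\<^sub>C 1 - loop.tr (loop_mat (bracket p q))) * h)"
    unfolding loop.D_commute[OF adm] loop.tr_commute[OF adm] co
    by (simp add: p_def q_def loop_mat_bracket_single)
  also have "\<dots> = - (loop_op (bracket p q) h + (?c * cocycle p q) *\<^sub>C h)"
    by (simp add: loop_op_def left_diff_distrib cvec.scale_right_diff_distrib)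
  finally show ?thesis .
qed

lemma loop_op_commute:
  "loop_op p (loop_op q h) - loop_op q (loop_op p h)
    = - (loop_op (bracket p q) h + (critical_level * cocycle p q) *\<^sub>C h)"
proof (induction p rule: poly_mapping_single_induct)
  case (single k x)
  show ?case
  proof (induction q rule: poly_mapping_single_induct)
    case (single l y)
    show ?case by (rule loop_op_commute_single)
  next
    case (add q r)
    from arg_cong2[OF this, of "(+)"] show ?case
      by (simp add: loop_op_linear clinear_add[OF clinear_loop_op] bracket_add_right cocycle_add_right
          distrib_left scaleC_add_left algebra_simps)
  qed
next
  case (add q r)
  from arg_cong2[OF this, of "(+)"] show ?case
    by (simp add: loop_op_linear clinear_add[OF clinear_loop_op] bracket_add_left cocycle_add_left
        distrib_left scaleC_add_left algebra_simps)
qed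

lemma affine_op_linear:
  "affine_op (a + b) h = affine_op a h + affine_op b h"
  "affine_op (c *\<^sub>C a) h = c *\<^sub>C affine_op a h"
  by (simp_all add: affine_op_def plus_affine_def scaleC_affine_def loop_op_linear scaleC_add_left scaleC_add_right
      distrib_left mult_ac)

lemma clinear_affine_op: "clinear (affine_op a)"
  by (rule clinearI)
     (simp_all add: affine_op_def clinear_add[OF clinear_loop_op] clinear_scale[OF clinear_loop_op]
       scaleC_add_right mult_ac)

lemma affine_op_commute:
  "affine_op a (affine_op b h) = affine_op b (affine_op a h) - affine_op (bracket a b) h"
proof -
  have comp: "affine_op a (affine_op b h) = loop_op (loop_part a) (loop_op (loop_part b) h)
      + ((critical_level * central_part b) *\<^sub>C loop_op (loop_part a) h
        + (critical_level * central_part a) *\<^sub>C loop_op (loop_part b) h)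
      + (critical_level * critical_level * (central_part a * central_part b)) *\<^sub>C h" for a b
    unfolding affine_op_def clinear_add[OF clinear_loop_op] clinear_scale[OF clinear_loop_op] scaleC_add_right
    by (simp add: mult_ac add_ac)
  have "affine_op a (affine_op b h) - affine_op b (affine_op a h)
      = loop_op (loop_part a) (loop_op (loop_part b) h) - loop_op (loop_part b) (loop_op (loop_part a) h)"
    unfolding comp[of a b] comp[of b a] mult.commute[of "central_part b" "central_part a"] by simp
  also have "\<dots> = - affine_op (bracket a b) h"
    by (simp add: loop_op_commute affine_op_def bracket_affine_def)
  finally have "affine_op a (affine_op b h) - affine_op b (affine_op a h) = - affine_op (bracket a b) h" .
  then show ?thesis by (simp add: diff_eq_eq)
qed

subsection \<open>Linear functionals on the vacuum module\<close>

text \<open>\<open>affine_op\<close> is an anti-representation, so words act from their first letter on.\<close>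

definition cell_functional :: "(int \<times> 'g::fd_lie_algebra) cell_fun \<Rightarrow> 'g affine list \<Rightarrow> complex"
  where "cell_functional h w = ev (fold affine_op w h)"

lemma clinear_fold_affine_op: "clinear (fold affine_op w)"
proof (induction w)
  case (Cons a w)
  from clinear_compose[OF Cons clinear_affine_op[of a]] show ?case by (simp add: comp_def)
qed (simp add: clinearI)

lemma uea_word_linear_cell_functional: "uea_word_linear (cell_functional h)"
proof -
  have "cell_functional h (u @ x # y # v)
      = cell_functional h (u @ y # x # v) + cell_functional h (u @ bracket x y # v)" for u v x y
    \<comment> \<open>In a word x y the letter x is applied before y, so the commutation rule is
      needed with the letters interchanged; this restores the sign of the bracket.\<close>
    using affine_op_commute[of y x "fold affine_op u h"]
    by (simp add: cell_functional_def bracket_antisym[of y x] clinear_add[OF clinear_fold_affine_op]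
        clinear_add[OF clinear_ev] affine_op_linear(2)[of "- 1" "bracket x y", simplified])
  moreover have "word_linear (cell_functional h)"
    unfolding word_linear_def
    by (simp add: cell_functional_def affine_op_linear clinear_add[OF clinear_fold_affine_op]
        clinear_scale[OF clinear_fold_affine_op] clinear_add[OF clinear_ev] clinear_scale[OF clinear_ev])
  ultimately show ?thesis unfolding uea_word_linear_def by blast
qed

text \<open>Elements of g[t] preserve H_+, so the vector field vanishes at the origin, and so does
  the trace function.\<close>

lemma ev_affine_op_nonneg:
  assumes "p \<in> nonneg_currents"
  shows "ev (affine_op (Affine p 0) h) = 0"
proof -
  have "loop_mat p j i = 0" if "j \<notin> {j. 0 \<le> fst j}" "i \<in> {j. 0 \<le> fst j}" for i j
  proof -
    have "Poly_Mapping.lookup p (fst j - fst i) = 0"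
      using assms that by (auto simp: nonneg_currents_def)
    then show ?thesis by (auto simp: loop_mat_def representation_linear)
  qed
  then have "ev (loop.D (loop_mat p) h) = 0"
    by (rule loop.ev_D_eq_0[OF admissible_loop_mat])
  then show ?thesis
    by (simp add: affine_op_def loop_op_def clinear_add[OF clinear_ev] clinear_scale[OF clinear_ev] ev_mult
        loop.ev_tr[OF admissible_loop_mat])
qed

lemma affine_op_central: "affine_op (Affine 0 1) h = critical_level *\<^sub>C h"
proof -
  have "loop_op 0 h = 0" using loop_op_linear(2)[of 0 0 h] by simp
  then show ?thesis by (simp add: affine_op_def)
qed

lemma uea_induct [case_names word add]:
  assumes "\<And>c w. P (c *\<^sub>C uea_word w)" "\<And>p q. P p \<Longrightarrow> P q \<Longrightarrow> P (p + q)"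
  shows "P (p :: 'a::lie_algebra uea)"
proof -
  have "P (abs_uea q)" for q :: "'a free_alg"
  proof (induction q rule: poly_mapping_single_induct)
    case (single k c)
    have "abs_uea (Poly_Mapping.single k c) = c *\<^sub>C uea_word k"
      by (simp add: uea_word.abs_eq scaleC_uea.abs_eq)
    with assms(1) show ?case by simp
  next
    case (add p q)
    with assms(2) show ?case by (simp flip: plus_uea.abs_eq)
  qed
  then show ?thesis by (induction p) simp
qed

text \<open>In a product ending with a relation, the relation acts last, directly before the
  evaluation, which kills g[t] and sees the central element as the level. The factor a is arbitrary
  so that the induction passes through left multiplication.\<close>

lemma cell_functional_vacuum_rels:
  assumes "u \<in> left_ideal_gen vacuum_rels"
  shows "uea_lift (cell_functional h) u = 0"
proof -
  note lin = clinear_uea_lift[OF uea_word_linear_cell_functional[of h]]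
  note val = uea_lift_word[OF uea_word_linear_cell_functional[of h]]
  have "uea_lift (cell_functional h) (a * u) = 0" for a
    using assms
  proof (induction arbitrary: a)
    case (gen r)
    show ?case
    proof (induction a rule: uea_induct)
      case (word c w)
      have "uea_lift (cell_functional h) (uea_word w * r) = 0"
        using gen ev_affine_op_nonneg
        by (auto simp: vacuum_rels_def val cell_functional_def right_diff_distrib clinear_diff[OF lin]
            clinear_scale[OF lin] affine_op_central clinear_scale[OF clinear_ev] simp flip: uea_word_append)
      then show ?case by (simp add: clinear_scale[OF lin])
    qed (simp add: distrib_right clinear_add[OF lin])
  qed (simp_all add: clinear_0[OF lin] distrib_left clinear_add[OF lin] flip: mult.assoc)
  from this[of 1] show ?thesis by simp
qed

text \<open>Only the constant parts of the vector fields contribute to the lowest-order term.\<close>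

lemma cell_functional_lowest:
  assumes "p \<in> aug (length w)"
  shows "cell_functional p w = ev (fold (\<lambda>a. loop.cder (loop_mat (loop_part a))) w p)"
  using assms
proof (induction w arbitrary: p)
  case (Cons a w)
  let ?d = "\<lambda>a. loop.cder (loop_mat (loop_part a))"
  let ?r = "affine_op a p - ?d a p"
  have lin: "clinear (fold ?d w)" for w
  proof (induction w)
    case (Cons a w)
    from clinear_compose[OF Cons loop.clinear_cder[of "loop_mat (loop_part a)"]] show ?case by (simp add: comp_def)
  qed (simp add: clinearI)
  have "fold ?d w q \<in> aug (n - length w)" if "q \<in> aug n" for w n and q :: "(int \<times> 'a) cell_fun"
    using that
  proof (induction w arbitrary: q n)
    case (Cons a w)
    from Cons.IH[OF loop.cder_aug[OF Cons.prems]] show ?case by simp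
  qed simp
  note fold_aug = this
  have p: "p \<in> aug (Suc (length w))" using Cons.prems by simp
  have "loop.D (loop_mat (loop_part a)) p - ?d a p \<in> aug (Suc (length w))"
    using loop.D_minus_cder_aug[OF admissible_loop_mat p, of "loop_part a"] by simp
  then have "(loop.D (loop_mat (loop_part a)) p - ?d a p)
      + (critical_level *\<^sub>C (loop.tr (loop_mat (loop_part a)) * p) + (critical_level * central_part a) *\<^sub>C p) \<in> aug (Suc (length w))"
    using p by (intro aug_add aug_scale aug_times)
  \<comment> \<open>The remainder keeps the full order \<open>Suc (length w)\<close>, whereas the
    constant fields of the remaining letters lower it by \<open>length w\<close> only; hence it
    evaluates to 0.\<close>
  then have r: "?r \<in> aug (Suc (length w))" by (simp add: affine_op_def loop_op_def algebra_simps)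
  have "cell_functional p (a # w) = cell_functional (?d a p) w + cell_functional ?r w"
    by (simp add: cell_functional_def clinear_diff[OF clinear_fold_affine_op] clinear_diff[OF clinear_ev])
  also have "cell_functional ?r w = ev (fold ?d w ?r)"
    by (rule Cons.IH[OF aug_mono[OF _ r]]) simp
  also have "\<dots> = 0" using fold_aug[OF r, of w] by (intro ev_aug) simp
  also have "cell_functional (?d a p) w = ev (fold ?d w (?d a p))"
    by (rule Cons.IH) (use loop.cder_aug[OF p] in simp)
  finally show ?case by simp
qed (simp add: cell_functional_def)

section \<open>Positive modes acting on powers\<close>

definition mode :: "int \<Rightarrow> 'g::fd_lie_algebra \<Rightarrow> 'g affine uea"
  where "mode n x = uea_word [Affine (Poly_Mapping.single n x) 0]"

definition central :: "'g::fd_lie_algebra affine uea"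
  where "central = uea_word [Affine 0 1]"

lemma uea_word_zero: "uea_word [0] = 0"
  using uea_word_1(2)[of 0 0] by simp

lemma mode_linear: "mode n (x + y) = mode n x + mode n y" "mode n (c *\<^sub>C x) = c *\<^sub>C mode n x"
proof -
  have "Affine (Poly_Mapping.single n (x + y)) 0 = Affine (Poly_Mapping.single n x) 0 + Affine (Poly_Mapping.single n y) 0"
    by (simp add: plus_affine_def Poly_Mapping.single_add)
  then show "mode n (x + y) = mode n x + mode n y" by (simp add: mode_def uea_word_1)
  have "Affine (Poly_Mapping.single n (c *\<^sub>C x)) 0 = c *\<^sub>C Affine (Poly_Mapping.single n x) 0"
    by (simp add: scaleC_affine_def)
  then show "mode n (c *\<^sub>C x) = c *\<^sub>C mode n x" by (simp add: mode_def uea_word_1)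
qed

lemma mode_commute:
  "mode m x * mode n y = mode n y * mode m x + mode (m + n) (bracket x y)
    + (if m + n = 0 then of_int m * killing x y else 0) *\<^sub>C central"
proof -
  have "bracket (Affine (Poly_Mapping.single m x) 0) (Affine (Poly_Mapping.single n y) 0)
      = Affine (Poly_Mapping.single (m + n) (bracket x y)) 0
        + (if m + n = 0 then of_int m * killing x y else 0) *\<^sub>C Affine 0 1"
    by (simp add: bracket_affine_def bracket_single cocycle_single plus_affine_def scaleC_affine_def)
  then have "uea_word [bracket (Affine (Poly_Mapping.single m x) 0) (Affine (Poly_Mapping.single n y) 0)]
      = mode (m + n) (bracket x y) + (if m + n = 0 then of_int m * killing x y else 0) *\<^sub>C central"
    by (simp only: uea_word_1(1,2) mode_def central_def)
  then show ?thesis by (simp only: uea_word_1(3) mode_def[symmetric]) (simp add: algebra_simps)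
qed

lemma central_commute: "central * mode n y = mode n y * central"
proof -
  have "cocycle 0 q = 0" for q :: "int \<Rightarrow>\<^sub>0 'a" by (simp add: cocycle_def)
  then have "bracket (Affine 0 1) (Affine (Poly_Mapping.single n y) 0) = 0"
    by (simp add: bracket_affine_def zero_affine_def)
  then show ?thesis
    using uea_word_1(3)[of "Affine 0 1" "Affine (Poly_Mapping.single n y) 0"]
    by (simp add: mode_def central_def uea_word_zero)
qed

lemma left_ideal_gen_diff: "p \<in> left_ideal_gen R \<Longrightarrow> q \<in> left_ideal_gen R \<Longrightarrow> p - q \<in> left_ideal_gen R"
  using left_ideal_gen.add[OF _ left_ideal_gen_uminus, of p R q] by simp

definition vac_eq :: "'g::fd_lie_algebra affine uea \<Rightarrow> 'g affine uea \<Rightarrow> bool"  (infix \<open>\<approx>\<close> 50)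
  where "u \<approx> v \<longleftrightarrow> u - v \<in> left_ideal_gen vacuum_rels"

lemma vac_eq_refl: "u \<approx> u"
  by (simp add: vac_eq_def left_ideal_gen.zero)

lemma vac_eq_trans [trans]: "u \<approx> v \<Longrightarrow> v \<approx> w \<Longrightarrow> u \<approx> w"
  unfolding vac_eq_def by (drule (1) left_ideal_gen.add) simp

lemma vac_eq_add: "u \<approx> u' \<Longrightarrow> v \<approx> v' \<Longrightarrow> u + v \<approx> u' + v'"
  unfolding vac_eq_def by (drule (1) left_ideal_gen.add) (simp add: algebra_simps)

lemma vac_eq_mult: "u \<approx> v \<Longrightarrow> a * u \<approx> a * v"
  unfolding vac_eq_def by (drule left_ideal_gen.mult_left[of _ _ a]) (simp add: algebra_simps)

lemma vac_eq_scaleC: "u \<approx> v \<Longrightarrow> c *\<^sub>C u \<approx> c *\<^sub>C v"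
  using vac_eq_mult[of u v "c *\<^sub>C 1"] by simp

lemma vac_eq_sum: "(\<And>i. i \<in> I \<Longrightarrow> f i \<approx> g i) \<Longrightarrow> sum f I \<approx> sum g I"
  by (induction I rule: infinite_finite_induct) (auto intro: vac_eq_add vac_eq_refl)

lemma vac_eq_0_cong: "u \<approx> v \<Longrightarrow> u \<approx> 0 \<longleftrightarrow> v \<approx> 0"
  unfolding vac_eq_def using left_ideal_gen.add[of "u - v" vacuum_rels v] left_ideal_gen_diff[of u vacuum_rels "u - v"]
  by auto

lemma mode_vac_eq_0: "0 \<le> n \<Longrightarrow> mode n x \<approx> 0"
  unfolding vac_eq_def mode_def
  by (auto intro!: left_ideal_gen.gen simp: vacuum_rels_def nonneg_currents_def Poly_Mapping.lookup_single when_def)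

lemma central_power_vac_eq: "central * mode n y ^ k \<approx> critical_level *\<^sub>C mode n y ^ k"
proof -
  have "central * mode n y ^ k = mode n y ^ k * central"
  proof (induction k)
    case (Suc k)
    have "central * mode n y ^ Suc k = mode n y * (central * mode n y ^ k)"
      by (simp add: central_commute flip: mult.assoc)
    with Suc show ?case by (simp add: mult.assoc)
  qed simp
  moreover have "central \<approx> critical_level *\<^sub>C 1"
    unfolding vac_eq_def central_def by (rule left_ideal_gen.gen) (simp add: vacuum_rels_def)
  ultimately show ?thesis using vac_eq_mult[of central "critical_level *\<^sub>C 1" "mode n y ^ k"] by simp
qed

lemma commute_power:
  fixes a b c :: "'a::ring_1"
  assumes "a * b = b * a + c"
  shows "a * b ^ k = b ^ k * a + (\<Sum>p<k. b ^ p * c * b ^ (k - Suc p))"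
proof (induction k)
  case (Suc k)
  have "a * b ^ Suc k = b * (a * b ^ k) + c * b ^ k"
    using assms by (simp add: distrib_right flip: mult.assoc)
  also have "\<dots> = b ^ Suc k * a + ((\<Sum>p<k. b ^ Suc p * c * b ^ (k - Suc p)) + c * b ^ k)"
    by (simp add: Suc distrib_left sum_distrib_left mult.assoc)
  also have "(\<Sum>p<k. b ^ Suc p * c * b ^ (k - Suc p)) + c * b ^ k = (\<Sum>p<Suc k. b ^ p * c * b ^ (Suc k - Suc p))"
    by (subst sum.lessThan_Suc_shift) simp
  finally show ?case .
qed simp

lemma mode_power_commute:
  assumes "n - 1 \<noteq> 0 \<or> killing x y = 0"
  shows "mode n x * mode (- 1) y ^ k = mode (- 1) y ^ k * mode n x
    + (\<Sum>p<k. mode (- 1) y ^ p * mode (n - 1) (bracket x y) * mode (- 1) y ^ (k - Suc p))"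
  by (rule commute_power) (use mode_commute[of n x "- 1" y] assms in auto)

lemma mode_power_vac_eq:
  assumes "0 \<le> n" "n \<noteq> 1 \<or> killing x y = 0"
  shows "mode n x * mode (- 1) y ^ k
    \<approx> (\<Sum>p<k. mode (- 1) y ^ p * mode (n - 1) (bracket x y) * mode (- 1) y ^ (k - Suc p))"
proof -
  have "mode (- 1) y ^ k * mode n x \<approx> mode (- 1) y ^ k * 0"
    by (rule vac_eq_mult[OF mode_vac_eq_0[OF assms(1)]])
  from vac_eq_add[OF this vac_eq_refl] show ?thesis
    using assms(2) by (subst mode_power_commute) auto
qed

text \<open>Passing one factor Y turns x[1] into [x, y][0], and passing a later one turns this into
  W. A W preceded by s factors arises from s + 1 choices of the earlier factor. Besides, each Y
  meets x[1] once and gives a central term.\<close>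

lemma mode_1_power_vac_eq:
  fixes x y :: "'g::fd_lie_algebra"
  defines "Y \<equiv> mode (- 1) y" and "W \<equiv> mode (- 1) (bracket (bracket x y) y)"
  shows "mode 1 x * Y ^ k \<approx> (\<Sum>s<k - 1. of_nat (Suc s) *\<^sub>C (Y ^ s * W * Y ^ (k - 1 - Suc s)))
    + (of_nat k * critical_level * killing x y) *\<^sub>C Y ^ (k - 1)"
proof (induction k)
  case 0
  then show ?case using mode_vac_eq_0[of 1 x] by simp
next
  case (Suc k)
  have Y: "mode 1 x * Y ^ Suc k = Y * (mode 1 x * Y ^ k) + mode 0 (bracket x y) * Y ^ k
      + killing x y *\<^sub>C (central * Y ^ k)"
    using mode_commute[of 1 x "- 1" y] by (simp add: Y_def distrib_right flip: mult.assoc)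
  have "mode 0 (bracket x y) * Y ^ k \<approx> (\<Sum>s<k. Y ^ s * W * Y ^ (k - Suc s))"
    using mode_power_vac_eq[of 0 "bracket x y" y k] by (simp add: Y_def W_def)
  moreover have "killing x y *\<^sub>C (central * Y ^ k) \<approx> killing x y *\<^sub>C (critical_level *\<^sub>C Y ^ k)"
    unfolding Y_def by (rule vac_eq_scaleC[OF central_power_vac_eq])
  ultimately have "mode 1 x * Y ^ Suc k
      \<approx> Y * ((\<Sum>s<k - 1. of_nat (Suc s) *\<^sub>C (Y ^ s * W * Y ^ (k - 1 - Suc s)))
        + (of_nat k * critical_level * killing x y) *\<^sub>C Y ^ (k - 1))
      + (\<Sum>s<k. Y ^ s * W * Y ^ (k - Suc s)) + killing x y *\<^sub>C (critical_level *\<^sub>C Y ^ k)"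
    unfolding Y by (intro vac_eq_add vac_eq_mult Suc)
  also have "\<dots> = (\<Sum>s<k. of_nat (Suc s) *\<^sub>C (Y ^ s * W * Y ^ (k - Suc s)))
      + (of_nat (Suc k) * critical_level * killing x y) *\<^sub>C Y ^ k"
  proof (cases k)
    case (Suc n)
    have A: "Y * (\<Sum>s<n. of_nat (Suc s) *\<^sub>C (Y ^ s * W * Y ^ (n - Suc s)))
        = (\<Sum>s<k. of_nat s *\<^sub>C (Y ^ s * W * Y ^ (k - Suc s)))"
      unfolding Suc sum.lessThan_Suc_shift by (simp add: sum_distrib_left mult.assoc)
    have B: "(\<Sum>s<k. of_nat (Suc s) *\<^sub>C (Y ^ s * W * Y ^ (k - Suc s)))
        = (\<Sum>s<k. of_nat s *\<^sub>C (Y ^ s * W * Y ^ (k - Suc s))) + (\<Sum>s<k. Y ^ s * W * Y ^ (k - Suc s))"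
      by (simp add: scaleC_add_left add.commute flip: sum.distrib)
    have C: "(of_nat k * critical_level * killing x y) *\<^sub>C Y ^ k + killing x y *\<^sub>C (critical_level *\<^sub>C Y ^ k)
        = (of_nat (Suc k) * critical_level * killing x y) *\<^sub>C Y ^ k"
      by (simp add: algebra_simps flip: scaleC_add_left)
    have n: "k - 1 = n" "Y * Y ^ n = Y ^ k" using Suc by simp_all
    show ?thesis
      unfolding distrib_left mult_scaleC_right n A B C[symmetric] by (simp only: add_ac)
  qed (simp add: mult.commute)
  finally show ?case by simp
qed

text \<open>Excludes central terms once a mode has already been commuted with y, also when its index
  is 1.\<close>

lemma killing_bracket_self: "killing (bracket x y) y = 0"
  by (simp add: killing_invariant)

text \<open>The indices n, n - 1 and n - 2 are nonnegative, so after each of the three commutations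
  the mode that reaches the right end annihilates the vacuum. For n = 2 the resulting index n - 3 is
  negative, which is why the process stops there.\<close>

lemma mode_ge_2_power_vac_eq:
  fixes x y :: "'g::fd_lie_algebra"
  assumes n: "2 \<le> n"
  defines "Y \<equiv> mode (- 1) y"
  shows "mode n x * Y ^ k \<approx> (\<Sum>p<k. \<Sum>q<k - Suc p. \<Sum>r<k - Suc p - Suc q.
    Y ^ (p + q + r) * mode (n - 3) (bracket (bracket (bracket x y) y) y) * Y ^ (k - Suc p - Suc q - Suc r))"
proof -
  have "mode (n - 2) (bracket (bracket x y) y) * Y ^ i
      \<approx> (\<Sum>r<i. Y ^ r * mode (n - 3) (bracket (bracket (bracket x y) y) y) * Y ^ (i - Suc r))" for i
    using mode_power_vac_eq[of "n - 2" "bracket (bracket x y) y" y i] n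
    by (simp add: Y_def killing_bracket_self)
  note 2 = this
  have 1: "mode (n - 1) (bracket x y) * Y ^ j \<approx> (\<Sum>q<j. \<Sum>r<j - Suc q.
      Y ^ (q + r) * mode (n - 3) (bracket (bracket (bracket x y) y) y) * Y ^ (j - Suc q - Suc r))" for j
  proof -
    have "mode (n - 1) (bracket x y) * Y ^ j
        \<approx> (\<Sum>q<j. Y ^ q * (mode (n - 2) (bracket (bracket x y) y) * Y ^ (j - Suc q)))"
      using mode_power_vac_eq[of "n - 1" "bracket x y" y j] n
      by (simp add: Y_def killing_bracket_self mult.assoc)
    also have "\<dots> \<approx> (\<Sum>q<j. Y ^ q * (\<Sum>r<j - Suc q.
        Y ^ r * mode (n - 3) (bracket (bracket (bracket x y) y) y) * Y ^ (j - Suc q - Suc r)))"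
      by (intro vac_eq_sum vac_eq_mult 2)
    finally show ?thesis by (simp add: sum_distrib_left power_add mult.assoc)
  qed
  have "mode n x * Y ^ k \<approx> (\<Sum>p<k. Y ^ p * (mode (n - 1) (bracket x y) * Y ^ (k - Suc p)))"
    using mode_power_vac_eq[of n x y k] n by (simp add: Y_def mult.assoc)
  also have "\<dots> \<approx> (\<Sum>p<k. Y ^ p * (\<Sum>q<k - Suc p. \<Sum>r<k - Suc p - Suc q.
      Y ^ (q + r) * mode (n - 3) (bracket (bracket (bracket x y) y) y) * Y ^ (k - Suc p - Suc q - Suc r)))"
    by (intro vac_eq_sum vac_eq_mult 1)
  finally show ?thesis by (simp add: sum_distrib_left power_add mult.assoc)
qed

section \<open>Reduction to powers\<close>

lemma clinear_at_minus_one: "clinear at_minus_one"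
  unfolding at_minus_one_def by (rule clinear_sym_lift[OF sym_word_linear_at_minus_one])

lemma clinear_uea_incl: "clinear uea_incl"
  unfolding uea_incl_def by (rule clinear_uea_lift[OF uea_word_linear_incl])

lemma uea_incl_mult: "uea_incl (u * v) = uea_incl u * uea_incl v"
proof (induction u rule: uea_induct)
  case (word c a)
  have "uea_incl (uea_word a * v) = uea_incl (uea_word a) * uea_incl v"
  proof (induction v rule: uea_induct)
    case (word d b)
    show ?case
      by (simp add: clinear_scale[OF clinear_uea_incl] uea_incl_word flip: uea_word_append)
  qed (simp add: distrib_left clinear_add[OF clinear_uea_incl])
  then show ?case by (simp add: clinear_scale[OF clinear_uea_incl])
qed (simp add: distrib_right clinear_add[OF clinear_uea_incl])

lemma uea_incl_power: "uea_incl (u ^ n) = uea_incl u ^ n"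
proof (induction n)
  case 0
  show ?case using uea_incl_word[of "[]"] by (simp add: uea_word_Nil)
qed (simp add: uea_incl_mult)

lemma uea_incl_shift: "uea_incl (uea_word [shift_minus_one x]) = mode (- 1) x"
  by (simp add: uea_incl_word mode_def shift_minus_one.rep_eq)

definition symm_incl :: "'g::fd_lie_algebra sym_alg \<Rightarrow> 'g affine uea"
  where "symm_incl s = uea_incl (symmetrise (at_minus_one s))"

lemma clinear_symm_incl: "clinear symm_incl"
  unfolding symm_incl_def[abs_def]
  by (intro clinear_compose[OF clinear_uea_incl] clinear_compose[OF clinear_symmetrise] clinear_at_minus_one)

lemma at_minus_one_power_times:
  "at_minus_one (sym_word [z] * sym_word [y] ^ n) = sym_word [shift_minus_one z] * sym_word [shift_minus_one y] ^ n"
  by (simp add: at_minus_one_word sym_word_Cons[of "shift_minus_one z" "replicate n _"] sym_word_replicate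
      flip: sym_word_Cons[of z "replicate n y"] sym_word_replicate)

lemma at_minus_one_power: "at_minus_one (sym_word [y] ^ n) = sym_word [shift_minus_one y] ^ n"
  by (simp add: at_minus_one_word flip: sym_word_replicate)

lemma symm_incl_power: "symm_incl (sym_word [y] ^ n) = mode (- 1) y ^ n"
  by (simp add: symm_incl_def at_minus_one_power symmetrise_power uea_incl_power uea_incl_shift)

lemma symm_incl_power_times:
  "of_nat n *\<^sub>C symm_incl (sym_word [z] * sym_word [y] ^ (n - 1))
    = (\<Sum>p<n. mode (- 1) y ^ p * mode (- 1) z * mode (- 1) y ^ (n - Suc p))"
  using arg_cong[OF symmetrise_power_times[of n "shift_minus_one z" "shift_minus_one y"], of uea_incl]
  by (simp add: symm_incl_def at_minus_one_power_times clinear_scale[OF clinear_uea_incl]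
      clinear_sum[OF clinear_uea_incl] uea_incl_mult uea_incl_power uea_incl_shift)

lemma feigin_frenkel_centre_iff:
  "symmetrise (at_minus_one F) \<in> feigin_frenkel_centre \<longleftrightarrow> (\<forall>n\<ge>0. \<forall>x. mode n x * symm_incl F \<approx> 0)"
proof -
  have abs: "vacuum_action a (abs_vacuum_module b) = abs_vacuum_module (a * b)" for a b :: "'a affine uea"
    by (simp add: vacuum_action.abs_eq)
  have zero: "abs_vacuum_module b = 0 \<longleftrightarrow> b \<approx> 0" for b :: "'a affine uea"
    unfolding zero_vacuum_module_def vac_eq_def vacuum_module.abs_eq_iff ..
  have "symmetrise (at_minus_one F) \<in> feigin_frenkel_centre
      \<longleftrightarrow> (\<forall>p\<in>nonneg_currents. uea_word [Affine p 0] * symm_incl F \<approx> 0)"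
    unfolding feigin_frenkel_centre_def vacuum_state_def vacuum_def
    by (simp add: abs zero symm_incl_def)
  also have "\<dots> \<longleftrightarrow> (\<forall>n\<ge>0. \<forall>x. mode n x * symm_incl F \<approx> 0)"
  proof (intro iffI ballI allI impI)
    fix n :: int and x
    assume "\<forall>p\<in>nonneg_currents. uea_word [Affine p 0] * symm_incl F \<approx> 0" "0 \<le> n"
    then show "mode n x * symm_incl F \<approx> 0"
      unfolding mode_def by (auto simp: nonneg_currents_def Poly_Mapping.lookup_single when_def)
  next
    fix p :: "int \<Rightarrow>\<^sub>0 'a"
    assume modes: "\<forall>n\<ge>0. \<forall>x. mode n x * symm_incl F \<approx> 0" and p: "p \<in> nonneg_currents"
    have lin: "clinear (\<lambda>p :: int \<Rightarrow>\<^sub>0 'a. uea_word [Affine p 0])"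
    proof (rule clinearI)
      fix p q :: "int \<Rightarrow>\<^sub>0 'a" and c
      show "uea_word [Affine (p + q) 0] = uea_word [Affine p 0] + uea_word [Affine q 0]"
        using uea_word_1(1)[of "Affine p 0" "Affine q 0"] by (simp add: plus_affine_def)
      show "uea_word [Affine (c *\<^sub>C p) 0] = c *\<^sub>C uea_word [Affine p 0]"
        using uea_word_1(2)[of c "Affine p 0"] by (simp add: scaleC_affine_def)
    qed
    have "p = (\<Sum>k\<in>Poly_Mapping.keys p. Poly_Mapping.single k (Poly_Mapping.lookup p k))"
      by (rule poly_mapping_eqI)
         (auto simp: Poly_Mapping.lookup_sum Poly_Mapping.lookup_single when_def Poly_Mapping.in_keys_iff
           intro!: sum.neutral[symmetric] split: if_splits)
    then have "uea_word [Affine p 0] = (\<Sum>k\<in>Poly_Mapping.keys p. mode k (Poly_Mapping.lookup p k))"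
      unfolding mode_def by (subst clinear_sum[OF lin, symmetric]) simp
    moreover have "mode k (Poly_Mapping.lookup p k) * symm_incl F \<approx> 0" if "k \<in> Poly_Mapping.keys p" for k
      using p that modes unfolding nonneg_currents_def Poly_Mapping.in_keys_iff by (cases "k < 0") auto
    then have "(\<Sum>k\<in>Poly_Mapping.keys p. mode k (Poly_Mapping.lookup p k) * symm_incl F) \<approx> (\<Sum>k\<in>Poly_Mapping.keys p. 0)"
      by (rule vac_eq_sum)
    ultimately show "uea_word [Affine p 0] * symm_incl F \<approx> 0"
      by (simp add: sum_distrib_right)
  qed
  finally show ?thesis .
qed


section \<open>From invariance to the action of x[1]\<close>

lemma clinear_at_scaleC_1: "clinear \<zeta> \<Longrightarrow> clinear (\<lambda>v. \<zeta> v *\<^sub>C (1 :: 'b::complex_algebra_1))"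
  by (rule clinearI) (simp_all add: clinear_add clinear_scale scaleC_add_left)

text \<open>The derivative of \<open>[u, F] = 0\<close> along a covector \<open>\<zeta>\<close>, contracted over \<open>u \<otimes> \<zeta> = \<Sum>\<^sub>b b \<otimes> b\<^sup>* \<circ> ad(x)\<close>.\<close>

lemma invariant_killing_identity:
  fixes x :: "'g::fd_lie_algebra"
  assumes inv: "\<And>u. (\<Sum>y\<in>I. c y *\<^sub>C (sym_word [bracket u y] * sym_word [y] ^ n)) = 0"
  shows "(\<Sum>y\<in>I. c y *\<^sub>C (killing x y *\<^sub>C sym_word [y] ^ n))
    = (\<Sum>y\<in>I. c y *\<^sub>C (of_nat n *\<^sub>C (sym_word [bracket (bracket x y) y] * sym_word [y] ^ (n - 1))))"
proof -
  let ?B = "chosen_basis :: 'g set"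
  \<comment> \<open>The covector dual to b, composed with ad(x). Summed over b, the first Leibniz
    term becomes minus the trace of ad(x) ad(y), the sign coming from [b, y] = -[y, b]; in the
    second, \<open>basis_expansion\<close> reassembles [x, y].\<close>
  define \<zeta> where "\<zeta> b v = cvec.representation ?B (bracket x v) b" for b v
  have lin: "clinear (\<zeta> b)" for b
    unfolding \<zeta>_def by (rule clinear_compose[OF clinear_representation clinear_bracket])
  note der = clinear_at_scaleC_1[OF lin]
  have "(\<Sum>y\<in>I. c y *\<^sub>C (\<zeta> b (bracket b y) *\<^sub>C sym_word [y] ^ n
      + of_nat n *\<^sub>C (\<zeta> b y *\<^sub>C (sym_word [bracket b y] * sym_word [y] ^ (n - 1))))) = 0" for b
  proof -
    have "sym_der (\<lambda>v. \<zeta> b v *\<^sub>C 1) (\<Sum>y\<in>I. c y *\<^sub>C (sym_word [bracket b y] * sym_word [y] ^ n)) = 0"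
      unfolding inv by (rule clinear_0[OF clinear_sym_der[OF der]])
    then show ?thesis
      by (simp add: clinear_sum[OF clinear_sym_der[OF der]] clinear_scale[OF clinear_sym_der[OF der]]
          sym_der_mult[OF der] sym_der_gen[OF der] sym_der_power[OF der] mult.commute)
  qed
  then have "(\<Sum>b\<in>?B. \<Sum>y\<in>I. c y *\<^sub>C (\<zeta> b (bracket b y) *\<^sub>C sym_word [y] ^ n
      + of_nat n *\<^sub>C (\<zeta> b y *\<^sub>C (sym_word [bracket b y] * sym_word [y] ^ (n - 1))))) = 0"
    by simp
  then have "(\<Sum>y\<in>I. c y *\<^sub>C ((\<Sum>b\<in>?B. \<zeta> b (bracket b y) *\<^sub>C sym_word [y] ^ n)
      + of_nat n *\<^sub>C (\<Sum>b\<in>?B. \<zeta> b y *\<^sub>C (sym_word [bracket b y] * sym_word [y] ^ (n - 1))))) = 0"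
    by (subst (asm) sum.swap) (simp add: cvec.scale_sum_right sum.distrib scaleC_add_right)
  moreover have "(\<Sum>b\<in>?B. \<zeta> b (bracket b y) *\<^sub>C sym_word [y] ^ n) = - (killing x y *\<^sub>C sym_word [y] ^ n)" for y
  proof -
    have "(\<Sum>b\<in>?B. \<zeta> b (bracket b y)) = (\<Sum>b\<in>?B. - cvec.representation ?B (bracket x (bracket y b)) b)"
      by (rule sum.cong[OF refl])
         (simp add: \<zeta>_def bracket_antisym[of _ y] bracket_minus_right cvec.representation_neg chosen_basis)
    also have "\<dots> = - killing x y" by (simp add: killing_def ctrace_def sum_negf)
    finally show ?thesis by (simp flip: cvec.scale_sum_left)
  qed
  moreover have "(\<Sum>b\<in>?B. \<zeta> b y *\<^sub>C (sym_word [bracket b y] * sym_word [y] ^ (n - 1)))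
      = sym_word [bracket (bracket x y) y] * sym_word [y] ^ (n - 1)" for y
  proof -
    have lin: "clinear (\<lambda>v. sym_word [bracket v y] * sym_word [y] ^ (n - 1))"
      by (rule clinearI) (simp_all add: bracket_add_left bracket_scaleC_left sym_word_1 distrib_right)
    have "(\<Sum>b\<in>?B. \<zeta> b y *\<^sub>C b) = bracket x y" unfolding \<zeta>_def by (rule basis_expansion)
    then show ?thesis
      by (metis (mono_tags, lifting) clinear_scale[OF lin] clinear_sum[OF lin] sum.cong)
  qed
  ultimately show ?thesis
    by (simp add: cvec.scale_right_diff_distrib sum_subtractf)
qed

text \<open>The weights n - 2s have partial sums (s + 1)(n - s). These vanish at s = n, so Abel
  summation leaves no boundary term, and they are positive before that.\<close>

lemma sum_by_parts:
  fixes T :: "nat \<Rightarrow> 'a::complex_vector"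
  shows "(\<Sum>s<Suc n. (of_nat n - 2 * of_nat s) *\<^sub>C T s)
    = (\<Sum>s<n. of_nat (Suc s * (n - s)) *\<^sub>C (T s - T (Suc s)))"
proof -
  have "(\<Sum>s<m. of_nat (Suc s * (n - s)) *\<^sub>C (T s - T (Suc s)))
      = (\<Sum>s<m. (of_nat n - 2 * of_nat s) *\<^sub>C T s) - (of_nat m * (of_nat n - of_nat m + 1)) *\<^sub>C T m"
    if "m \<le> n" for m
    using that
  proof (induction m)
    case (Suc m)
    have "(of_nat (n - m) :: complex) = of_nat n - of_nat m"
      using Suc.prems by (intro of_nat_diff) simp
    then have "(of_nat (Suc m * (n - m)) :: complex) = (of_nat m + 1) * (of_nat n - of_nat m)"
      by (simp only: of_nat_mult of_nat_Suc add.commute)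
    then have "of_nat (Suc m * (n - m)) *\<^sub>C (T m - T (Suc m))
        = ((of_nat m + 1) * (of_nat n - of_nat m)) *\<^sub>C T m
          - ((of_nat m + 1) * (of_nat n - of_nat m)) *\<^sub>C T (Suc m)"
      by (simp only: cvec.scale_right_diff_distrib)
    moreover have "((of_nat m + 1) * (of_nat n - of_nat m)) *\<^sub>C T m
        = (of_nat n - 2 * of_nat m) *\<^sub>C T m + (of_nat m * (of_nat n - of_nat m + 1)) *\<^sub>C T m"
      unfolding scaleC_add_left[symmetric]
      by (rule arg_cong[of _ _ "\<lambda>a. a *\<^sub>C T m"]) (simp add: algebra_simps)
    moreover have "((of_nat m + 1) * (of_nat n - of_nat m)) *\<^sub>C T (Suc m)
        = (of_nat (Suc m) * (of_nat n - of_nat (Suc m) + 1)) *\<^sub>C T (Suc m)"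
      by (simp add: algebra_simps)
    ultimately show ?case using Suc by simp
  qed simp
  from this[OF order_refl] show ?thesis
    by (simp add: algebra_simps flip: cvec.scale_left_diff_distrib)
qed

lemma mode_1_symm_incl_vac_eq:
  fixes x :: "'g::fd_lie_algebra"
  assumes inv: "\<And>u. (\<Sum>y\<in>I. c y *\<^sub>C (sym_word [bracket u y] * sym_word [y] ^ (n + 2))) = 0"
  shows "mode 1 x * (\<Sum>y\<in>I. c y *\<^sub>C mode (- 1) y ^ (n + 3))
    \<approx> (- 1 / 2) *\<^sub>C (\<Sum>s<Suc n. of_nat (Suc s * (Suc n - s)) *\<^sub>C (\<Sum>y\<in>I. c y *\<^sub>C
      (mode (- 1) y ^ s * mode (- 2) (bracket (bracket (bracket x y) y) y) * mode (- 1) y ^ (n - s))))"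
proof -
  define Y where "Y y = mode (- 1) y" for y :: 'g
  define W where "W y = mode (- 1) (bracket (bracket x y) y)" for y
  define T where "T y s = Y y ^ s * W y * Y y ^ (Suc n - s)" for y s
  \<comment> \<open>The identity in the symmetric algebra is carried over by symmetrisation; the
    factor n + 2 is absorbed by the n + 2 positions that W can take.\<close>
  have kill: "(\<Sum>y\<in>I. c y *\<^sub>C (killing x y *\<^sub>C Y y ^ (n + 2))) = (\<Sum>y\<in>I. c y *\<^sub>C (\<Sum>s<n + 2. T y s))"
  proof -
    have "symm_incl (\<Sum>y\<in>I. c y *\<^sub>C (killing x y *\<^sub>C sym_word [y] ^ (n + 2)))
        = symm_incl (\<Sum>y\<in>I. c y *\<^sub>C (of_nat (n + 2) *\<^sub>C
          (sym_word [bracket (bracket x y) y] * sym_word [y] ^ (n + 2 - 1))))"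
      by (rule arg_cong[OF invariant_killing_identity[OF inv]])
    then show ?thesis
      by (simp only: clinear_sum[OF clinear_symm_incl] clinear_scale[OF clinear_symm_incl] symm_incl_power
          symm_incl_power_times) (simp add: Y_def W_def T_def)
  qed
  have "mode 1 x * (\<Sum>y\<in>I. c y *\<^sub>C Y y ^ (n + 3)) = (\<Sum>y\<in>I. c y *\<^sub>C (mode 1 x * Y y ^ (n + 3)))"
    by (simp add: sum_distrib_left)
  also have "\<dots> \<approx> (\<Sum>y\<in>I. c y *\<^sub>C ((\<Sum>s<n + 2. of_nat (Suc s) *\<^sub>C T y s)
      + (of_nat (n + 3) * critical_level * killing x y) *\<^sub>C Y y ^ (n + 2)))"
    using mode_1_power_vac_eq[of x _ "n + 3"]
    by (intro vac_eq_sum vac_eq_scaleC) (simp add: Y_def W_def T_def numeral_3_eq_3 del: of_nat_Suc of_nat_add)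
  also have "\<dots> = (\<Sum>y\<in>I. c y *\<^sub>C (\<Sum>s<n + 2. of_nat (Suc s) *\<^sub>C T y s))
      + (of_nat (n + 3) * critical_level) *\<^sub>C (\<Sum>y\<in>I. c y *\<^sub>C (killing x y *\<^sub>C Y y ^ (n + 2)))"
    by (simp only: scaleC_add_right sum.distrib cvec.scale_sum_right scaleC_scaleC mult_ac)
  also have "\<dots> = (\<Sum>y\<in>I. c y *\<^sub>C ((- 1 / 2) *\<^sub>C (\<Sum>s<Suc (Suc n). (of_nat (Suc n) - 2 * of_nat s) *\<^sub>C T y s)))"
  proof -
    have "(\<Sum>s<n + 2. of_nat (Suc s) *\<^sub>C T y s) + (of_nat (n + 3) * critical_level) *\<^sub>C (\<Sum>s<n + 2. T y s)
        = (- 1 / 2) *\<^sub>C (\<Sum>s<Suc (Suc n). (of_nat (Suc n) - 2 * of_nat s) *\<^sub>C T y s)" for y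
    proof -
      \<comment> \<open>The weights s + 1 for s = 0, ..., n + 1 have mean (n + 3)/2, and this is
        where the value -1/2 of the level is used.\<close>
      have "(of_nat (Suc s) + of_nat (n + 3) * critical_level) = (- 1 / 2) * (of_nat (Suc n) - 2 * of_nat s)" for s
        by (simp add: critical_level_def field_simps)
      then show ?thesis
        by (simp only: cvec.scale_sum_right scaleC_scaleC flip: sum.distrib scaleC_add_left) simp
    qed
    then show ?thesis
      unfolding kill
      by (simp only: cvec.scale_sum_right[of _ _ I] cvec.scale_left_commute[of _ "c _"]
          flip: sum.distrib scaleC_add_right)
  qed
  also have "\<dots> = (\<Sum>y\<in>I. c y *\<^sub>C ((- 1 / 2) *\<^sub>C (\<Sum>s<Suc n. of_nat (Suc s * (Suc n - s)) *\<^sub>C (T y s - T y (Suc s)))))"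
    by (simp only: sum_by_parts)
  also have "\<dots> = (- 1 / 2) *\<^sub>C (\<Sum>s<Suc n. of_nat (Suc s * (Suc n - s)) *\<^sub>C (\<Sum>y\<in>I. c y *\<^sub>C (T y s - T y (Suc s))))"
    unfolding cvec.scale_sum_right scaleC_scaleC by (subst sum.swap) (simp add: mult_ac)
  also have "(\<Sum>s<Suc n. of_nat (Suc s * (Suc n - s)) *\<^sub>C (\<Sum>y\<in>I. c y *\<^sub>C (T y s - T y (Suc s))))
      = (\<Sum>s<Suc n. of_nat (Suc s * (Suc n - s)) *\<^sub>C (\<Sum>y\<in>I. c y *\<^sub>C
        (Y y ^ s * mode (- 2) (bracket (bracket (bracket x y) y) y) * Y y ^ (n - s))))"
  proof (intro sum.cong refl arg_cong2[where f = scaleC])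
    fix s y assume "s \<in> {..<Suc n}"
    then have "Suc n - s = Suc (n - s)" by auto
    then have "T y s - T y (Suc s) = Y y ^ s * (W y * Y y - Y y * W y) * Y y ^ (n - s)"
      by (simp add: T_def left_diff_distrib right_diff_distrib power_Suc2[of _ s] mult.assoc del: power_Suc)
         (simp add: mult.assoc)
    also have "W y * Y y - Y y * W y = mode (- 2) (bracket (bracket (bracket x y) y) y)"
      using mode_commute[of "- 1" "bracket (bracket x y) y" "- 1" y] by (simp add: W_def Y_def)
    finally show "T y s - T y (Suc s)
        = Y y ^ s * mode (- 2) (bracket (bracket (bracket x y) y) y) * Y y ^ (n - s)" .
  qed
  finally show ?thesis by (simp add: Y_def)
qed

section \<open>Detecting the leading term\<close>

text \<open>A matrix coefficient of ad(z). The coordinates of the big cell see z only through these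
  numbers.\<close>

definition entry :: "'g \<times> 'g \<Rightarrow> 'g::fd_lie_algebra \<Rightarrow> complex"
  where "entry q z = cvec.representation chosen_basis (bracket z (snd q)) (fst q)"

lemma clinear_entry: "clinear (entry q)"
  by (rule clinearI) (simp_all add: entry_def bracket_add_left bracket_scaleC_left representation_linear)

text \<open>The higher Leibniz rule, in which v is differentiated at most once because its
  derivative is constant.\<close>

lemma derivation_iterate_mult:
  fixes d :: "'a::complex_algebra_1 \<Rightarrow> 'a"
  assumes lin: "clinear d" and mult: "\<And>p q. d (p * q) = d p * q + p * d q" and v: "d v = a *\<^sub>C 1"
  shows "(d ^^ Suc n) (v * g) = v * (d ^^ Suc n) g + (of_nat (Suc n) * a) *\<^sub>C (d ^^ n) g"
proof (induction n)
  case (Suc n)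
  have "(d ^^ Suc (Suc n)) (v * g) = d (v * (d ^^ Suc n) g + (of_nat (Suc n) * a) *\<^sub>C (d ^^ n) g)"
    by (simp only: funpow.simps(2)[of "Suc n"] comp_apply Suc)
  also have "\<dots> = v * (d ^^ Suc (Suc n)) g + (a *\<^sub>C (d ^^ Suc n) g + (of_nat (Suc n) * a) *\<^sub>C (d ^^ Suc n) g)"
    by (simp add: mult v clinear_add[OF lin] clinear_scale[OF lin] del: of_nat_Suc)
  also have "a *\<^sub>C (d ^^ Suc n) g + (of_nat (Suc n) * a) *\<^sub>C (d ^^ Suc n) g
      = (of_nat (Suc (Suc n)) * a) *\<^sub>C (d ^^ Suc n) g"
    unfolding scaleC_add_left[symmetric]
    by (rule arg_cong[of _ _ "\<lambda>a. a *\<^sub>C (d ^^ Suc n) g"]) (simp add: algebra_simps)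
  finally show ?case .
qed (simp add: mult v)

lemma derivation_iterate_prod_list:
  fixes d :: "'a::complex_algebra_1 \<Rightarrow> 'a"
  assumes lin: "clinear d" and mult: "\<And>p q. d (p * q) = d p * q + p * d q"
    and v: "\<And>q. q \<in> set qs \<Longrightarrow> d (v q) = a q *\<^sub>C 1"
  shows "(d ^^ length qs) (prod_list (map v qs)) = (fact (length qs) * prod_list (map a qs)) *\<^sub>C 1"
  using v
proof (induction qs)
  case (Cons q qs)
  have "d 1 = 0" using mult[of 1 1] by simp
  then show ?case
    using Cons
    by (simp only: list.size(4) add_0 add_Suc_right list.map prod_list.Cons add.right_neutral
        derivation_iterate_mult[OF lin mult Cons.prems[of q]] list.set_intros)
       (simp add: clinear_scale[OF lin] mult_ac)
qed simp

text \<open>The coordinate with row in degree k and column in degree 0. Since z[k] maps degree 0 to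
  degree k, this variable responds to modes of index k only.\<close>

definition zvar :: "int \<Rightarrow> 'g \<times> 'g \<Rightarrow> (int \<times> 'g::fd_lie_algebra) cell_fun"
  where "zvar k q = loop.Z (k, fst q) (0, snd q)"

lemma zvar_aug: "zvar k q \<in> aug 1"
  by (simp add: zvar_def loop.Z_def aug_word aug_zero)

lemma prod_list_zvar_aug: "prod_list (map (zvar k) qs) \<in> aug (length qs)"
proof (induction qs)
  case (Cons q qs)
  from aug_mult[OF zvar_aug[of k q] this] show ?case by simp
qed (simp add: aug_0)

abbreviation mode_der :: "int \<Rightarrow> 'g::fd_lie_algebra \<Rightarrow> (int \<times> 'g) cell_fun \<Rightarrow> (int \<times> 'g) cell_fun"
  where "mode_der k z \<equiv> loop.cder (loop_mat (Poly_Mapping.single k z))"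

lemma mode_der_zvar:
  assumes "l < 0" "q \<in> chosen_basis \<times> chosen_basis"
  shows "mode_der k z (zvar l q) = (if k = l then entry q z else 0) *\<^sub>C 1"
  using assms
  by (auto simp: zvar_def loop.cder_Z loop_mat_def Poly_Mapping.lookup_single when_def entry_def representation_linear
      mem_Times_iff)

lemma (in polarization) cder_commute: "cder x (cder y p) = cder y (cder x p)"
proof -
  have "cder x (cder y p) - cder y (cder x p) = 0"
  proof (rule cell_derivation_eqI[where d = "\<lambda>p. cder x (cder y p) - cder y (cder x p)" and d' = "\<lambda>_. 0"])
    show "clinear (\<lambda>p. cder x (cder y p) - cder y (cder x p))"
      by (rule clinearI) (simp_all add: clinear_add[OF clinear_cder] clinear_scale[OF clinear_cder]
          cvec.scale_right_diff_distrib)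
    show "clinear (\<lambda>_ :: 'j cell_fun. 0 :: 'j cell_fun)" by (rule clinearI) simp_all
    have "cder x (sym_word [Poly_Mapping.single (j, i) 1]) = (if j \<notin> P \<and> i \<in> P then x j i else 0) *\<^sub>C 1" for x j i
      unfolding cder_def by (simp add: sym_der_gen[OF clinear_lin_ext])
    then show "cder x (cder y (sym_word [Poly_Mapping.single (j, i) 1]))
        - cder y (cder x (sym_word [Poly_Mapping.single (j, i) 1])) = 0" for j i
      by (simp add: clinear_scale[OF clinear_cder] cder_1)
  qed (simp_all add: cder_mult clinear_add[OF clinear_cder] algebra_simps)
  then show ?thesis by simp
qed

text \<open>The degree of h equals the number of letters, so only constant fields count, and these
  commute. The field of z[-2] can differentiate only the factor \<open>zvar (- 2) q\<close>, those
  of y[-1] only the others; hence the value does not depend on s.\<close>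

lemma cell_functional_mode_word:
  fixes y z :: "'g::fd_lie_algebra"
  assumes q: "q \<in> chosen_basis \<times> chosen_basis" and qs: "set qs \<subseteq> chosen_basis \<times> chosen_basis"
    and len: "length qs = s + r"
  defines "h \<equiv> zvar (- 2) q * prod_list (map (zvar (- 1)) qs)"
  shows "uea_lift (cell_functional h) (mode (- 1) y ^ s * mode (- 2) z * mode (- 1) y ^ r)
    = fact (length qs) * (entry q z * prod_list (map (\<lambda>q. entry q y) qs))"
proof -
  let ?Y = "Affine (Poly_Mapping.single (- 1) y) 0" and ?X = "Affine (Poly_Mapping.single (- 2) z) 0"
  let ?w = "replicate s ?Y @ ?X # replicate r ?Y" and ?zs = "prod_list (map (zvar (- 1)) qs)"
  let ?d = "mode_der (- 1) y" and ?e = "mode_der (- 2) z"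
  have d0: "?d (zvar (- 2) q) = 0" using mode_der_zvar[of "- 2" q "- 1" y] q by simp
  have e0: "?e (zvar (- 1) p) = 0" if "p \<in> set qs" for p
    using mode_der_zvar[of "- 1" p "- 2" z] qs that by auto
  have e_zs: "?e ?zs = 0"
    using e0 by (induction qs) (simp_all add: loop.cder_1 loop.cder_mult)
  have e_d: "?e ((?d ^^ s) ?zs) = 0"
  proof -
    have "?e ((?d ^^ s) g) = (?d ^^ s) (?e g)" for g
      by (induction s) (simp_all add: loop.cder_commute[of "loop_mat (Poly_Mapping.single (- 2) z)"])
    moreover have "(?d ^^ s) 0 = 0" by (induction s) (simp_all add: clinear_0[OF loop.clinear_cder])
    ultimately show ?thesis by (simp add: e_zs)
  qed
  have d_h: "(?d ^^ s) h = zvar (- 2) q * (?d ^^ s) ?zs"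
    unfolding h_def by (induction s) (simp_all add: loop.cder_mult d0)
  have scale: "(?d ^^ r) (c *\<^sub>C g) = c *\<^sub>C (?d ^^ r) g" for c g
    by (induction r) (simp_all add: clinear_scale[OF loop.clinear_cder])
  have "mode (- 1) y ^ s * mode (- 2) z * mode (- 1) y ^ r = uea_word ?w"
    by (simp add: mode_def uea_word_append uea_word_Cons[of ?X "replicate r ?Y"] uea_word_replicate mult.assoc)
  then have "uea_lift (cell_functional h) (mode (- 1) y ^ s * mode (- 2) z * mode (- 1) y ^ r) = cell_functional h ?w"
    by (simp add: uea_lift_word[OF uea_word_linear_cell_functional])
  also have "\<dots> = ev (fold (\<lambda>a. loop.cder (loop_mat (loop_part a))) ?w h)"
  proof (rule cell_functional_lowest)
    have "h \<in> aug (1 + length qs)" unfolding h_def by (rule aug_mult[OF zvar_aug prod_list_zvar_aug])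
    then show "h \<in> aug (length ?w)" by (simp add: len)
  qed
  also have "fold (\<lambda>a. loop.cder (loop_mat (loop_part a))) ?w h = (?d ^^ r) (?e ((?d ^^ s) h))"
    by (simp add: fold_replicate)
  also have "?e ((?d ^^ s) h) = entry q z *\<^sub>C (?d ^^ s) ?zs"
    unfolding d_h loop.cder_mult e_d using mode_der_zvar[of "- 2" q "- 2" z] q by simp
  also have "(?d ^^ r) \<dots> = entry q z *\<^sub>C (?d ^^ length qs) ?zs"
    unfolding scale len by (simp add: funpow_add add.commute)
  also have "(?d ^^ length qs) ?zs = (fact (length qs) * prod_list (map (\<lambda>q. entry q y) qs)) *\<^sub>C 1"
    by (rule derivation_iterate_prod_list[OF loop.clinear_cder loop.cder_mult])
       (use mode_der_zvar[of "- 1" _ "- 1" y] qs in auto)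
  finally show ?thesis by (simp add: clinear_scale[OF clinear_ev] mult_ac)
qed

text \<open>All positions s give the same value, so the functional returns that value times the sum
  of the positive integers (s + 1)(n + 1 - s), which can be cancelled.\<close>

lemma leading_coefficients_eq_0:
  fixes w :: "'g::fd_lie_algebra \<Rightarrow> 'g"
  assumes vac: "(\<Sum>s<Suc n. of_nat (Suc s * (Suc n - s)) *\<^sub>C (\<Sum>y\<in>I. c y *\<^sub>C
      (mode (- 1) y ^ s * mode (- 2) (w y) * mode (- 1) y ^ (n - s)))) \<approx> 0"
    and q: "q \<in> chosen_basis \<times> chosen_basis" and qs: "set qs \<subseteq> chosen_basis \<times> chosen_basis" "length qs = n"
  shows "(\<Sum>y\<in>I. c y * (entry q (w y) * prod_list (map (\<lambda>q. entry q y) qs))) = 0"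
proof -
  define h where "h = zvar (- 2) q * prod_list (map (zvar (- 1)) qs)"
  let ?f = "uea_lift (cell_functional h)" and ?S = "\<Sum>y\<in>I. c y * (entry q (w y) * prod_list (map (\<lambda>q. entry q y) qs))"
  note lin = clinear_uea_lift[OF uea_word_linear_cell_functional[of h]]
  have val: "?f (mode (- 1) y ^ s * mode (- 2) (w y) * mode (- 1) y ^ (n - s))
      = fact n * (entry q (w y) * prod_list (map (\<lambda>q. entry q y) qs))" if "s < Suc n" for y s
    using cell_functional_mode_word[of q qs s "n - s" y "w y"] q qs that by (simp add: h_def)
  have "0 = ?f (\<Sum>s<Suc n. of_nat (Suc s * (Suc n - s)) *\<^sub>C (\<Sum>y\<in>I. c y *\<^sub>C
      (mode (- 1) y ^ s * mode (- 2) (w y) * mode (- 1) y ^ (n - s))))"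
    using cell_functional_vacuum_rels[of _ h] vac by (simp add: vac_eq_def)
  also have "\<dots> = (\<Sum>s<Suc n. of_nat (Suc s * (Suc n - s)) * (\<Sum>y\<in>I. c y *
      ?f (mode (- 1) y ^ s * mode (- 2) (w y) * mode (- 1) y ^ (n - s))))"
    by (simp only: clinear_sum[OF lin] clinear_scale[OF lin] scaleC_complex_def)
  also have "\<dots> = (\<Sum>s<Suc n. of_nat (Suc s * (Suc n - s)) * (fact n * ?S))"
    by (intro sum.cong refl arg_cong2[where f = times])
       (simp only: lessThan_iff val sum_distrib_left mult.left_commute[of _ "fact n"])
  also have "\<dots> = of_nat (\<Sum>s<Suc n. Suc s * (Suc n - s)) * (fact n * ?S)"
    by (simp only: of_nat_sum sum_distrib_right)
  finally have "(of_nat (\<Sum>s<Suc n. Suc s * (Suc n - s)) :: complex) * (fact n * ?S) = 0" by simp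
  moreover have "(\<Sum>s<Suc n. Suc s * (Suc n - s)) \<noteq> 0" by simp
  ultimately show ?thesis by (simp only: mult_eq_0_iff of_nat_eq_0_iff fact_nonzero simp_thms)
qed

section \<open>The map m on powers\<close>

text \<open>The universal property of the tensor product, evaluated on a chosen representative; the
  choice is immaterial once \<beta> is bilinear.\<close>

definition tensor_prod_lift ::
    "('a::complex_vector \<Rightarrow> 'b::complex_vector \<Rightarrow> 'c::complex_vector) \<Rightarrow> ('a, 'b) tensor_prod \<Rightarrow> 'c"
  where "tensor_prod_lift \<beta> t = lin_ext (\<lambda>(a, b). \<beta> a b) (rep_tensor_prod t)"

context
  fixes \<beta> :: "'a::complex_vector \<Rightarrow> 'b::complex_vector \<Rightarrow> 'c::complex_vector"
  assumes \<beta>: "\<And>b. clinear (\<lambda>a. \<beta> a b)" "\<And>a. clinear (\<beta> a)"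
begin

lemma tensor_prod_lift_abs: "tensor_prod_lift \<beta> (abs_tensor_prod p) = lin_ext (\<lambda>(a, b). \<beta> a b) p"
proof -
  let ?f = "lin_ext (\<lambda>(a, b). \<beta> a b)"
  note lin = clinear_lin_ext[of "\<lambda>(a, b). \<beta> a b"]
  have "r = 0 \<or> ?f r = 0" if "r \<in> bilinear_rels" for r
    using that clinear_add[OF \<beta>(1)] clinear_scale[OF \<beta>(1)] clinear_add[OF \<beta>(2)] clinear_scale[OF \<beta>(2)]
    by (auto simp: bilinear_rels_def clinear_diff[OF lin])
  moreover have "cvec.subspace {r. ?f r = 0}"
    by (simp add: cvec.subspace_def clinear_0[OF lin] clinear_add[OF lin] clinear_scale[OF lin])
  ultimately have "?f r = 0" if "r \<in> cvec.span bilinear_rels" for r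
    using cvec.span_minimal[of bilinear_rels "{r. ?f r = 0}"] that clinear_0[OF lin] by blast
  moreover have "rep_tensor_prod (abs_tensor_prod p) - p \<in> cvec.span bilinear_rels"
    by (rule Quotient3_rep_abs[OF Quotient3_tensor_prod]) (simp add: cvec.span_zero)
  ultimately show ?thesis
    by (metis clinear_diff[OF lin] eq_iff_diff_eq_0 tensor_prod_lift_def)
qed

lemma tensor_prod_lift_tensor: "tensor_prod_lift \<beta> (a \<otimes>\<^sub>C b) = \<beta> a b"
  by (simp add: tensor.abs_eq tensor_prod_lift_abs)

lemma clinear_tensor_prod_lift: "clinear (tensor_prod_lift \<beta>)"
proof (rule clinearI)
  fix x y :: "('a, 'b) tensor_prod" and c :: complex
  note lin = clinear_lin_ext[of "\<lambda>(a, b). \<beta> a b"]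
  show "tensor_prod_lift \<beta> (x + y) = tensor_prod_lift \<beta> x + tensor_prod_lift \<beta> y"
    by (induction x; induction y) (simp add: plus_tensor_prod.abs_eq tensor_prod_lift_abs clinear_add[OF lin])
  show "tensor_prod_lift \<beta> (c *\<^sub>C x) = c *\<^sub>C tensor_prod_lift \<beta> x"
    by (induction x) (simp add: scaleC_tensor_prod.abs_eq tensor_prod_lift_abs clinear_scale[OF lin])
qed

end

section \<open>The value of m on powers and the consequences of its vanishing\<close>

definition ad_cubed :: "'g::lie_algebra \<Rightarrow> 'g gl"
  where "ad_cubed y = gl_comp (ad y) (gl_comp (ad y) (ad y))"

lemma Rep_ad_cubed: "Rep_gl (ad_cubed y) x = - bracket (bracket (bracket x y) y) y"
proof -
  have "Rep_gl (ad_cubed y) x = bracket y (bracket y (bracket y x))"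
    by (simp add: ad_cubed_def gl_comp.rep_eq ad.rep_eq)
  also have "\<dots> = - bracket (bracket (bracket x y) y) y"
    by (simp add: bracket_antisym[of y] bracket_minus_left bracket_minus_right)
  finally show ?thesis .
qed

lemma tensor_word_Cons: "tensor_word (x # w) = tensor_word [x] * tensor_word w"
  by (simp flip: tensor_word_append)

lemma m_map_power: "m_map (sym_word [y] ^ (n + 3)) = ad_cubed y \<otimes>\<^sub>C tensor_word (replicate n y)"
proof -
  have "m_map (sym_word [y] ^ (n + 3)) = m_word (replicate (n + 3) y)"
    by (simp only: sym_word_replicate[symmetric] m_map_word average_replicate)
  also have "replicate (n + 3) y = y # y # y # replicate n y" by (simp add: numeral_3_eq_3)
  finally show ?thesis by (simp add: ad_cubed_def)
qed

text \<open>A given letter falls either among the first a or among the rest, so exactly one of the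
  two factors depends on it.\<close>

lemma word_linear_split:
  fixes x :: "'a::complex_algebra_1"
  assumes f: "word_linear f" and g: "word_linear g"
  shows "word_linear (\<lambda>w. f (take a w) * x * g (drop a w))"
proof -
  have 1: "take a (u @ z # v) = take a u" "drop a (u @ z # v) = drop a u @ z # v" if "a \<le> length u" for u v and z :: 'b
    using that by simp_all
  have 2: "take a (u @ z # v) = u @ z # take (a - Suc (length u)) v"
    "drop a (u @ z # v) = drop (a - Suc (length u)) v" if "\<not> a \<le> length u" for u v and z :: 'b
  proof -
    have "a - length u = Suc (a - Suc (length u))" using that by simp
    then show "take a (u @ z # v) = u @ z # take (a - Suc (length u)) v"
      "drop a (u @ z # v) = drop (a - Suc (length u)) v" using that by simp_all
  qed
  show ?thesis
    unfolding word_linear_def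
  proof (intro conjI allI)
    fix u v y z and c :: complex
    show "f (take a (u @ (y + z) # v)) * x * g (drop a (u @ (y + z) # v))
        = f (take a (u @ y # v)) * x * g (drop a (u @ y # v)) + f (take a (u @ z # v)) * x * g (drop a (u @ z # v))"
      by (cases "a \<le> length u"; simp only: 1 2 word_linearD[OF f] word_linearD[OF g] not_False_eq_True)
         (simp_all add: algebra_simps)
    show "f (take a (u @ (c *\<^sub>C y) # v)) * x * g (drop a (u @ (c *\<^sub>C y) # v))
        = c *\<^sub>C (f (take a (u @ y # v)) * x * g (drop a (u @ y # v)))"
      by (cases "a \<le> length u"; simp only: 1 2 word_linearD[OF f] word_linearD[OF g] not_False_eq_True) simp_all
  qed
qed

lemma word_linear_mode: "word_linear (\<lambda>w :: 'g::fd_lie_algebra list. uea_word (map (\<lambda>y. Affine (Poly_Mapping.single (- 1) y) 0) w))"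
proof -
  let ?i = "\<lambda>y :: 'g. Affine (Poly_Mapping.single (- 1 :: int) y) 0"
  have 1: "?i (x + y) = ?i x + ?i y" for x y by (simp add: plus_affine_def Poly_Mapping.single_add)
  have 2: "?i (c *\<^sub>C x) = c *\<^sub>C ?i x" for c x by (simp add: scaleC_affine_def)
  show ?thesis
    using uea_word_linear[where 'a = "'g affine"]
    unfolding uea_word_linear_def word_linear_def map_append list.map 1 2 by blast
qed

text \<open>For fixed x, k and a, inserting (f x)[k] after the first a letters of a word is a linear
  map on gl(g) \<otimes> T(g), and it sends m(y^(n+3)) to minus the term in question. Since the
  target of m keeps words as tensors, the position a makes sense.\<close>

lemma mode_terms_eq_0_if_m_map_eq_0:
  fixes x :: "'g::fd_lie_algebra"
  assumes m: "(\<Sum>y\<in>I. c y *\<^sub>C m_map (sym_word [y] ^ (n + 3))) = 0" and ab: "a + b = n"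
  shows "(\<Sum>y\<in>I. c y *\<^sub>C (mode (- 1) y ^ a * mode k (bracket (bracket (bracket x y) y) y) * mode (- 1) y ^ b)) = 0"
proof -
  define wd where "wd = (\<lambda>w. uea_word (map (\<lambda>y :: 'g. Affine (Poly_Mapping.single (- 1) y) 0) w))"
  define g where "g f = (\<lambda>w. wd (take a w) * mode k (Rep_gl f x) * wd (drop a w))" for f
  define \<beta> where "\<beta> f t = tensor_lift (g f) t" for f t
  have g: "word_linear (g f)" for f
    unfolding g_def wd_def by (rule word_linear_split[OF word_linear_mode word_linear_mode])
  \<comment> \<open>Linearity in f holds word by word on the fixed representative of t.\<close>
  have "clinear (\<lambda>f. \<beta> f t)" for t
    by (rule clinearI)
       (simp_all add: \<beta>_def tensor_lift_def lin_ext_def g_def plus_gl.rep_eq scaleC_gl.rep_eq mode_linear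
         distrib_left distrib_right scaleC_add_right sum.distrib cvec.scale_sum_right mult.commute)
  moreover have "clinear (\<beta> f)" for f unfolding \<beta>_def by (rule clinear_tensor_lift[OF g])
  ultimately have lin: "clinear (tensor_prod_lift \<beta>)"
    and val: "tensor_prod_lift \<beta> (f \<otimes>\<^sub>C t) = \<beta> f t" for f t
    by (auto intro: clinear_tensor_prod_lift tensor_prod_lift_tensor)
  have "0 = tensor_prod_lift \<beta> (\<Sum>y\<in>I. c y *\<^sub>C m_map (sym_word [y] ^ (n + 3)))"
    unfolding m by (rule clinear_0[OF lin, symmetric])
  also have "\<dots> = (\<Sum>y\<in>I. c y *\<^sub>C g (ad_cubed y) (replicate n y))"
    by (simp add: clinear_sum[OF lin] clinear_scale[OF lin] m_map_power val \<beta>_def tensor_lift_word[OF g])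
  also have "\<dots> = (\<Sum>y\<in>I. c y *\<^sub>C - (mode (- 1) y ^ a * mode k (bracket (bracket (bracket x y) y) y) * mode (- 1) y ^ b))"
  proof -
    have "wd (replicate j y) = mode (- 1) y ^ j" for j y by (simp add: wd_def mode_def uea_word_replicate)
    moreover have "mode k (- z) = - mode k z" for z :: 'g using mode_linear(2)[of k "- 1" z] by simp
    ultimately show ?thesis using ab by (intro sum.cong refl) (auto simp: g_def Rep_ad_cubed)
  qed
  finally show ?thesis by (simp add: sum_negf)
qed


section \<open>Faithfulness of the adjoint representation\<close>

lemma solvable_centre: "solvable {z :: 'g::fd_lie_algebra. \<forall>x. bracket z x = 0}"
proof -
  have "derived {z :: 'g. \<forall>x. bracket z x = 0} = {0}"
  proof -
    have "{bracket x y |x y. x \<in> {z :: 'g. \<forall>x. bracket z x = 0} \<and> y \<in> {z. \<forall>x. bracket z x = 0}} \<subseteq> {0}"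
      by auto
    then show ?thesis
      unfolding derived_def using cvec.span_minimal[OF _ cvec.subspace_single_0] cvec.span_zero by blast
  qed
  then show ?thesis unfolding solvable_def by (intro exI[of _ 1]) simp
qed

lemma semisimple_centre_trivial:
  assumes "semisimple TYPE('g::fd_lie_algebra)" "\<And>x. bracket z x = 0"
  shows "z = (0 :: 'g::fd_lie_algebra)"
proof -
  have "lie_ideal {z :: 'g. \<forall>x. bracket z x = 0}"
    unfolding lie_ideal_def cvec.subspace_def
    by (auto simp: bracket_add_left bracket_scaleC_left bracket_bracket)
  then have "{z :: 'g. \<forall>x. bracket z x = 0} = {0}"
    using assms(1) solvable_centre unfolding semisimple_def by blast
  with assms(2) show ?thesis by blast
qed

text \<open>Trivial centre makes the map \<iota> from z to the matrix of ad(z) injective. A linear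
  left inverse recovers z from its matrix coefficients, with the images of the matrix units as the
  vectors l.\<close>

lemma semisimple_entry_expansion:
  assumes "semisimple TYPE('g::fd_lie_algebra)"
  obtains l :: "'g \<times> 'g \<Rightarrow> 'g::fd_lie_algebra"
  where "\<And>z. z = (\<Sum>q\<in>chosen_basis \<times> chosen_basis. entry q z *\<^sub>C l q)"
proof -
  let ?P = "chosen_basis \<times> chosen_basis :: ('g \<times> 'g) set"
  define \<iota> where "\<iota> z = (\<Sum>q\<in>?P. entry q z *\<^sub>C Poly_Mapping.single q (1 :: complex))" for z
  have lin: "clinear \<iota>"
    by (rule clinearI)
       (simp_all only: \<iota>_def clinear_add[OF clinear_entry] clinear_scale[OF clinear_entry] scaleC_add_left
         sum.distrib cvec.scale_sum_right scaleC_scaleC scaleC_complex_def)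
  have coeff: "Poly_Mapping.lookup (\<iota> z) q = entry q z" if "q \<in> ?P" for q z
    using that by (simp add: \<iota>_def Poly_Mapping.lookup_sum Poly_Mapping.lookup_single when_def chosen_basis
        if_distrib[of "times _"] sum.delta cong: if_cong)
  have "z = 0" if "\<iota> z = 0" for z
  proof (rule semisimple_centre_trivial[OF assms])
    fix x
    have entry0: "cvec.representation chosen_basis (bracket z b) c = 0" if "b \<in> chosen_basis" "c \<in> chosen_basis" for b c
      using coeff[of "(c, b)" z] that \<open>\<iota> z = 0\<close> by (simp add: entry_def)
    have basis: "bracket z b = 0" if "b \<in> chosen_basis" for b
      using basis_expansion[of "bracket z b"] entry0[OF that] by simp
    have "bracket z (\<Sum>b\<in>chosen_basis. cvec.representation chosen_basis x b *\<^sub>C b) = 0"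
      by (simp add: clinear_sum[OF clinear_bracket] bracket_scaleC_right basis)
    then show "bracket z x = 0" by (simp only: basis_expansion)
  qed
  then have "inj \<iota>"
    by (metis clinear_diff[OF lin] eq_iff_diff_eq_0 injI)
  interpret vsp: vector_space_pair "scaleC :: complex \<Rightarrow> 'g \<Rightarrow> 'g"
    "scaleC :: complex \<Rightarrow> (('g \<times> 'g) \<Rightarrow>\<^sub>0 complex) \<Rightarrow> _"
    by unfold_locales
  obtain L where L: "clinear L" "L \<circ> \<iota> = id"
    using vsp.linear_injective_left_inverse[OF lin \<open>inj \<iota>\<close>] by blast
  have "z = (\<Sum>q\<in>?P. entry q z *\<^sub>C L (Poly_Mapping.single q 1))" for z
    using fun_cong[OF L(2), of z] by (simp only: \<iota>_def comp_apply id_apply clinear_sum[OF L(1)] clinear_scale[OF L(1)])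
  then show ?thesis by (rule that[of "\<lambda>q. L (Poly_Mapping.single q 1)"])
qed

lemma clinear_tensor: "clinear (\<lambda>a. a \<otimes>\<^sub>C b)" "clinear (\<lambda>b. a \<otimes>\<^sub>C b)"
  by (rule clinearI; simp add: tensor_bilinear)+

lemma clinear_tensor_word_1: "clinear (\<lambda>x. tensor_word [x])"
  using word_linearD[OF tensor_word_linear, of "[]" _ _ "[]"] by (intro clinearI) simp_all

lemma tensor_word_replicate_expansion:
  assumes "finite A" and y: "y = (\<Sum>q\<in>A. a q *\<^sub>C l q)"
  shows "tensor_word (replicate n y)
    = (\<Sum>qs | set qs \<subseteq> A \<and> length qs = n. prod_list (map a qs) *\<^sub>C tensor_word (map l qs))"
proof (induction n)
  case (Suc n)
  let ?L = "\<lambda>n. {qs. set qs \<subseteq> A \<and> length qs = n}"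
  have y1: "tensor_word [y] = (\<Sum>q\<in>A. a q *\<^sub>C tensor_word [l q])"
    by (subst y) (simp only: clinear_sum[OF clinear_tensor_word_1] clinear_scale[OF clinear_tensor_word_1])
  have "tensor_word (replicate (Suc n) y) = tensor_word [y] * tensor_word (replicate n y)"
    by (simp add: tensor_word_Cons[of y "replicate n y"])
  also have "\<dots> = (\<Sum>qs\<in>?L n. \<Sum>q\<in>A. prod_list (map a (q # qs)) *\<^sub>C tensor_word (map l (q # qs)))"
    unfolding Suc y1 sum_distrib_left sum_distrib_right
    by (simp add: tensor_word_Cons[of "l _" "map l _"] mult.commute)
  also have "\<dots> = (\<Sum>(qs, q)\<in>?L n \<times> A. prod_list (map a (q # qs)) *\<^sub>C tensor_word (map l (q # qs)))"
    by (rule sum.cartesian_product)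
  also have "\<dots> = (\<Sum>qs\<in>?L (Suc n). prod_list (map a qs) *\<^sub>C tensor_word (map l qs))"
    unfolding lists_length_Suc_eq
    by (subst sum.reindex) (auto simp: inj_on_def case_prod_unfold)
  finally show ?case .
qed (simp add: Collect_conv_if cong: conj_cong)

text \<open>Expanding ad(y)^3 in the rank-one operators E and y^n in words in the vectors l gives,
  as coefficients of m, up to sign, the sums assumed to vanish, with x running through the
  basis.\<close>

lemma m_map_eq_0_if_coefficients_eq_0:
  assumes ss: "semisimple TYPE('g::fd_lie_algebra)"
    and coeff: "\<And>x q qs. q \<in> chosen_basis \<times> chosen_basis \<Longrightarrow> set qs \<subseteq> chosen_basis \<times> chosen_basis \<Longrightarrow>
      length qs = n \<Longrightarrow>
      (\<Sum>y\<in>I. c y * (entry q (bracket (bracket (bracket x y) y) y) * prod_list (map (\<lambda>q. entry q y) qs))) = 0"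
  shows "(\<Sum>y\<in>I. c y *\<^sub>C m_map (sym_word [y :: 'g::fd_lie_algebra] ^ (n + 3))) = 0"
proof -
  obtain l :: "'g \<times> 'g \<Rightarrow> 'g" where l: "\<And>z. z = (\<Sum>q\<in>chosen_basis \<times> chosen_basis. entry q z *\<^sub>C l q)"
    using semisimple_entry_expansion[OF ss] by blast
  let ?B = "chosen_basis :: 'g set" and ?P = "chosen_basis \<times> chosen_basis :: ('g \<times> 'g) set"
  let ?L = "{qs. set qs \<subseteq> ?P \<and> length qs = n}"
  define w where "w x y = bracket (bracket (bracket x y) y) y" for x y :: 'g
  define E where "E b q = Abs_gl (\<lambda>x. cvec.representation ?B x b *\<^sub>C l q)" for b q
  have E: "Rep_gl (E b q) x = cvec.representation ?B x b *\<^sub>C l q" for b q x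
  proof -
    have "clinear (\<lambda>x. cvec.representation ?B x b *\<^sub>C l q)"
      by (rule clinear_compose[OF clinear_scaleC(2) clinear_representation])
    then show ?thesis by (simp add: E_def Abs_gl_inverse)
  qed
  have Rep_sum: "Rep_gl (sum f A) x = (\<Sum>a\<in>A. Rep_gl (f a) x)" for f :: "'i \<Rightarrow> 'g gl" and A x
    by (induction A rule: infinite_finite_induct) (simp_all add: zero_gl.rep_eq plus_gl.rep_eq)
  have ad3: "ad_cubed y = (\<Sum>b\<in>?B. \<Sum>q\<in>?P. (- entry q (w b y)) *\<^sub>C E b q)" for y
  proof -
    have "Rep_gl (ad_cubed y) x = Rep_gl (\<Sum>b\<in>?B. \<Sum>q\<in>?P. (- entry q (w b y)) *\<^sub>C E b q) x" for x
    proof -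
      have lin: "clinear (Rep_gl (ad_cubed y))" using Rep_gl[of "ad_cubed y"] by simp
      have "Rep_gl (ad_cubed y) x = Rep_gl (ad_cubed y) (\<Sum>b\<in>?B. cvec.representation ?B x b *\<^sub>C b)"
        by (simp only: basis_expansion)
      also have "\<dots> = (\<Sum>b\<in>?B. cvec.representation ?B x b *\<^sub>C (- w b y))"
        by (simp only: clinear_sum[OF lin] clinear_scale[OF lin]) (simp only: Rep_ad_cubed w_def)
      also have "\<dots> = (\<Sum>b\<in>?B. cvec.representation ?B x b *\<^sub>C (- (\<Sum>q\<in>?P. entry q (w b y) *\<^sub>C l q)))"
        by (simp only: l[symmetric])
      also have "\<dots> = Rep_gl (\<Sum>b\<in>?B. \<Sum>q\<in>?P. (- entry q (w b y)) *\<^sub>C E b q) x"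
        by (simp add: Rep_sum scaleC_gl.rep_eq uminus_gl.rep_eq E cvec.scale_sum_right sum_negf mult.commute)
      finally show ?thesis .
    qed
    then have "Rep_gl (ad_cubed y) = Rep_gl (\<Sum>b\<in>?B. \<Sum>q\<in>?P. (- entry q (w b y)) *\<^sub>C E b q)" by (rule ext)
    then show ?thesis by (simp only: Rep_gl_inject)
  qed
  have "(\<Sum>y\<in>I. c y *\<^sub>C m_map (sym_word [y] ^ (n + 3)))
      = (\<Sum>y\<in>I. \<Sum>b\<in>?B. \<Sum>q\<in>?P. \<Sum>qs\<in>?L. (- (c y * (entry q (w b y) * prod_list (map (\<lambda>q. entry q y) qs))))
        *\<^sub>C (E b q \<otimes>\<^sub>C tensor_word (map l qs)))"
  proof (rule sum.cong[OF refl])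
    fix y
    have tw: "tensor_word (replicate n y) = (\<Sum>qs\<in>?L. prod_list (map (\<lambda>q. entry q y) qs) *\<^sub>C tensor_word (map l qs))"
      by (rule tensor_word_replicate_expansion[OF _ l]) (simp add: chosen_basis)
    show "c y *\<^sub>C m_map (sym_word [y] ^ (n + 3)) = (\<Sum>b\<in>?B. \<Sum>q\<in>?P. \<Sum>qs\<in>?L.
        (- (c y * (entry q (w b y) * prod_list (map (\<lambda>q. entry q y) qs)))) *\<^sub>C (E b q \<otimes>\<^sub>C tensor_word (map l qs)))"
      unfolding m_map_power ad3 clinear_sum[OF clinear_tensor(1)]
      unfolding tw clinear_sum[OF clinear_tensor(2)] tensor_bilinear cvec.scale_sum_right scaleC_scaleC
      by (intro sum.cong refl arg_cong2[where f = scaleC]) simp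
  qed
  also have "\<dots> = (\<Sum>b\<in>?B. \<Sum>q\<in>?P. \<Sum>qs\<in>?L. \<Sum>y\<in>I. (- (c y * (entry q (w b y) * prod_list (map (\<lambda>q. entry q y) qs))))
        *\<^sub>C (E b q \<otimes>\<^sub>C tensor_word (map l qs)))"
    by (simp only: sum.swap[of _ _ I])
  also have "\<dots> = 0"
  proof (rule sum.neutral, rule ballI, rule sum.neutral, rule ballI, rule sum.neutral, rule ballI)
    fix b q qs assume "q \<in> ?P" "qs \<in> ?L"
    then have "(\<Sum>y\<in>I. c y * (entry q (w b y) * prod_list (map (\<lambda>q. entry q y) qs))) = 0"
      using coeff[of q qs b] by (simp add: w_def)
    then show "(\<Sum>y\<in>I. (- (c y * (entry q (w b y) * prod_list (map (\<lambda>q. entry q y) qs))))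
        *\<^sub>C (E b q \<otimes>\<^sub>C tensor_word (map l qs))) = 0"
      by (simp only: cvec.scale_sum_left[symmetric] sum_negf minus_zero cvec.scale_zero_left)
  qed
  finally show ?thesis .
qed

theorem theorem3p5:
  fixes F :: "'g::fd_lie_algebra sym_alg" and m :: nat
  assumes "semisimple TYPE('g)"
    and "m \<ge> 4"
    and "F \<in> sym_power m"
    and "F \<in> sym_invariants"
  shows "symmetrise (at_minus_one F) \<in> feigin_frenkel_centre \<longleftrightarrow> m_map F = 0"
proof -
  define n where "n = m - 3"
  with assms(2) have m: "m = n + 3" by simp
  have "F \<in> cvec.span (range (\<lambda>y. sym_word [y] ^ m))"
    using assms(3) sym_power_subset_span_powers by blast
  then obtain S r where S: "finite S" "S \<subseteq> range (\<lambda>y. sym_word [y] ^ m)" and F0: "F = (\<Sum>v\<in>S. r v *\<^sub>C v)"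
    unfolding cvec.span_explicit by blast
  \<comment> \<open>One y is chosen for each power occurring in F, so that the coefficients can be
    indexed by y.\<close>
  obtain I where "inj_on (\<lambda>y. sym_word [y] ^ m) I" and "S = (\<lambda>y. sym_word [y] ^ m) ` I"
    using S(2)[unfolded subset_image_inj] by (elim exE conjE)
  with F0 obtain c where F: "F = (\<Sum>y\<in>I. c y *\<^sub>C sym_word [y] ^ m)"
    by (simp add: sum.reindex)
  have sF: "symm_incl F = (\<Sum>y\<in>I. c y *\<^sub>C mode (- 1) y ^ m)"
    by (simp add: F clinear_sum[OF clinear_symm_incl] clinear_scale[OF clinear_symm_incl] symm_incl_power)
  have mF: "m_map F = (\<Sum>y\<in>I. c y *\<^sub>C m_map (sym_word [y] ^ (n + 3)))"
    by (simp add: F m clinear_sum[OF clinear_m_map] clinear_scale[OF clinear_m_map])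
  have inv: "(\<Sum>y\<in>I. c y *\<^sub>C (sym_word [bracket u y] * sym_word [y] ^ (n + 2))) = 0" for u
  proof -
    have "ad_sym u F = of_nat m *\<^sub>C (\<Sum>y\<in>I. c y *\<^sub>C (sym_word [bracket u y] * sym_word [y] ^ (m - 1)))"
      by (simp add: F clinear_sum[OF clinear_ad_sym] clinear_scale[OF clinear_ad_sym] ad_sym_power
          cvec.scale_sum_right mult.commute)
    moreover have "ad_sym u F = 0" using assms(4) by (simp add: sym_invariants_def)
    moreover have "m - 1 = n + 2" "(of_nat m :: complex) \<noteq> 0" using m by (simp_all del: of_nat_add)
    ultimately have "of_nat m *\<^sub>C (\<Sum>y\<in>I. c y *\<^sub>C (sym_word [bracket u y] * sym_word [y] ^ (n + 2))) = 0"
      by (simp only:)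
    with \<open>of_nat m \<noteq> 0\<close> show ?thesis by (simp only: cvec.scale_eq_0_iff simp_thms)
  qed
  let ?A = "\<lambda>x. \<Sum>s<Suc n. of_nat (Suc s * (Suc n - s)) *\<^sub>C (\<Sum>y\<in>I. c y *\<^sub>C
      (mode (- 1) y ^ s * mode (- 2) (bracket (bracket (bracket x y) y) y) * mode (- 1) y ^ (n - s)))"
  have mode1: "mode 1 x * symm_incl F \<approx> (- 1 / 2) *\<^sub>C ?A x" for x
    unfolding sF m by (rule mode_1_symm_incl_vac_eq[OF inv])
  show ?thesis
    unfolding feigin_frenkel_centre_iff
  proof
    assume *: "\<forall>k\<ge>0. \<forall>x. mode k x * symm_incl F \<approx> 0"
    have "?A x \<approx> 0" for x
    proof -
      have "mode 1 x * symm_incl F \<approx> 0" using * by simp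
      then have "(- 1 / 2) *\<^sub>C ?A x \<approx> 0" by (rule iffD1[OF vac_eq_0_cong[OF mode1[of x]]])
      from vac_eq_scaleC[OF this, of "- 2"] have "(- 2 * (- 1 / 2)) *\<^sub>C ?A x \<approx> 0"
        by (simp only: scaleC_scaleC cvec.scale_zero_right)
      moreover have "- 2 * (- 1 / 2) = (1 :: complex)" by simp
      ultimately show ?thesis by (simp only: scaleC_one)
    qed
    then show "m_map F = 0"
      unfolding mF by (intro m_map_eq_0_if_coefficients_eq_0[OF assms(1)] leading_coefficients_eq_0)
  next
    assume "m_map F = 0"
    then have V: "(\<Sum>y\<in>I. c y *\<^sub>C (mode (- 1) y ^ a * mode k (bracket (bracket (bracket x y) y) y) * mode (- 1) y ^ b)) = 0"
      if "a + b = n" for a b k x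
      using mode_terms_eq_0_if_m_map_eq_0[OF _ that] by (simp add: mF)
    show "\<forall>k\<ge>0. \<forall>x. mode k x * symm_incl F \<approx> 0"
    proof (intro allI impI)
      fix k :: int and x :: 'g assume "0 \<le> k"
      then consider "k = 0" | "k = 1" | "2 \<le> k" by linarith
      then show "mode k x * symm_incl F \<approx> 0"
      proof cases
        case 1
        have "mode 0 x * symm_incl F = (\<Sum>y\<in>I. c y *\<^sub>C (mode 0 x * mode (- 1) y ^ m))"
          by (simp add: sF sum_distrib_left)
        also have "\<dots> \<approx> (\<Sum>y\<in>I. c y *\<^sub>C (\<Sum>p<m. mode (- 1) y ^ p * mode (- 1) (bracket x y) * mode (- 1) y ^ (m - Suc p)))"
          using mode_power_vac_eq[of 0 x _ m] by (intro vac_eq_sum vac_eq_scaleC) simp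
        \<comment> \<open>The commutators with the single factors add up to the symmetrisation of
          the adjoint action of x on F.\<close>
        also have "\<dots> = of_nat m *\<^sub>C symm_incl (\<Sum>y\<in>I. c y *\<^sub>C (sym_word [bracket x y] * sym_word [y] ^ (m - 1)))"
          by (simp only: clinear_sum[OF clinear_symm_incl] clinear_scale[OF clinear_symm_incl] cvec.scale_sum_right
              cvec.scale_left_commute[of "of_nat m"] symm_incl_power_times)
        also have "\<dots> = 0"
          using inv[of x] by (simp add: m clinear_0[OF clinear_symm_incl])
        finally show ?thesis by (simp add: 1)
      next
        case 2
        have "?A x = 0"
          by (intro sum.neutral ballI) (simp add: V)
        with mode1[of x] show ?thesis by (simp add: 2)
      next
        case 3
        have "mode k x * symm_incl F = (\<Sum>y\<in>I. c y *\<^sub>C (mode k x * mode (- 1) y ^ m))"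
          by (simp add: sF sum_distrib_left)
        also have "\<dots> \<approx> (\<Sum>y\<in>I. c y *\<^sub>C (\<Sum>p<m. \<Sum>q<m - Suc p. \<Sum>r<m - Suc p - Suc q. mode (- 1) y ^ (p + q + r)
            * mode (k - 3) (bracket (bracket (bracket x y) y) y) * mode (- 1) y ^ (m - Suc p - Suc q - Suc r)))"
          by (intro vac_eq_sum vac_eq_scaleC mode_ge_2_power_vac_eq[OF 3])
        also have "\<dots> = (\<Sum>p<m. \<Sum>q<m - Suc p. \<Sum>r<m - Suc p - Suc q. \<Sum>y\<in>I. c y *\<^sub>C (mode (- 1) y ^ (p + q + r)
            * mode (k - 3) (bracket (bracket (bracket x y) y) y) * mode (- 1) y ^ (m - Suc p - Suc q - Suc r)))"
          by (simp only: cvec.scale_sum_right sum.swap[of _ _ I])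
        also have "\<dots> = 0"
          \<comment> \<open>Three of the m factors have been used up, so the two exponents add up to
            n in every summand.\<close>
          by (intro sum.neutral ballI V) (simp add: m)
        finally show ?thesis .
      qed
    qed
  qed
qed

end
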